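(* For each integer $n>1$ and each $k\in\mathbb{Z}$, there is a stable ($C_2$-equivariant) equivalence $$\Sigma^{2^{\phi(2n-1)}\rho}\,\mathbb{P}_{k\rho}^{(k+n)\rho}\simeq \mathbb{P}_{(k+2^{\phi(2n-1)})\rho}^{(k+2^{\phi(2n-1)}+n)\rho},$$ where, for a positive integer $j$, $\phi(j)$ denotes the number of integers $s$ with $0<s\leq j$ and $s\equiv 0,1,2,4\pmod 8$.
   Context: $C_2$ is the cyclic group of order two, $\sigma$ its real sign representation, $\rho=1+\sigma$ its regular representation. $\mathbb{P}(n\rho):=S(n\rho)/\text{antipodes}$ with its residual $C_2$-action. Let $\Sigma_2$ be the symmetric group on two letters and $\tau_2$ its real sign representation. The $\rho$-dimensional tautological bundle over $\mathbb{P}(n\rho)$ is the $C_2$-equivariant real vector bundle $$\xi_\rho^{(n)}:\quad S(n\rho\otimes\tau_2)\times_{\Sigma_2}(\rho\otimes\tau_2)\to\mathbb{P}(n\rho).$$ For $n>1$ and $k\in\mathbb{Z}$, the $C_2$-equivariant stunted projective spectrum is the ($C_2$-equivariant) Thom spectrum $$\mathbb{P}_{k\rho}^{(k+n)\rho}:=\mathrm{Th}(k\xi_\rho^{(n)})$$ of the (virtual, if $k<0$) bundle $k\xi_\rho^{(n)}$. $\Sigma^{N\rho}$ denotes suspension by the representation sphere $S^{N\rho}$. A stable equivalence is an equivalence of genuine $C_2$-spectra. *)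

theory Defs
  imports "HOL-Analysis.Analysis"
begin

section \<open>Quotient topologies\<close>

definition quotient_top :: "'a topology \<Rightarrow> ('a \<Rightarrow> 'b) \<Rightarrow> 'b topology" where
  "quotient_top X q =
     topology (\<lambda>U. U \<subseteq> q ` topspace X \<and> openin X {x \<in> topspace X. q x \<in> U})"

lemma openin_quotient_top:
  "openin (quotient_top X q) U \<longleftrightarrow>
     U \<subseteq> q ` topspace X \<and> openin X {x \<in> topspace X. q x \<in> U}"
proof -
  have "istopology (\<lambda>U. U \<subseteq> q ` topspace X \<and> openin X {x \<in> topspace X. q x \<in> U})"
    unfolding istopology_def
  proof (intro conjI allI impI)
    fix S T
    assume S: "S \<subseteq> q ` topspace X \<and> openin X {x \<in> topspace X. q x \<in> S}"
      and T: "T \<subseteq> q ` topspace X \<and> openin X {x \<in> topspace X. q x \<in> T}"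
    have "{x \<in> topspace X. q x \<in> S \<inter> T} =
          {x \<in> topspace X. q x \<in> S} \<inter> {x \<in> topspace X. q x \<in> T}"
      by auto
    then show "openin X {x \<in> topspace X. q x \<in> S \<inter> T}"
      using S T by auto
    show "S \<inter> T \<subseteq> q ` topspace X"
      using S by auto
  next
    fix K
    assume K: "\<forall>S\<in>K. S \<subseteq> q ` topspace X \<and> openin X {x \<in> topspace X. q x \<in> S}"
    have "{x \<in> topspace X. q x \<in> \<Union> K} = (\<Union>S\<in>K. {x \<in> topspace X. q x \<in> S})"
      by auto
    then show "openin X {x \<in> topspace X. q x \<in> \<Union> K}"
      using K by auto
    show "\<Union> K \<subseteq> q ` topspace X"
      using K by auto
  qed
  then show ?thesis
    by (simp add: quotient_top_def topology_inverse')
qed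

lemma quotient_map_quotient_top: "quotient_map X (quotient_top X q) q"
proof -
  have "openin (quotient_top X q) (q ` topspace X)"
  proof -
    have "{x \<in> topspace X. q x \<in> q ` topspace X} = topspace X"
      by auto
    then show ?thesis
      by (simp add: openin_quotient_top)
  qed
  then have "topspace (quotient_top X q) = q ` topspace X"
    by (metis openin_quotient_top openin_subset openin_topspace subset_antisym)
  then show ?thesis
    by (auto simp: quotient_map_def openin_quotient_top)
qed


section \<open>Based \<open>C\<^sub>2\<close>-spaces\<close>

text \<open>The action of \<open>C\<^sub>2\<close> is given by the action of its generator. Actions, maps and bonding
  maps are only meaningful on the relevant \<^const>\<open>topspace\<close>.\<close>

record 'a c2_space =
  pts :: "'a topology"
  bpt :: 'a
  act :: "'a \<Rightarrow> 'a"

datatype c2_subgroup = Trivial_Subgroup | Whole_Group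

definition based_map ::
  "c2_subgroup \<Rightarrow> 'a c2_space \<Rightarrow> 'b c2_space \<Rightarrow> ('a \<Rightarrow> 'b) \<Rightarrow> bool" where
  "based_map H A B f \<longleftrightarrow>
     continuous_map (pts A) (pts B) f \<and> f (bpt A) = bpt B \<and>
     (H = Whole_Group \<longrightarrow> (\<forall>x\<in>topspace (pts A). f (act A x) = act B (f x)))"

definition is_c2_space :: "'a c2_space \<Rightarrow> bool" where
  "is_c2_space A \<longleftrightarrow>
     bpt A \<in> topspace (pts A) \<and> based_map Whole_Group A A (act A) \<and>
     (\<forall>x\<in>topspace (pts A). act A (act A x) = x)"

definition based_homotopic ::
  "c2_subgroup \<Rightarrow> 'a c2_space \<Rightarrow> 'b c2_space \<Rightarrow> ('a \<Rightarrow> 'b) \<Rightarrow> ('a \<Rightarrow> 'b) \<Rightarrow> bool" where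
  "based_homotopic H A B f g \<longleftrightarrow> homotopic_with (based_map H A B) (pts A) (pts B) f g"

text \<open>Smash products: \<^const>\<open>None\<close> is the base point, and \<^term>\<open>Some (x, y)\<close> represents
  \<open>x \<and> y\<close> when neither \<open>x\<close> nor \<open>y\<close> is a base point.\<close>

definition smash_proj :: "'a c2_space \<Rightarrow> 'b c2_space \<Rightarrow> 'a \<times> 'b \<Rightarrow> ('a \<times> 'b) option" where
  "smash_proj A B = (\<lambda>(x, y). if x = bpt A \<or> y = bpt B then None else Some (x, y))"

definition smash :: "'a c2_space \<Rightarrow> 'b c2_space \<Rightarrow> ('a \<times> 'b) option c2_space" where
  "smash A B =
     \<lparr>pts = quotient_top (prod_topology (pts A) (pts B)) (smash_proj A B),
      bpt = None,
      act = map_option (map_prod (act A) (act B))\<rparr>"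

definition smash_map ::
  "'c c2_space \<Rightarrow> 'd c2_space \<Rightarrow> ('a \<Rightarrow> 'c) \<Rightarrow> ('b \<Rightarrow> 'd) \<Rightarrow>
   ('a \<times> 'b) option \<Rightarrow> ('c \<times> 'd) option" where
  "smash_map C D f g z =
     (case z of None \<Rightarrow> None | Some (x, y) \<Rightarrow> smash_proj C D (f x, g y))"


section \<open>Representations and representation spheres\<close>

text \<open>A pair \<open>(u, v)\<close> with \<open>u \<in> \<real>\<^sup>p\<close>, \<open>v \<in> \<real>\<^sup>q\<close> is a vector of the representation
  \<open>p + q\<sigma>\<close>; in particular \<open>m\<rho>\<close> is \<open>rep m m\<close>.\<close>

type_synonym vec = "(nat \<Rightarrow> real) \<times> (nat \<Rightarrow> real)"

definition rep :: "nat \<Rightarrow> nat \<Rightarrow> vec topology" where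
  "rep p q = prod_topology (Euclidean_space p) (Euclidean_space q)"

definition flip :: "vec \<Rightarrow> vec" where
  "flip = (\<lambda>(u, v). (u, \<lambda>i. - v i))"

definition neg :: "vec \<Rightarrow> vec" where
  "neg = (\<lambda>(u, v). (\<lambda>i. - u i, \<lambda>i. - v i))"

definition dot :: "nat \<Rightarrow> vec \<Rightarrow> vec \<Rightarrow> real" where
  "dot m x y = (\<Sum>i<m. fst x i * fst y i) + (\<Sum>i<m. snd x i * snd y i)"

definition rep_sphere :: "nat \<Rightarrow> nat \<Rightarrow> vec option c2_space" where
  "rep_sphere p q =
     \<lparr>pts = Alexandroff_compactification (rep p q), bpt = None, act = map_option flip\<rparr>"

abbreviation rho_sphere :: "nat \<Rightarrow> vec option c2_space" where
  "rho_sphere m \<equiv> rep_sphere m m"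

text \<open>The identification \<open>S\<^sup>\<rho> \<and> S\<^bsup>p + q\<sigma>\<^esup> \<cong> S\<^bsup>(p+1) + (q+1)\<sigma>\<^esup>\<close>, which appends the coordinates
  of \<open>\<rho>\<close> as the last ones, and its inverse.\<close>

definition stack :: "nat \<Rightarrow> nat \<Rightarrow> (vec option \<times> vec option) option \<Rightarrow> vec option" where
  "stack p q z =
     (case z of Some (Some (a, b), Some (u, v)) \<Rightarrow> Some (u(p := a 0), v(q := b 0)) | _ \<Rightarrow> None)"

definition unstack :: "nat \<Rightarrow> nat \<Rightarrow> vec option \<Rightarrow> (vec option \<times> vec option) option" where
  "unstack p q z =
     (case z of None \<Rightarrow> None
      | Some (u, v) \<Rightarrow>
          Some (Some ((\<lambda>_. 0)(0 := u p), (\<lambda>_. 0)(0 := v q)), Some (u(p := 0), v(q := 0))))"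


section \<open>Genuine \<open>C\<^sub>2\<close>-spectra\<close>

text \<open>Genuine \<open>C\<^sub>2\<close>-spectra are modelled by prespectra indexed on the cofinal sequence
  \<open>0 \<subset> \<rho> \<subset> 2\<rho> \<subset> \<dots>\<close> of the complete universe \<open>\<infinity>\<rho>\<close>: the space of index \<open>m\<close> sits at \<open>m\<rho>\<close>,
  and the bonding maps are based \<open>C\<^sub>2\<close>-maps \<open>S\<^sup>\<rho> \<and> X\<^sub>m \<rightarrow> X\<^bsub>m+1\<^esub>\<close>.\<close>

record 'a c2_spectrum =
  level :: "nat \<Rightarrow> 'a c2_space"
  bond :: "nat \<Rightarrow> (vec option \<times> 'a) option \<Rightarrow> 'a"

definition is_spectrum :: "'a c2_spectrum \<Rightarrow> bool" where
  "is_spectrum X \<longleftrightarrow>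
     (\<forall>m. is_c2_space (level X m) \<and>
          based_map Whole_Group (smash (rho_sphere 1) (level X m)) (level X (Suc m)) (bond X m))"

definition spectrum_map ::
  "'a c2_spectrum \<Rightarrow> 'b c2_spectrum \<Rightarrow> (nat \<Rightarrow> 'a \<Rightarrow> 'b) \<Rightarrow> bool" where
  "spectrum_map X Y f \<longleftrightarrow>
     (\<forall>m. based_map Whole_Group (level X m) (level Y m) (f m) \<and>
          (\<forall>z\<in>topspace (pts (smash (rho_sphere 1) (level X m))).
             f (Suc m) (bond X m z) =
             bond Y m (smash_map (rho_sphere 1) (level Y m) id (f m) z)))"

text \<open>The homotopy group \<open>\<pi>\<^sub>k\<^sup>H(X)\<close>, \<open>k \<in> \<int>\<close>, is the colimit over \<open>m\<close> of the sets
  \<open>[S\<^bsup>k + m\<rho>\<^esup>, X\<^sub>m]\<^sup>H\<close> with \<open>k + m \<ge> 0\<close>, where \<open>k + m\<rho> = (k + m) + m\<sigma>\<close>. An element is a class of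
  pairs \<open>(m, \<alpha>)\<close> that become homotopic after finitely many suspensions by \<open>\<rho>\<close>.\<close>

definition stem_sphere :: "int \<Rightarrow> nat \<Rightarrow> vec option c2_space" where
  "stem_sphere k m = rep_sphere (nat (k + int m)) m"

primrec stabilise ::
  "'a c2_spectrum \<Rightarrow> int \<Rightarrow> nat \<Rightarrow> (vec option \<Rightarrow> 'a) \<Rightarrow> nat \<Rightarrow> vec option \<Rightarrow> 'a" where
  "stabilise X k m \<alpha> 0 = \<alpha>"
| "stabilise X k m \<alpha> (Suc r) =
     bond X (m + r) \<circ>
     smash_map (rho_sphere 1) (level X (m + r)) id (stabilise X k m \<alpha> r) \<circ>
     unstack (nat (k + int (m + r))) (m + r)"

definition stems ::
  "'a c2_spectrum \<Rightarrow> c2_subgroup \<Rightarrow> int \<Rightarrow> (nat \<times> (vec option \<Rightarrow> 'a)) set" where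
  "stems X H k =
     {(m, \<alpha>). 0 \<le> k + int m \<and> based_map H (stem_sphere k m) (level X m) \<alpha>}"

definition stably_homotopic ::
  "'a c2_spectrum \<Rightarrow> c2_subgroup \<Rightarrow> int \<Rightarrow> (nat \<times> (vec option \<Rightarrow> 'a)) rel" where
  "stably_homotopic X H k =
     {((m, \<alpha>), (m', \<alpha>')). (m, \<alpha>) \<in> stems X H k \<and> (m', \<alpha>') \<in> stems X H k \<and>
        (\<exists>r r'. m + r = m' + r' \<and>
           based_homotopic H (stem_sphere k (m + r)) (level X (m + r))
             (stabilise X k m \<alpha> r) (stabilise X k m' \<alpha>' r'))}"

definition homotopy_group ::
  "'a c2_spectrum \<Rightarrow> c2_subgroup \<Rightarrow> int \<Rightarrow> (nat \<times> (vec option \<Rightarrow> 'a)) set set" where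
  "homotopy_group X H k = stems X H k // stably_homotopic X H k"

definition induced_map ::
  "'b c2_spectrum \<Rightarrow> (nat \<Rightarrow> 'a \<Rightarrow> 'b) \<Rightarrow> c2_subgroup \<Rightarrow> int \<Rightarrow>
   (nat \<times> (vec option \<Rightarrow> 'a)) set \<Rightarrow> (nat \<times> (vec option \<Rightarrow> 'b)) set" where
  "induced_map Y f H k c = (\<Union>(m, \<alpha>)\<in>c. stably_homotopic Y H k `` {(m, f m \<circ> \<alpha>)})"

definition pi_isomorphism ::
  "'a c2_spectrum \<Rightarrow> 'b c2_spectrum \<Rightarrow> (nat \<Rightarrow> 'a \<Rightarrow> 'b) \<Rightarrow> bool" where
  "pi_isomorphism X Y f \<longleftrightarrow>
     is_spectrum X \<and> is_spectrum Y \<and> spectrum_map X Y f \<and>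
     (\<forall>H k. bij_betw (induced_map Y f H k) (homotopy_group X H k) (homotopy_group Y H k))"

definition pi_isomorphic_to :: "'a c2_spectrum \<Rightarrow> 'b c2_spectrum \<Rightarrow> bool" where
  "pi_isomorphic_to X Y \<longleftrightarrow> (\<exists>f. pi_isomorphism X Y f)"

text \<open>Two spectra are stably equivalent (isomorphic in the genuine stable homotopy category) iff
  they are joined by a zigzag of \<open>\<pi>\<^sub>*\<close>-isomorphisms. HOL has no quantification over types, so the
  intermediate spectra have their points in one type, \<^typ>\<open>real \<Rightarrow> 'a + 'b\<close>. This is no
  restriction: its cardinality is \<open>(|'a| + |'b|)\<^sup>c\<close> with \<open>c\<close> the cardinality of the continuum, so
  it has room for copies of \<open>X\<close> and \<open>Y\<close> as well as for their cellular replacements and the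
  associated \<open>\<Omega>\<close>-spectra, and \<open>X \<leftarrow> QX \<rightarrow> RY \<leftarrow> Y\<close> with \<open>QX\<close> cellular and \<open>RY\<close> an
  \<open>\<Omega>\<close>-spectrum realises every isomorphism \<open>X \<cong> Y\<close> of the homotopy category.\<close>

definition stably_equivalent :: "'a c2_spectrum \<Rightarrow> 'b c2_spectrum \<Rightarrow> bool"
    (infix "\<simeq>\<^sub>s" 50) where
  "X \<simeq>\<^sub>s Y \<longleftrightarrow>
     (\<exists>Z W :: (real \<Rightarrow> 'a + 'b) c2_spectrum.
        pi_isomorphic_to Z X \<and> equivclp pi_isomorphic_to Z W \<and> pi_isomorphic_to W Y)"

text \<open>The suspension \<open>\<Sigma>\<^bsup>N\<rho>\<^esup> X\<close>, with levels \<open>S\<^bsup>N\<rho>\<^esup> \<and> X\<^sub>m\<close> and bonding maps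
  \<open>S\<^sup>\<rho> \<and> S\<^bsup>N\<rho>\<^esup> \<and> X\<^sub>m \<cong> S\<^bsup>N\<rho>\<^esup> \<and> S\<^sup>\<rho> \<and> X\<^sub>m \<rightarrow> S\<^bsup>N\<rho>\<^esup> \<and> X\<^bsub>m+1\<^esub>\<close>.\<close>

definition suspension :: "nat \<Rightarrow> 'a c2_spectrum \<Rightarrow> (vec option \<times> 'a) option c2_spectrum" where
  "suspension N X =
     \<lparr>level = (\<lambda>m. smash (rho_sphere N) (level X m)),
      bond = (\<lambda>m z. case z of
        Some (s, Some (t, x)) \<Rightarrow>
          smash_proj (rho_sphere N) (level X (Suc m)) (t, bond X m (Some (s, x)))
      | _ \<Rightarrow> None)\<rparr>"

text \<open>The desuspended suspension spectrum \<open>\<Sigma>\<^bsup>-N\<rho>\<^esup> \<Sigma>\<^sup>\<infinity> A\<close>, with levels \<open>S\<^bsup>(m-N)\<rho>\<^esup> \<and> A\<close> for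
  \<open>m \<ge> N\<close> and a point for \<open>m < N\<close>.\<close>

definition shifted_suspension_spectrum ::
  "nat \<Rightarrow> 'a c2_space \<Rightarrow> (vec option \<times> 'a) option c2_spectrum" where
  "shifted_suspension_spectrum N A =
     \<lparr>level = (\<lambda>m.
        if m < N then \<lparr>pts = discrete_topology {None}, bpt = None, act = id\<rparr>
        else smash (rho_sphere (m - N)) A),
      bond = (\<lambda>m z.
        if m < N then None
        else case z of
          Some (s, Some (t, x)) \<Rightarrow>
            smash_proj (rho_sphere (Suc m - N)) A (stack (m - N) (m - N) (Some (s, t)), x)
        | _ \<Rightarrow> None)\<rparr>"


section \<open>Bundles and Thom spectra\<close>

record ('b, 'e) c2_bundle =
  base_pts :: "'b topology"
  base_act :: "'b \<Rightarrow> 'b"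
  total_pts :: "'e topology"
  total_act :: "'e \<Rightarrow> 'e"
  proj :: "'e \<Rightarrow> 'b"

text \<open>The Whitney sum of \<open>k\<close> copies of a bundle is its \<open>k\<close>-fold fibre power over the base.\<close>

definition whitney_power ::
  "nat \<Rightarrow> ('b, 'e) c2_bundle \<Rightarrow> ('b, 'b \<times> (nat \<Rightarrow> 'e)) c2_bundle" where
  "whitney_power k E =
     \<lparr>base_pts = base_pts E,
      base_act = base_act E,
      total_pts =
        subtopology (prod_topology (base_pts E) (product_topology (\<lambda>_. total_pts E) {..<k}))
          {(b, e). \<forall>i<k. proj E (e i) = b},
      total_act = (\<lambda>(b, e). (base_act E b, \<lambda>i\<in>{..<k}. total_act E (e i))),
      proj = fst\<rparr>"

text \<open>All base spaces below are compact, so that the Thom space is the one-point compactification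
  of the total space.\<close>

definition thom_space :: "('b, 'e) c2_bundle \<Rightarrow> 'e option c2_space" where
  "thom_space E =
     \<lparr>pts = Alexandroff_compactification (total_pts E), bpt = None,
      act = map_option (total_act E)\<rparr>"

definition unit_sphere :: "nat \<Rightarrow> vec topology" where
  "unit_sphere n = subtopology (rep n n) {x. dot n x x = 1}"

definition antipodal_class :: "vec \<Rightarrow> vec set" where
  "antipodal_class x = {x, neg x}"

definition projective_space :: "nat \<Rightarrow> vec set topology" where
  "projective_space n = quotient_top (unit_sphere n) antipodal_class"

text \<open>The tautological bundle \<open>S(n\<rho> \<otimes> \<tau>\<^sub>2) \<times>\<^bsub>\<Sigma>\<^sub>2\<^esub> (\<rho> \<otimes> \<tau>\<^sub>2)\<close>.\<close>

definition tautological_bundle :: "nat \<Rightarrow> (vec set, (vec \<times> vec) set) c2_bundle" where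
  "tautological_bundle n =
     \<lparr>base_pts = projective_space n,
      base_act = image flip,
      total_pts = quotient_top (prod_topology (unit_sphere n) (rep 1 1))
                    (\<lambda>(x, y). {(x, y), (neg x, neg y)}),
      total_act = image (map_prod flip flip),
      proj = image fst\<rparr>"

text \<open>The tensor product \<open>n\<rho> \<otimes> \<rho> \<rightarrow> 2n\<rho>\<close>. For \<open>x = (a, b)\<close> and \<open>y = (c, d)\<close> the products \<open>ac\<close>
  and \<open>bd\<close> are fixed by \<open>C\<^sub>2\<close>, whereas \<open>bc\<close> and \<open>ad\<close> change sign.\<close>

definition tensor :: "nat \<Rightarrow> vec \<Rightarrow> vec \<Rightarrow> vec" where
  "tensor n x y =
     (case x of (a, b) \<Rightarrow> case y of (c, d) \<Rightarrow>
       (\<lambda>i. if i < n then a i * c 0 else if i < 2 * n then b (i - n) * d 0 else 0,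
        \<lambda>i. if i < n then b i * c 0 else if i < 2 * n then a (i - n) * d 0 else 0))"

lemma flip_tensor: "flip (tensor n x y) = tensor n (flip x) (flip y)"
  by (cases x; cases y) (auto simp: flip_def tensor_def fun_eq_iff)

lemma tensor_neg_neg: "tensor n (neg x) (neg y) = tensor n x y"
  by (cases x; cases y) (auto simp: neg_def tensor_def fun_eq_iff)

lemma dot_tensor:
  "dot (2 * n) (tensor n x y) (tensor n x' y') = dot n x x' * dot 1 y y'"
proof -
  have split: "(\<Sum>i<2 * n. f i) = (\<Sum>i<n. f i) + (\<Sum>i<n. f (n + i))" for f :: "nat \<Rightarrow> real"
    using sum.atLeastLessThan_concat[of 0 n "2 * n" f]
      sum.shift_bounds_nat_ivl[of f 0 n n]
    by (simp add: atLeast0LessThan mult_2 add.commute)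
  obtain a b c d a' b' c' d' where
    "x = (a, b)" "y = (c, d)" "x' = (a', b')" "y' = (c', d')"
    by (metis surj_pair)
  then show ?thesis
    unfolding dot_def split
    by (simp add: tensor_def sum_distrib_left sum_distrib_right algebra_simps)
qed

text \<open>By the lemmas above \<open>[x, y] \<mapsto> ([x], x \<otimes> y)\<close> is an equivariant fibrewise isometric
  embedding of the tautological bundle \<open>\<xi>\<close> into the trivial bundle \<open>\<P>(n\<rho>) \<times> 2n\<rho>\<close>. The following
  bundle is the orthogonal complement \<open>\<xi>\<^sup>\<bottom>\<close> of its image; the point \<open>([x], w)\<close> is written as
  \<open>{(x, w), (-x, w)}\<close>.\<close>

definition complement_bundle :: "nat \<Rightarrow> (vec set, (vec \<times> vec) set) c2_bundle" where
  "complement_bundle n =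
     \<lparr>base_pts = projective_space n,
      base_act = image flip,
      total_pts =
        quotient_top
          (subtopology (prod_topology (unit_sphere n) (rep (2 * n) (2 * n)))
            {(x, w). \<forall>y\<in>topspace (rep 1 1). dot (2 * n) w (tensor n x y) = 0})
          (\<lambda>(x, w). {(x, w), (neg x, w)}),
      total_act = image (map_prod flip flip),
      proj = image fst\<rparr>"

text \<open>The Thom spectrum of the virtual bundle \<open>E - N\<rho>\<close>, where \<open>N\<rho>\<close> denotes the trivial bundle.\<close>

definition thom_spectrum ::
  "('b, 'e) c2_bundle \<Rightarrow> nat \<Rightarrow> (vec option \<times> 'e option) option c2_spectrum" where
  "thom_spectrum E N = shifted_suspension_spectrum N (thom_space E)"

text \<open>The stunted projective spectrum \<open>\<P>\<^bsub>k\<rho>\<^esub>\<^bsup>(k+n)\<rho>\<^esup> = Th(k\<xi>)\<close>. If \<open>k = -l < 0\<close>, then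
  \<open>k\<xi> = l\<xi>\<^sup>\<bottom> - 2nl\<rho>\<close> because \<open>\<xi> \<oplus> \<xi>\<^sup>\<bottom> = 2n\<rho>\<close>.\<close>

definition stunted_projective_spectrum ::
  "nat \<Rightarrow> int \<Rightarrow>
   (vec option \<times> (vec set \<times> (nat \<Rightarrow> (vec \<times> vec) set)) option) option c2_spectrum" where
  "stunted_projective_spectrum n k =
     (if 0 \<le> k then thom_spectrum (whitney_power (nat k) (tautological_bundle n)) 0
      else thom_spectrum (whitney_power (nat (- k)) (complement_bundle n)) (2 * n * nat (- k)))"

definition \<phi> :: "nat \<Rightarrow> nat" where
  "\<phi> j = card {s. 0 < s \<and> s \<le> j \<and> s mod 8 \<in> {0, 1, 2, 4}}"

end

theory Submission
  imports Defs
begin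

text \<open>Write \<open>\<xi>\<close> for the tautological bundle over \<open>\<P>(n\<rho>)\<close>, \<open>\<xi>\<^sup>\<bottom>\<close> for its complement in the trivial bundle
  with fibre \<open>V = 2n\<rho>\<close>, and \<open>N = 2\<^bsup>\<phi>(2n-1)\<^esup>\<close>. The periodicity holds because the bundle \<open>N\<xi>\<close> is
  equivariantly trivial, \<open>N\<xi> \<cong> \<P>(n\<rho>) \<times> N\<rho>\<close>: adding \<open>N\<close> copies of \<open>\<xi>\<close> to \<open>k\<xi>\<close> then has the effect of an
  \<open>N\<rho>\<close>-fold suspension on Thom spectra.

  The trivialisation comes from Clifford modules. By the theory of Radon and Hurwitz there are \<open>2n\<close>
  orthogonal \<open>N \<times> N\<close> matrices \<open>C\<^sub>j\<close> whose real linear combinations are all similarities. They are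
  realised as signed permutation matrices, which reduces their existence to a combinatorial problem
  over the field with two elements; the period \<open>8\<close> of \<open>\<phi>\<close> appears there as a way to join two solutions
  (\<open>equidistant_join\<close>). Non-equivariantly, \<open>[x, y] \<mapsto> (\<Sum> x\<^sub>j C\<^sub>j) y\<close> trivialises \<open>N\<close> times the
  tautological line bundle over the real projective space of dimension \<open>2n - 1\<close>. For
  \<open>x = (a, b) \<in> n\<rho>\<close> the matrices \<open>K = \<Sum> a\<^sub>j C\<^sub>j\<close> and \<open>L = \<Sum> b\<^sub>j C\<^bsub>n+j\<^esub>\<close> satisfy \<open>K\<^sup>T L + L\<^sup>T K = 0\<close> and
  \<open>K\<^sup>T K + L\<^sup>T L = |x|\<^sup>2\<close>, so that the block matrix with rows \<open>(K, L)\<close> and \<open>(L, K)\<close> is a similarity of \<open>N\<rho>\<close>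
  of ratio \<open>|x|\<close>; it is equivariant in \<open>x\<close>, and therefore trivialises \<open>N\<xi>\<close> over \<open>\<P>(n\<rho>)\<close>
  (\<open>part_orthogonal\<close>, \<open>theta_theta_inv\<close>, \<open>theta_flip\<close>).

  A negative multiple \<open>-l\<xi>\<close> is represented by \<open>l\<xi>\<^sup>\<bottom> - lV\<close>. Combining the trivialisation with
  \<open>\<xi> \<oplus> \<xi>\<^sup>\<bottom> = V\<close> gives homeomorphisms of total spaces
  \<open>N\<rho> \<times> k\<xi> \<cong> (k+N)\<xi>\<close>, \<open>N\<rho> \<times> l\<xi>\<^sup>\<bottom> \<cong> lV \<times> (N-l)\<xi>\<close> for \<open>l \<le> N\<close>, and
  \<open>N\<rho> \<times> l\<xi>\<^sup>\<bottom> \<cong> NV \<times> (l-N)\<xi>\<^sup>\<bottom>\<close> for \<open>l \<ge> N\<close>; all three are cases of \<open>whitney_power_homeomorphism\<close>.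

  Smash products of one-point compactifications are one-point compactifications of products, so
  such a homeomorphism \<open>N\<rho> \<times> X \<cong> M\<rho> \<times> Y\<close> induces equivariant homeomorphisms between the levels of
  \<open>\<Sigma>\<^bsup>N\<rho>\<^esup> \<Sigma>\<^bsup>-(M+q)\<rho>\<^esup> X\<^sup>+\<close> and \<open>\<Sigma>\<^bsup>-q\<rho>\<^esup> Y\<^sup>+\<close> from level \<open>M + q\<close> on, compatibly with the bonding maps
  (\<open>suspension_shifted_suspension_spectrum_equivalent\<close>). Finally, a map of spectra that is a
  homeomorphism in all sufficiently high levels induces isomorphisms on all homotopy groups
  (\<open>pi_isomorphism_eventually_homeomorphic\<close>).\<close>



section \<open>Families of orthogonal matrices of Radon-Hurwitz type\<close>

text \<open>The pair \<open>(P, S)\<close> of finite sets stands for the signed permutation matrix that sends the basis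
  vector \<open>I \<triangle> P\<close> to \<open>(-1)\<^bsup>|S \<inter> I|\<^esup> I\<close>, where the basis is indexed by the subsets \<open>I\<close> of
  \<open>{0, \<dots>, m-1}\<close>. In terms of tensor products, \<open>P\<close> records the factors containing a coordinate swap
  and \<open>S\<close> those containing a reflection. For two such matrices \<open>A\<close> and \<open>B\<close>, the matrix \<open>A\<^sup>T B\<close> is
  skew-symmetric iff the quadratic form \<open>(P, S) \<mapsto> |P \<inter> S| mod 2\<close> takes the value \<open>1\<close> on the
  difference of the two pairs; so what is needed are equidistant families in a quadratic space over
  the field with two elements.\<close>

definition equidistant :: "nat \<Rightarrow> nat \<Rightarrow> (nat \<Rightarrow> nat set) \<Rightarrow> (nat \<Rightarrow> nat set) \<Rightarrow> bool" where
  "equidistant r m P S \<longleftrightarrow>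
     (\<forall>j<r. P j \<subseteq> {..<m} \<and> S j \<subseteq> {..<m}) \<and>
     (\<forall>i<r. \<forall>j<r. i \<noteq> j \<longrightarrow> odd (card (sym_diff (P i) (P j) \<inter> sym_diff (S i) (S j))))"

text \<open>The matrices belonging to the following families generate, up to isomorphism, the actions of the
  complex numbers, the quaternions and the octonions on themselves. The first components are the
  binary expansions of \<open>j\<close>, and the first matrix is the identity.\<close>

lemma equidistant_2: "equidistant 2 1 ((!) [{}, {0}]) ((!) [{}, {0}])"
  unfolding equidistant_def by (auto simp: less_Suc_eq numeral_eq_Suc)

lemma equidistant_4:
  "equidistant 4 2 ((!) [{}, {0}, {1}, {0,1}]) ((!) [{}, {0}, {0,1}, {1}])"
proof -
  have all: "(\<forall>i<4. Q i) \<longleftrightarrow> Q 0 \<and> Q 1 \<and> Q 2 \<and> Q 3" for Q :: "nat \<Rightarrow> bool"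
    by (simp add: eval_nat_numeral All_less_Suc conj_ac)
  show ?thesis
    unfolding equidistant_def all by (simp add: insert_Diff_if Int_insert_left)
qed

lemma equidistant_8:
  "equidistant 8 3 ((!) [{}, {0}, {1}, {0,1}, {2}, {0,2}, {1,2}, {0,1,2}])
     ((!) [{}, {0}, {0,1}, {1,2}, {0,1,2}, {2}, {0,2}, {1}])"
proof -
  have all: "(\<forall>i<8. Q i) \<longleftrightarrow> Q 0 \<and> Q 1 \<and> Q 2 \<and> Q 3 \<and> Q 4 \<and> Q 5 \<and> Q 6 \<and> Q 7"
    for Q :: "nat \<Rightarrow> bool"
    by (simp add: eval_nat_numeral All_less_Suc conj_ac)
  show ?thesis
    unfolding equidistant_def all by (simp add: insert_Diff_if Int_insert_left)
qed

lemma equidistant_mono: "equidistant r m P S \<Longrightarrow> r' \<le> r \<Longrightarrow> equidistant r' m P S"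
  unfolding equidistant_def by (meson less_le_trans)

text \<open>This is the mechanism of Bott periodicity; with \<open>r' = 8\<close> and \<open>m' = 3\<close> it passes from \<open>n\<close> to \<open>n + 4\<close>.
  Members of the first family may be reflected in the new bit \<open>m + m'\<close>, which changes nothing among
  themselves; members of the second family swap the new bit. A mixed difference has the form
  \<open>v + w + x\<close>, where \<open>x\<close> is a pair on the new bit that can be chosen to make the total value of the
  quadratic form \<open>1\<close>.\<close>

lemma equidistant_join:
  assumes v: "equidistant r m P S" and w: "equidistant r' m' P' S'"
  shows "\<exists>P'' S''. equidistant (r + r') (m + m' + 1) P'' S''"
proof -
  define t where "t = m + m'"
  define Q where "Q = (\<lambda>j. odd (card (P j \<inter> S j)))"
  define Q' where "Q' = (\<lambda>j. odd (card (P' j \<inter> S' j)))"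
  define p where "p = (\<lambda>j. if j < r then P j else insert t ((+) m ` P' (j - r)))"
  define s where "s = (\<lambda>j. if j < r then S j \<union> (if Q j then {t} else {})
      else (+) m ` S' (j - r) \<union> (if Q' (j - r) then {} else {t}))"
  have P: "P j \<subseteq> {..<m}" "S j \<subseteq> {..<m}" if "j < r" for j
    using v that by (auto simp: equidistant_def)
  have P': "P' j \<subseteq> {..<m'}" "S' j \<subseteq> {..<m'}" if "j < r'" for j
    using w that by (auto simp: equidistant_def)
  have fin: "finite (P j)" "finite (S j)" if "j < r" for j
    using P that by (meson finite_lessThan finite_subset)+
  have fin': "finite (P' j)" "finite (S' j)" if "j < r'" for j
    using P' that by (meson finite_lessThan finite_subset)+
  have mixed: "odd (card (sym_diff (p i) (p (r + j)) \<inter> sym_diff (s i) (s (r + j))))"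
    if "i < r" "j < r'" for i j
  proof -
    \<comment> \<open>the values of the quadratic form on \<open>v\<close>, \<open>w\<close> and \<open>x\<close>, supported on disjoint sets of bits\<close>
    let ?X = "P i \<inter> S i" and ?Y = "(+) m ` (P' j \<inter> S' j)"
      and ?T = "if Q i = Q' j then {t} else {}"
    have "sym_diff (p i) (p (r + j)) \<inter> sym_diff (s i) (s (r + j)) = ?X \<union> ?Y \<union> ?T"
    proof -
      have gen: "sym_diff A (insert t A') \<inter> sym_diff (B \<union> (if q then {t} else {})) (B' \<union> (if q' then {} else {t})) =
          (A \<inter> B) \<union> (A' \<inter> B') \<union> (if q = q' then {t} else {})"
        if "A \<inter> A' = {}" "A \<inter> B' = {}" "B \<inter> A' = {}" "B \<inter> B' = {}"
          "t \<notin> A" "t \<notin> B" "t \<notin> A'" "t \<notin> B'" for A A' B B' and q q' :: bool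
        using that by (cases q; cases q') (simp; blast)+
      have "P i \<inter> (+) m ` P' j = {}" "P i \<inter> (+) m ` S' j = {}" "S i \<inter> (+) m ` P' j = {}"
        "S i \<inter> (+) m ` S' j = {}" "t \<notin> P i" "t \<notin> S i" "t \<notin> (+) m ` P' j" "t \<notin> (+) m ` S' j"
        using P[OF that(1)] P'[OF that(2)] by (auto simp: t_def)
      note gen[OF this, of "Q i" "Q' j"]
      then show ?thesis using that by (simp add: p_def s_def image_Int)
    qed
    moreover have "card (?X \<union> ?Y \<union> ?T) = card ?X + card ?Y + card ?T"
    proof -
      have "card (?X \<union> ?Y \<union> ?T) = card (?X \<union> ?Y) + card ?T"
        by (rule card_Un_disjoint) (use that P[OF that(1)] P'[OF that(2)] fin[OF that(1)] fin'[OF that(2)] in \<open>auto simp: t_def\<close>)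
      moreover have "card (?X \<union> ?Y) = card ?X + card ?Y"
        by (rule card_Un_disjoint) (use that P[OF that(1)] P'[OF that(2)] fin[OF that(1)] fin'[OF that(2)] in \<open>auto\<close>)
      ultimately show ?thesis by simp
    qed
    moreover have "card ?Y = card (P' j \<inter> S' j)" by (simp add: card_image)
    ultimately show ?thesis by (auto simp: Q_def Q'_def)
  qed
  have "odd (card (sym_diff (p i) (p j) \<inter> sym_diff (s i) (s j)))"
    if ij: "i < r + r'" "j < r + r'" "i \<noteq> j" for i j
  proof -
    consider "i < r" "j < r" | "i < r" "j \<ge> r" | "i \<ge> r" "j < r" | "i \<ge> r" "j \<ge> r" by linarith
    then show ?thesis
    proof cases
      case 1
      then have "sym_diff (p i) (p j) \<inter> sym_diff (s i) (s j) =
          sym_diff (P i) (P j) \<inter> sym_diff (S i) (S j)"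
        using P[of i] P[of j] by (auto simp: p_def s_def t_def)
      then show ?thesis using v 1 ij by (simp add: equidistant_def)
    next
      case 2
      then show ?thesis using mixed[of i "j - r"] ij by simp
    next
      case 3
      then show ?thesis using mixed[of j "i - r"] ij by (simp add: Un_commute)
    next
      case 4
      then have "sym_diff (p i) (p j) \<inter> sym_diff (s i) (s j) =
          (+) m ` (sym_diff (P' (i - r)) (P' (j - r)) \<inter> sym_diff (S' (i - r)) (S' (j - r)))"
      proof -
        have gen: "sym_diff (insert t A) (insert t A') \<inter>
            sym_diff (B \<union> (if q then {} else {t})) (B' \<union> (if q' then {} else {t})) =
            sym_diff A A' \<inter> sym_diff B B'"
          if "t \<notin> A" "t \<notin> B" "t \<notin> A'" "t \<notin> B'" for A A' B B' and q q' :: bool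
          using that by (cases q; cases q') (simp; blast)+
        have "t \<notin> (+) m ` P' (i - r)" "t \<notin> (+) m ` S' (i - r)"
          "t \<notin> (+) m ` P' (j - r)" "t \<notin> (+) m ` S' (j - r)"
          using P'(1,2)[of "i - r"] P'(1,2)[of "j - r"] 4 ij by (force simp: t_def)+
        note gen[OF this, of "Q' (i - r)" "Q' (j - r)"]
        then show ?thesis using 4 by (simp add: p_def s_def image_Int image_Un image_set_diff)
      qed
      moreover have "i - r < r'" "j - r < r'" "i - r \<noteq> j - r" using 4 ij by auto
      ultimately show ?thesis using w unfolding equidistant_def by (simp add: card_image)
    qed
  qed
  moreover have "p j \<subseteq> {..<m + m' + 1} \<and> s j \<subseteq> {..<m + m' + 1}" if "j < r + r'" for j
  proof (cases "j < r")
    case True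
    then have "P j \<subseteq> {..<m + m' + 1}" "S j \<subseteq> {..<m + m' + 1}"
      using P[OF True] by force+
    then show ?thesis using True by (simp add: p_def s_def t_def)
  next
    case False
    then have "j - r < r'" using that by simp
    then show ?thesis using P'[of "j - r"] False by (auto simp: p_def s_def t_def)
  qed
  ultimately have "equidistant (r + r') (m + m' + 1) p s"
    by (simp add: equidistant_def)
  then show ?thesis by blast
qed

lemma \<phi>_0: "\<phi> 0 = 0"
proof -
  have "{s::nat. 0 < s \<and> s \<le> 0 \<and> s mod 8 \<in> {0, 1, 2, 4}} = {}" by auto
  then show ?thesis by (simp only: \<phi>_def card.empty)
qed

lemma \<phi>_Suc: "\<phi> (Suc j) = \<phi> j + (if Suc j mod 8 \<in> {0, 1, 2, 4} then 1 else 0)"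
proof -
  let ?A = "\<lambda>j. {s. 0 < s \<and> s \<le> j \<and> s mod 8 \<in> {0, 1, 2, 4::nat}}"
  have "?A (Suc j) = ?A j \<union> (if Suc j mod 8 \<in> {0, 1, 2, 4} then {Suc j} else {})"
    by (auto simp: le_Suc_eq)
  moreover have "finite (?A j)" by (rule finite_subset[of _ "{..j}"]) auto
  ultimately show ?thesis unfolding \<phi>_def by (simp add: card_insert_if)
qed

lemma \<phi>_small: "\<phi> 1 = 1" "\<phi> 3 = 2" "\<phi> 5 = 3" "\<phi> 7 = 3" "\<phi> 8 = 4"
proof -
  show 1: "\<phi> 1 = 1" using \<phi>_Suc[of 0] \<phi>_0 by simp
  have 2: "\<phi> 2 = 2" using \<phi>_Suc[of 1] 1 by (simp add: numeral_2_eq_2)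
  show 3: "\<phi> 3 = 2" using \<phi>_Suc[of 2] 2 by simp
  have 4: "\<phi> 4 = 3" using \<phi>_Suc[of 3] 3 by simp
  show 5: "\<phi> 5 = 3" using \<phi>_Suc[of 4] 4 by simp
  have 6: "\<phi> 6 = 3" using \<phi>_Suc[of 5] 5 by simp
  show 7: "\<phi> 7 = 3" using \<phi>_Suc[of 6] 6 by simp
  show "\<phi> 8 = 4" using \<phi>_Suc[of 7] 7 by simp
qed

lemma \<phi>_add_8: "\<phi> (j + 8) = \<phi> j + 4"
proof (induction j)
  case 0
  then show ?case by (simp add: \<phi>_small \<phi>_0)
next
  case (Suc j)
  have "Suc (j + 8) mod 8 = Suc j mod 8" by (metis add_Suc mod_add_self2)
  then show ?case using Suc.IH \<phi>_Suc[of "j + 8"] \<phi>_Suc[of j] by simp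
qed

lemma equidistant_exists:
  assumes "0 < n"
  shows "\<exists>P S. equidistant (2 * n) (\<phi> (2 * n - 1)) P S"
  using assms
proof (induction n rule: less_induct)
  case (less n)
  consider "n = 1" | "n = 2" | "n = 3" | "n = 4" | "n > 4" using less.prems by linarith
  then show ?case
  proof cases
    case 1 then show ?thesis using equidistant_2 \<phi>_small by auto
  next
    case 2 then show ?thesis using equidistant_4 \<phi>_small by auto
  next
    case 3 then show ?thesis using equidistant_mono[OF equidistant_8, of 6] \<phi>_small by auto
  next
    case 4 then show ?thesis using equidistant_8 \<phi>_small by auto
  next
    case 5
    then obtain P S where "equidistant (2 * (n - 4)) (\<phi> (2 * (n - 4) - 1)) P S"
      using less.IH[of "n - 4"] by auto
    from equidistant_join[OF this equidistant_8]
    have "\<exists>P S. equidistant (2 * (n - 4) + 8) (\<phi> (2 * (n - 4) - 1) + 3 + 1) P S" .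
    moreover have n: "2 * (n - 4) + 8 = 2 * n" "2 * (n - 4) - 1 + 8 = 2 * n - 1" using 5 by auto
    have "\<phi> (2 * (n - 4) - 1) + 3 + 1 = \<phi> (2 * n - 1)"
      unfolding n(2)[symmetric] \<phi>_add_8 by simp
    ultimately show ?thesis unfolding n(1) by metis
  qed
qed

definition parity_sign :: "nat set \<Rightarrow> real" where
  "parity_sign A = (- 1) ^ card A"

lemma parity_sign_sym_diff:
  assumes "finite A" "finite B"
  shows "parity_sign (sym_diff A B) = parity_sign A * parity_sign B"
proof -
  have "card (sym_diff A B) = card (A - B) + card (B - A)"
    using assms by (intro card_Un_disjoint) auto
  moreover have "card A = card (A - B) + card (A \<inter> B)" "card B = card (B - A) + card (A \<inter> B)"
    using assms by (metis card_Int_Diff add.commute Int_commute)+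
  moreover have "(- 1::real) ^ card (A \<inter> B) * (- 1) ^ card (A \<inter> B) = 1"
    by (simp flip: power_mult_distrib)
  ultimately show ?thesis
    by (simp add: parity_sign_def power_add)
qed

lemma parity_sign_square [simp]: "parity_sign A * parity_sign A = 1"
  by (simp add: parity_sign_def flip: power_mult_distrib)

text \<open>A family of orthogonal matrices with \<open>C\<^sub>i\<^sup>T C\<^sub>j + C\<^sub>j\<^sup>T C\<^sub>i = 2\<delta>\<^sub>i\<^sub>j = C\<^sub>i C\<^sub>j\<^sup>T + C\<^sub>j C\<^sub>i\<^sup>T\<close>, so that
  \<open>\<Sum> x\<^sub>i C\<^sub>i\<close> is a similarity of ratio \<open>|x|\<close> for all real vectors \<open>x\<close>.\<close>

definition orthogonal_family :: "nat \<Rightarrow> nat \<Rightarrow> (nat \<Rightarrow> nat \<Rightarrow> nat \<Rightarrow> real) \<Rightarrow> bool" where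
  "orthogonal_family r N C \<longleftrightarrow>
     (\<forall>i<r. \<forall>j<r. \<forall>k<N. \<forall>l<N.
        (\<Sum>a<N. C i a k * C j a l + C j a k * C i a l) = (if i = j \<and> k = l then 2 else 0) \<and>
        (\<Sum>a<N. C i k a * C j l a + C j k a * C i l a) = (if i = j \<and> k = l then 2 else 0))"

text \<open>The entries \<open>(K, L)\<close> of \<open>C\<^sub>i\<^sup>T C\<^sub>j\<close> and \<open>C\<^sub>j\<^sup>T C\<^sub>i\<close> are nonzero for the same \<open>L = K \<triangle> P\<^sub>i \<triangle> P\<^sub>j\<close>, and
  moving the index from \<open>K \<triangle> P\<^sub>i\<close> to \<open>K \<triangle> P\<^sub>j\<close> changes the product of the two signs by
  \<open>(-1)\<^bsup>|(P\<^sub>i \<triangle> P\<^sub>j) \<inter> (S\<^sub>i \<triangle> S\<^sub>j)|\<^esup> = -1\<close>. The rows behave in the same way.\<close>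

lemma equidistant_imp_orthogonal_family:
  assumes v: "equidistant r m P S"
  shows "\<exists>C. orthogonal_family r (2 ^ m) C"
proof -
  let ?B = "Pow {..<m}"
  define D :: "nat \<Rightarrow> nat set \<Rightarrow> nat set \<Rightarrow> real"
    where "D = (\<lambda>j I J. if J = sym_diff I (P j) then parity_sign (S j \<inter> I) else 0)"
  have PS: "P j \<subseteq> {..<m}" "S j \<subseteq> {..<m}" "finite (P j)" "finite (S j)" if "j < r" for j
    using v that finite_subset[OF _ finite_lessThan, of _ m] by (auto simp: equidistant_def)
  have flip: "J = sym_diff I X \<longleftrightarrow> I = sym_diff J X" for I J X :: "nat set" by blast
  have sym_in: "sym_diff I (P j) \<in> ?B" if "j < r" "I \<in> ?B" for I j using that PS by blast
  have sign_add: "parity_sign (S k \<inter> sym_diff I J) = parity_sign (S k \<inter> I) * parity_sign (S k \<inter> J)"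
    if "k < r" for k I J
  proof -
    have "S k \<inter> sym_diff I J = sym_diff (S k \<inter> I) (S k \<inter> J)" by blast
    then show ?thesis using PS(4)[OF that] by (simp add: parity_sign_sym_diff)
  qed
  have minus: "parity_sign (S i \<inter> sym_diff (P i) (P j)) * parity_sign (S j \<inter> sym_diff (P i) (P j)) = -1"
    if "i < r" "j < r" "i \<noteq> j" for i j
  proof -
    let ?X = "sym_diff (P i) (P j)"
    have "sym_diff (S i \<inter> ?X) (S j \<inter> ?X) = ?X \<inter> sym_diff (S i) (S j)" by blast
    then have "parity_sign (S i \<inter> ?X) * parity_sign (S j \<inter> ?X) = parity_sign (?X \<inter> sym_diff (S i) (S j))"
      using PS that by (metis finite_Int parity_sign_sym_diff)
    moreover have "odd (card (?X \<inter> sym_diff (S i) (S j)))"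
      using v that by (simp add: equidistant_def)
    ultimately show ?thesis by (simp add: parity_sign_def)
  qed
  have cols: "(\<Sum>A\<in>?B. D i A K * D j A L) =
      (if sym_diff K (P i) = sym_diff L (P j) then
        parity_sign (S i \<inter> sym_diff K (P i)) * parity_sign (S j \<inter> sym_diff K (P i)) else 0)"
    if "i < r" "j < r" "K \<in> ?B" "L \<in> ?B" for i j K L
  proof -
    have "(\<Sum>A\<in>?B. D i A K * D j A L) = (\<Sum>A\<in>?B. if sym_diff K (P i) = A then
        (if A = sym_diff L (P j) then parity_sign (S i \<inter> A) * parity_sign (S j \<inter> A) else 0) else 0)"
      unfolding D_def by (intro sum.cong refl) (auto simp: flip[of K] flip[of L])
    then show ?thesis using sym_in[OF that(1,3)] by (simp add: sum.delta)
  qed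
  have rows: "(\<Sum>A\<in>?B. D i K A * D j L A) =
      (if sym_diff K (P i) = sym_diff L (P j) then parity_sign (S i \<inter> K) * parity_sign (S j \<inter> L) else 0)"
    if "i < r" "j < r" "K \<in> ?B" "L \<in> ?B" for i j K L
  proof -
    have "(\<Sum>A\<in>?B. D i K A * D j L A) = (\<Sum>A\<in>?B. if sym_diff K (P i) = A then
        (if A = sym_diff L (P j) then parity_sign (S i \<inter> K) * parity_sign (S j \<inter> L) else 0) else 0)"
      unfolding D_def by (intro sum.cong refl) auto
    then show ?thesis using sym_in[OF that(1,3)] by (simp add: sum.delta)
  qed
  have D: "(\<Sum>A\<in>?B. D i A K * D j A L + D j A K * D i A L) = (if i = j \<and> K = L then 2 else 0)"
    "(\<Sum>A\<in>?B. D i K A * D j L A + D j K A * D i L A) = (if i = j \<and> K = L then 2 else 0)"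
    if ij: "i < r" "j < r" and KL: "K \<in> ?B" "L \<in> ?B" for i j K L
  proof -
    have L: "sym_diff K (P i) = sym_diff L (P j) \<longleftrightarrow> L = sym_diff K (sym_diff (P i) (P j))"
      "sym_diff K (P j) = sym_diff L (P i) \<longleftrightarrow> L = sym_diff K (sym_diff (P i) (P j))" by blast+
    have same: "sym_diff K (P i) = sym_diff L (P i) \<longleftrightarrow> K = L" by blast
    note m = minus[OF ij] and add = sign_add[OF ij(1)] sign_add[OF ij(2)]
    \<comment> \<open>two signs whose product is \<open>-1\<close>\<close>
    have cancel: "x + y = 0" if "x * x = 1" "y * y = 1" "x * y = - 1" for x y :: real
    proof -
      have "(x + y) * (x + y) = 0" using that by (simp add: algebra_simps)
      then show ?thesis by simp
    qed
    have square: "parity_sign A * parity_sign B * (parity_sign A * parity_sign B) = 1" for A B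
      by (metis mult.commute mult.left_commute mult_1_right parity_sign_square)
    let ?s = "\<lambda>k A. parity_sign (S k \<inter> A)"
    have c: "?s i (sym_diff K (P i)) * ?s j (sym_diff K (P i)) +
        ?s j (sym_diff K (P j)) * ?s i (sym_diff K (P j)) = 0" if "i \<noteq> j"
    proof (rule cancel)
      have "?s i (sym_diff K (P i)) * ?s j (sym_diff K (P i)) *
          (?s j (sym_diff K (P j)) * ?s i (sym_diff K (P j))) =
          (?s i K * ?s i K) * (?s j K * ?s j K) * (?s i (sym_diff (P i) (P j)) * ?s j (sym_diff (P i) (P j)))"
        by (simp only: add ac_simps)
      then show "?s i (sym_diff K (P i)) * ?s j (sym_diff K (P i)) *
          (?s j (sym_diff K (P j)) * ?s i (sym_diff K (P j))) = - 1"
        using m that by simp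
    qed (rule square)+
    have d: "?s i K * ?s j L + ?s j K * ?s i L = 0"
      if "i \<noteq> j" "L = sym_diff K (sym_diff (P i) (P j))"
    proof (rule cancel)
      have "?s i K * ?s j L * (?s j K * ?s i L) =
          (?s i K * ?s i K) * (?s j K * ?s j K) * (?s i (sym_diff (P i) (P j)) * ?s j (sym_diff (P i) (P j)))"
        unfolding that(2) by (simp only: sign_add[OF ij(1), of K "sym_diff (P i) (P j)"]
            sign_add[OF ij(2), of K "sym_diff (P i) (P j)"] ac_simps)
      then show "?s i K * ?s j L * (?s j K * ?s i L) = - 1"
        using m that by simp
    qed (rule square)+
    have "(\<Sum>A\<in>?B. D i A K * D j A L + D j A K * D i A L) =
        (\<Sum>A\<in>?B. D i A K * D j A L) + (\<Sum>A\<in>?B. D j A K * D i A L)"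
      by (rule sum.distrib)
    then show "(\<Sum>A\<in>?B. D i A K * D j A L + D j A K * D i A L) = (if i = j \<and> K = L then 2 else 0)"
      unfolding cols[OF ij KL] cols[OF ij(2,1) KL] using c L same by (cases "i = j") auto
    have "(\<Sum>A\<in>?B. D i K A * D j L A + D j K A * D i L A) =
        (\<Sum>A\<in>?B. D i K A * D j L A) + (\<Sum>A\<in>?B. D j K A * D i L A)"
      by (rule sum.distrib)
    then show "(\<Sum>A\<in>?B. D i K A * D j L A + D j K A * D i L A) = (if i = j \<and> K = L then 2 else 0)"
      unfolding rows[OF ij KL] rows[OF ij(2,1) KL] using d L same by (cases "i = j") auto
  qed
  \<comment> \<open>renumber the subsets of \<open>{..<m}\<close> by natural numbers\<close>
  have "card ?B = 2 ^ m" by (simp add: card_Pow)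
  then obtain h where h: "bij_betw h {..<(2::nat) ^ m} ?B"
    using ex_bij_betw_nat_finite[of ?B] by (auto simp: lessThan_atLeast0)
  have hB: "h k \<in> ?B" if "k < 2 ^ m" for k using h that by (auto simp: bij_betw_def)
  have hinj: "h k = h l \<longleftrightarrow> k = l" if "k < 2 ^ m" "l < 2 ^ m" for k l
    using h that by (auto simp: bij_betw_def inj_on_def)
  have "orthogonal_family r (2 ^ m) (\<lambda>j k l. D j (h k) (h l))"
    unfolding orthogonal_family_def
  proof (intro allI impI)
    fix i j k l :: nat assume *: "i < r" "j < r" "k < 2 ^ m" "l < 2 ^ m"
    show "(\<Sum>a<2 ^ m. D i (h a) (h k) * D j (h a) (h l) + D j (h a) (h k) * D i (h a) (h l)) =
         (if i = j \<and> k = l then 2 else 0) \<and>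
       (\<Sum>a<2 ^ m. D i (h k) (h a) * D j (h l) (h a) + D j (h k) (h a) * D i (h l) (h a)) =
         (if i = j \<and> k = l then 2 else 0)"
      using D[OF *(1,2) hB[OF *(3)] hB[OF *(4)]] hinj[OF *(3,4)]
        sum.reindex_bij_betw[OF h, of "\<lambda>A. D i A (h k) * D j A (h l) + D j A (h k) * D i A (h l)"]
        sum.reindex_bij_betw[OF h, of "\<lambda>A. D i (h k) A * D j (h l) A + D j (h k) A * D i (h l) A"]
      by simp
  qed
  then show ?thesis by blast
qed

lemma orthogonal_family_exists:
  assumes "0 < n"
  shows "\<exists>C. orthogonal_family (2 * n) (2 ^ \<phi> (2 * n - 1)) C"
  using equidistant_exists[OF assms] equidistant_imp_orthogonal_family by blast


section \<open>Based spaces as one-point compactifications\<close>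

lemma homeomorphic_map_prod:
  assumes "homeomorphic_map X X' f" "homeomorphic_map Y Y' g"
  shows "homeomorphic_map (prod_topology X Y) (prod_topology X' Y') (map_prod f g)"
proof -
  obtain f' g' where "homeomorphic_maps X X' f f'" "homeomorphic_maps Y Y' g g'"
    using assms by (auto simp: homeomorphic_map_maps)
  then have "homeomorphic_maps (prod_topology X Y) (prod_topology X' Y')
      (\<lambda>(x, y). (f x, g y)) (\<lambda>(x, y). (f' x, g' y))"
    by (simp add: homeomorphic_maps_prod)
  then show ?thesis by (auto simp: homeomorphic_map_maps map_prod_def)
qed

text \<open>Every space at a level of the suspension spectra below is compact Hausdorff, hence the one-point
  compactification of the complement of its base point. A based homeomorphism is therefore the
  same as a homeomorphism between the complements, and the smash product becomes the product of
  the complements. This turns all verifications about iterated smash products into statements about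
  ordinary products.\<close>

definition one_point_compactification ::
  "'x topology \<Rightarrow> 'a c2_space \<Rightarrow> ('x \<Rightarrow> 'a) \<Rightarrow> bool" where
  "one_point_compactification X A j \<longleftrightarrow>
     compact_space (pts A) \<and> Hausdorff_space (pts A) \<and> bpt A \<in> topspace (pts A) \<and>
     embedding_map X (pts A) j \<and> j ` topspace X = topspace (pts A) - {bpt A}"

lemma one_point_compactification_Alexandroff:
  assumes "Hausdorff_space X" "locally_compact_space X"
    and "pts A = Alexandroff_compactification X" "bpt A = None"
  shows "one_point_compactification X A Some"
  using assms by (auto simp: one_point_compactification_def
      Hausdorff_space_Alexandroff_compactification embedding_map_Some)

text \<open>At the base point, continuity amounts to a statement about compact sets: the neighbourhoods of the
  base point are the complements of the compact subsets of the rest.\<close>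

lemma one_point_compactification_extend:
  assumes A: "one_point_compactification X A j" and B: "one_point_compactification Y B k"
    and f: "homeomorphic_map X Y f"
    and base: "F (bpt A) = bpt B"
    and ext: "\<And>x. x \<in> topspace X \<Longrightarrow> F (j x) = k (f x)"
  shows "homeomorphic_map (pts A) (pts B) F"
proof -
  have jX: "j ` topspace X = topspace (pts A) - {bpt A}"
    and kY: "k ` topspace Y = topspace (pts B) - {bpt B}"
    using A B by (auto simp: one_point_compactification_def)
  have fX: "f ` topspace X = topspace Y" and injf: "inj_on f (topspace X)"
    using f by (auto simp: homeomorphic_imp_surjective_map homeomorphic_imp_injective_map)
  have injj: "inj_on j (topspace X)" and injk: "inj_on k (topspace Y)"
    using A B by (auto simp: one_point_compactification_def embedding_map_def
        dest: homeomorphic_imp_injective_map)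
  have contf: "continuous_map X Y f" and contj: "continuous_map X (pts A) j"
    and contk: "continuous_map Y (pts B) k"
    using A B f by (auto simp: one_point_compactification_def homeomorphic_imp_continuous_map
        embedding_map_def continuous_map_in_subtopology dest!: homeomorphic_imp_continuous_map)
  have cpts: "x = bpt A \<or> (\<exists>y\<in>topspace X. x = j y)" if "x \<in> topspace (pts A)" for x
    using that jX by blast
  have into: "F \<in> topspace (pts A) \<rightarrow> topspace (pts B)"
  proof
    fix x assume "x \<in> topspace (pts A)"
    then consider "x = bpt A" | y where "y \<in> topspace X" "x = j y" using cpts by blast
    then show "F x \<in> topspace (pts B)"
      using base ext fX kY B unfolding one_point_compactification_def by cases auto
  qed
  have cont: "continuous_map (pts A) (pts B) F"
    unfolding continuous_map_def
  proof (intro conjI allI impI into)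
    fix U assume U: "openin (pts B) U"
    show "openin (pts A) {x \<in> topspace (pts A). F x \<in> U}"
    proof (cases "bpt B \<in> U")
      case False
      have "closedin (pts A) {bpt A}"
        using A by (simp add: one_point_compactification_def closedin_Hausdorff_singleton)
      then have op: "openin (pts A) (j ` topspace X)"
        by (simp add: jX openin_diff)
      have V: "openin X {x \<in> topspace X. k (f x) \<in> U}"
        using openin_continuous_map_preimage[OF continuous_map_compose[OF contf contk] U]
        by (simp add: o_def)
      have "open_map X (subtopology (pts A) (j ` topspace X)) j"
        using A homeomorphic_imp_open_map
        unfolding one_point_compactification_def embedding_map_def by blast
      then have "open_map X (pts A) j"
        using op openin_trans_full unfolding open_map_def by blast
      moreover have "{x \<in> topspace (pts A). F x \<in> U} = j ` {x \<in> topspace X. k (f x) \<in> U}"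
      proof (intro set_eqI iffI)
        fix x assume "x \<in> {x \<in> topspace (pts A). F x \<in> U}"
        then show "x \<in> j ` {x \<in> topspace X. k (f x) \<in> U}"
          using cpts[of x] base ext False by auto
      next
        fix x assume "x \<in> j ` {x \<in> topspace X. k (f x) \<in> U}"
        then show "x \<in> {x \<in> topspace (pts A). F x \<in> U}"
          using jX ext by auto
      qed
      ultimately show ?thesis using V by (simp add: open_map_def)
    next
      case True
      let ?C = "topspace (pts B) - U"
      let ?D = "{x \<in> topspace X. k (f x) \<in> ?C}"
      have "compactin (pts B) ?C"
        using B U by (meson one_point_compactification_def closedin_compact_space
            closedin_diff closedin_topspace)
      then have "compactin (subtopology (pts B) (topspace (pts B) - {bpt B})) ?C"
        using True by (auto simp: compactin_subtopology)
      moreover have hk: "homeomorphic_map X (subtopology (pts B) (topspace (pts B) - {bpt B})) (k \<circ> f)"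
        using B f homeomorphic_map_compose[of X Y f] kY
        by (auto simp: one_point_compactification_def embedding_map_def)
      moreover have "(k \<circ> f) ` ?D = ?C"
      proof
        have "?C \<subseteq> k ` f ` topspace X" using True kY fX by auto
        then show "?C \<subseteq> (k \<circ> f) ` ?D" by auto
      qed auto
      ultimately have "compactin X ?D"
        by (metis (no_types, lifting) homeomorphic_map_compactness mem_Collect_eq subsetI)
      then have "compactin (pts A) (j ` ?D)"
        using contj image_compactin by blast
      then have "closedin (pts A) (j ` ?D)"
        using A by (simp add: one_point_compactification_def compactin_imp_closedin)
      moreover have "{x \<in> topspace (pts A). F x \<in> U} = topspace (pts A) - j ` ?D"
      proof (intro set_eqI iffI)
        fix x assume x: "x \<in> {x \<in> topspace (pts A). F x \<in> U}"
        have "x \<notin> j ` ?D"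
        proof
          assume "x \<in> j ` ?D"
          then show False using x ext by auto
        qed
        then show "x \<in> topspace (pts A) - j ` ?D" using x by auto
      next
        fix x assume x: "x \<in> topspace (pts A) - j ` ?D"
        then consider "x = bpt A" | y where "y \<in> topspace X" "x = j y" using cpts by blast
        then show "x \<in> {x \<in> topspace (pts A). F x \<in> U}"
        proof cases
          case 1 then show ?thesis using x base True by auto
        next
          case 2
          then have "F x \<in> topspace (pts B)" using x into by auto
          then show ?thesis using 2 x ext by auto
        qed
      qed
      ultimately show ?thesis by auto
    qed
  qed
  moreover have "F ` topspace (pts A) = topspace (pts B)"
  proof
    show "F ` topspace (pts A) \<subseteq> topspace (pts B)" using into by auto
    have "topspace (pts B) = insert (bpt B) (k ` topspace Y)"
      using kY B by (auto simp: one_point_compactification_def)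
    also have "\<dots> \<subseteq> F ` topspace (pts A)"
    proof (intro insert_subsetI subsetI)
      show "bpt B \<in> F ` topspace (pts A)"
        using base A unfolding one_point_compactification_def by (metis imageI)
      fix b assume "b \<in> k ` topspace Y"
      then obtain x where "x \<in> topspace X" "b = k (f x)" unfolding fX[symmetric] by auto
      then show "b \<in> F ` topspace (pts A)" using ext jX by (metis DiffE imageI)
    qed
    finally show "topspace (pts B) \<subseteq> F ` topspace (pts A)" .
  qed
  moreover have "inj_on F (topspace (pts A))"
  proof (rule inj_onI)
    fix x y assume xy: "x \<in> topspace (pts A)" "y \<in> topspace (pts A)" "F x = F y"
    have "k (f z) \<noteq> bpt B" if "z \<in> topspace X" for z using kY fX that by blast
    then show "x = y"
      using cpts[OF xy(1)] cpts[OF xy(2)] xy(3) base ext injk injf fX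
      by (metis imageI inj_onD)
  qed
  ultimately show ?thesis
    using A B by (meson one_point_compactification_def continuous_imp_homeomorphic_map)
qed

lemma topspace_quotient_top: "topspace (quotient_top X q) = q ` topspace X"
  using quotient_imp_surjective_map quotient_map_quotient_top by metis

lemma bpt_smash [simp]: "bpt (smash A B) = None"
  and act_smash: "act (smash A B) = map_option (map_prod (act A) (act B))"
  by (simp_all add: smash_def)

lemma topspace_smash:
  assumes "bpt A \<in> topspace (pts A)" "bpt B \<in> topspace (pts B)"
  shows "topspace (pts (smash A B)) =
    insert None (Some ` ((topspace (pts A) - {bpt A}) \<times> (topspace (pts B) - {bpt B})))"
proof -
  have "topspace (pts (smash A B)) = smash_proj A B ` (topspace (pts A) \<times> topspace (pts B))"
    by (simp add: smash_def topspace_quotient_top)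
  also have "\<dots> = insert None (Some ` ((topspace (pts A) - {bpt A}) \<times> (topspace (pts B) - {bpt B})))"
  proof (intro equalityI insert_subsetI)
    show "None \<in> smash_proj A B ` (topspace (pts A) \<times> topspace (pts B))"
      using assms by (intro image_eqI[of _ _ "(bpt A, bpt B)"]) (auto simp: smash_proj_def)
    show "Some ` ((topspace (pts A) - {bpt A}) \<times> (topspace (pts B) - {bpt B})) \<subseteq>
        smash_proj A B ` (topspace (pts A) \<times> topspace (pts B))"
    proof (intro subsetI, elim imageE)
      fix z w assume "z = Some w" "w \<in> (topspace (pts A) - {bpt A}) \<times> (topspace (pts B) - {bpt B})"
      then have "z = smash_proj A B w" "w \<in> topspace (pts A) \<times> topspace (pts B)"
        by (cases w; simp add: smash_proj_def)+
      then show "z \<in> smash_proj A B ` (topspace (pts A) \<times> topspace (pts B))" by simp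
    qed
  qed (auto simp: smash_proj_def split: if_splits)
  finally show ?thesis .
qed

lemma continuous_map_smash_proj:
  "continuous_map (prod_topology (pts A) (pts B)) (pts (smash A B)) (smash_proj A B)"
  by (simp add: smash_def quotient_imp_continuous_map[OF quotient_map_quotient_top])

text \<open>A neighbourhood of the base point of \<open>A \<and> B\<close> and one of a point \<open>x \<and> y\<close> are separated by the
  images of \<open>U' \<times> B \<union> A \<times> V'\<close> and \<open>U \<times> V\<close>, where \<open>U, U'\<close> separate \<open>x\<close> and \<open>V, V'\<close> separate \<open>y\<close>
  from the base points.\<close>

lemma Hausdorff_space_smash:
  assumes A: "Hausdorff_space (pts A)" "bpt A \<in> topspace (pts A)"
    and B: "Hausdorff_space (pts B)" "bpt B \<in> topspace (pts B)"
  shows "Hausdorff_space (pts (smash A B))"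
proof -
  let ?q = "smash_proj A B"
  let ?S = "pts (smash A B)"
  let ?P = "prod_topology (pts A) (pts B)"
  \<comment> \<open>images of saturated open sets are open\<close>
  have openI: "openin ?S (?q ` W)" if W: "openin ?P W"
    and sat: "\<And>z z'. z \<in> W \<Longrightarrow> z' \<in> topspace ?P \<Longrightarrow> ?q z = ?q z' \<Longrightarrow> z' \<in> W" for W
  proof -
    have "{x \<in> topspace ?P. ?q x \<in> ?q ` W} = W"
      using openin_subset[OF W] sat by (auto simp del: topspace_prod_topology)
    then show ?thesis
      using W openin_subset[OF W] by (auto simp: smash_def openin_quotient_top)
  qed
  have sep_base: "\<exists>U V. openin ?S U \<and> openin ?S V \<and> None \<in> U \<and> Some (x, y) \<in> V \<and> disjnt U V"
    if x: "x \<in> topspace (pts A) - {bpt A}" and y: "y \<in> topspace (pts B) - {bpt B}" for x y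
  proof -
    obtain U U' where U: "openin (pts A) U" "openin (pts A) U'" "x \<in> U" "bpt A \<in> U'" "disjnt U U'"
      using A x unfolding Hausdorff_space_def by (metis DiffE insertI1)
    obtain V V' where V: "openin (pts B) V" "openin (pts B) V'" "y \<in> V" "bpt B \<in> V'" "disjnt V V'"
      using B y unfolding Hausdorff_space_def by (metis DiffE insertI1)
    let ?W = "U' \<times> topspace (pts B) \<union> topspace (pts A) \<times> V'"
    have "openin ?P ?W" using U V by (simp add: openin_Un openin_prod_Times_iff)
    then have "openin ?S (?q ` ?W)"
      by (rule openI) (use U V in \<open>auto simp: smash_proj_def split: if_splits\<close>)
    moreover have nb: "bpt A \<notin> U" "bpt B \<notin> V" using U V by (auto simp: disjnt_iff)
    have "openin ?S (?q ` (U \<times> V))"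
      by (rule openI) (use U V nb in \<open>auto simp: smash_proj_def openin_prod_Times_iff split: if_splits\<close>)
    moreover have "None \<in> ?q ` ?W" using U A B V
      by (auto simp: smash_proj_def image_iff intro!: bexI[of _ "(bpt A, bpt B)"])
    moreover have "Some (x, y) \<in> ?q ` (U \<times> V)" using U V x y
      by (auto simp: smash_proj_def image_iff intro!: bexI[of _ "(x, y)"])
    moreover have "disjnt (?q ` ?W) (?q ` (U \<times> V))"
      using U V nb by (fastforce simp: disjnt_iff smash_proj_def split: if_splits)
    ultimately show ?thesis by blast
  qed
  have sep: "\<exists>U V. openin ?S U \<and> openin ?S V \<and> Some (x, y) \<in> U \<and> Some (x', y') \<in> V \<and> disjnt U V"
    if x: "x \<in> topspace (pts A) - {bpt A}" "x' \<in> topspace (pts A) - {bpt A}"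
      and y: "y \<in> topspace (pts B) - {bpt B}" "y' \<in> topspace (pts B) - {bpt B}"
      and ne: "(x, y) \<noteq> (x', y')" for x y x' y'
  proof -
    have "Hausdorff_space ?P" using A B by (simp add: Hausdorff_space_prod_topology)
    then obtain U V where U: "openin ?P U" "openin ?P V" "(x, y) \<in> U" "(x', y') \<in> V" "disjnt U V"
      using x y ne unfolding Hausdorff_space_def by (metis DiffE SigmaI topspace_prod_topology)
    let ?N = "(topspace (pts A) - {bpt A}) \<times> (topspace (pts B) - {bpt B})"
    have N: "openin ?P ?N"
      using A B by (simp add: openin_prod_Times_iff openin_diff closedin_Hausdorff_singleton)
    have "openin ?S (?q ` (U \<inter> ?N))" "openin ?S (?q ` (V \<inter> ?N))"
      by (rule openI; use U N in \<open>auto simp: smash_proj_def split: if_splits\<close>)+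
    moreover have "Some (x, y) \<in> ?q ` (U \<inter> ?N)" "Some (x', y') \<in> ?q ` (V \<inter> ?N)"
      using U x y by (auto simp: smash_proj_def image_def
          intro: bexI[of _ "(x, y)"] bexI[of _ "(x', y')"])
    moreover have "disjnt (?q ` (U \<inter> ?N)) (?q ` (V \<inter> ?N))"
      using U by (fastforce simp: disjnt_iff smash_proj_def split: if_splits)
    ultimately show ?thesis by blast
  qed
  show ?thesis
    unfolding Hausdorff_space_def topspace_smash[OF A(2) B(2)]
  proof (intro allI impI, elim conjE)
    fix a b
    let ?T = "insert None (Some ` ((topspace (pts A) - {bpt A}) \<times> (topspace (pts B) - {bpt B})))"
    assume a: "a \<in> ?T" and b: "b \<in> ?T" and ne: "a \<noteq> b"
    then consider "a = None" "b \<noteq> None" | "a \<noteq> None" "b = None" | "a \<noteq> None" "b \<noteq> None" by auto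
    then show "\<exists>U V. openin ?S U \<and> openin ?S V \<and> a \<in> U \<and> b \<in> V \<and> disjnt U V"
    proof cases
      case 1 then show ?thesis using b sep_base by auto
    next
      case 2 then show ?thesis using a sep_base by (auto simp: disjnt_sym) (metis disjnt_sym)
    next
      case 3 then show ?thesis using a b ne sep by auto
    qed
  qed
qed

lemma compact_space_smash:
  assumes "compact_space (pts A)" "compact_space (pts B)"
  shows "compact_space (pts (smash A B))"
proof -
  have "compact_space (prod_topology (pts A) (pts B))"
    using assms by (simp add: compact_space_prod_topology)
  then show ?thesis
    using image_compactin[OF _ continuous_map_smash_proj, of A B]
    by (metis compact_space_def quotient_imp_surjective_map quotient_map_quotient_top
        smash_def c2_space.select_convs(1))
qed

text \<open>The complement of the two axes is open in \<open>A \<times> B\<close>, and the projection to \<open>A \<and> B\<close> is injective there.\<close>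

lemma one_point_compactification_smash:
  assumes A: "one_point_compactification X A j" and B: "one_point_compactification Y B k"
  shows "one_point_compactification (prod_topology X Y) (smash A B) (\<lambda>(x, y). Some (j x, k y))"
    (is "one_point_compactification _ _ ?f")
proof -
  let ?P = "prod_topology (pts A) (pts B)"
  let ?N = "(topspace (pts A) - {bpt A}) \<times> (topspace (pts B) - {bpt B})"
  have a: "bpt A \<in> topspace (pts A)" "Hausdorff_space (pts A)" "compact_space (pts A)"
    "embedding_map X (pts A) j" "j ` topspace X = topspace (pts A) - {bpt A}"
    and b: "bpt B \<in> topspace (pts B)" "Hausdorff_space (pts B)" "compact_space (pts B)"
    "embedding_map Y (pts B) k" "k ` topspace Y = topspace (pts B) - {bpt B}"
    using A B by (auto simp: one_point_compactification_def)
  have N: "openin ?P ?N"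
    using a b by (simp add: openin_prod_Times_iff openin_diff closedin_Hausdorff_singleton)
  have in_N: "(j x, k y) \<in> ?N" if "x \<in> topspace X" "y \<in> topspace Y" for x y using that a b by blast
  have eq: "?f z = smash_proj A B (map_prod j k z)" if "z \<in> topspace X \<times> topspace Y" for z
    using that in_N by (auto simp: smash_proj_def)
  have "homeomorphic_map X (subtopology (pts A) (topspace (pts A) - {bpt A})) j"
    "homeomorphic_map Y (subtopology (pts B) (topspace (pts B) - {bpt B})) k"
    using a b by (metis embedding_map_def)+
  then have hom: "homeomorphic_map (prod_topology X Y) (subtopology ?P ?N) (map_prod j k)"
    using homeomorphic_map_prod[of X "subtopology (pts A) (topspace (pts A) - {bpt A})" j
        Y "subtopology (pts B) (topspace (pts B) - {bpt B})" k]
    by (simp add: prod_topology_subtopology subtopology_subtopology Times_Int_Times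
        Int_absorb1 Int_absorb2 Diff_subset)
  have cont: "continuous_map (prod_topology X Y) (pts (smash A B)) ?f"
  proof (rule continuous_map_eq)
    show "continuous_map (prod_topology X Y) (pts (smash A B)) (smash_proj A B \<circ> map_prod j k)"
      using hom continuous_map_smash_proj[of A B]
      by (meson continuous_map_compose continuous_map_in_subtopology homeomorphic_imp_continuous_map)
  qed (simp add: eq)
  have op: "open_map (prod_topology X Y) (pts (smash A B)) ?f"
    unfolding open_map_def
  proof (intro allI impI)
    fix U assume U: "openin (prod_topology X Y) U"
    then have US: "U \<subseteq> topspace X \<times> topspace Y" using openin_subset by fastforce
    have "openin (subtopology ?P ?N) (map_prod j k ` U)"
      using hom U homeomorphic_imp_open_map open_map_def by blast
    then have o: "openin ?P (map_prod j k ` U)"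
      using N openin_trans_full by blast
    have sub: "map_prod j k ` U \<subseteq> ?N" using US in_N by auto
    have "{x \<in> topspace ?P. smash_proj A B x \<in> ?f ` U} = map_prod j k ` U"
    proof
      show "map_prod j k ` U \<subseteq> {x \<in> topspace ?P. smash_proj A B x \<in> ?f ` U}"
        using sub US eq by (auto simp del: topspace_prod_topology simp: image_iff) 
          (use openin_subset[OF o] in blast, use eq in \<open>force\<close>)
      show "{x \<in> topspace ?P. smash_proj A B x \<in> ?f ` U} \<subseteq> map_prod j k ` U"
        by (auto simp: smash_proj_def image_iff split: if_splits) (metis map_prod_simp)
    qed
    moreover have "?f ` U \<subseteq> smash_proj A B ` topspace ?P"
      using US eq sub by (fastforce simp: image_iff)
    ultimately show "openin (pts (smash A B)) (?f ` U)"
      using o by (simp add: smash_def openin_quotient_top)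
  qed
  have "inj_on j (topspace X)" "inj_on k (topspace Y)"
    using a b by (auto simp: embedding_map_def dest: homeomorphic_imp_injective_map)
  then have "inj_on ?f (topspace (prod_topology X Y))"
    by (auto simp: inj_on_def)
  then have "embedding_map (prod_topology X Y) (pts (smash A B)) ?f"
    using cont op injective_open_imp_embedding_map by blast
  moreover have "?f ` topspace (prod_topology X Y) = topspace (pts (smash A B)) - {bpt (smash A B)}"
  proof -
    have "?f ` (topspace X \<times> topspace Y) = Some ` (j ` topspace X \<times> k ` topspace Y)" by force
    then show ?thesis
      using a b by (simp add: topspace_smash insert_Diff_if image_iff)
  qed
  ultimately show ?thesis
    using Hausdorff_space_smash[OF a(2,1) b(2,1)] compact_space_smash[OF a(3) b(3)]
    by (simp add: one_point_compactification_def topspace_smash a b)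
qed


section \<open>Based maps and homotopies\<close>

lemma based_map_cong:
  assumes "is_c2_space A" "\<And>x. x \<in> topspace (pts A) \<Longrightarrow> f x = g x" "based_map H A B f"
  shows "based_map H A B g"
proof -
  have "act A x \<in> topspace (pts A)" if "x \<in> topspace (pts A)" for x
    using assms(1) that unfolding is_c2_space_def based_map_def
    by (meson continuous_map_image_subset_topspace image_subset_iff)
  moreover have "bpt A \<in> topspace (pts A)" using assms(1) by (simp add: is_c2_space_def)
  ultimately show ?thesis
    using assms unfolding based_map_def by (metis continuous_map_eq)
qed

lemma based_map_in: "based_map H A B f \<Longrightarrow> x \<in> topspace (pts A) \<Longrightarrow> f x \<in> topspace (pts B)"
  unfolding based_map_def by (meson continuous_map_image_subset_topspace image_subset_iff)

lemma based_map_compose: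
  "based_map H A B f \<Longrightarrow> based_map H B C g \<Longrightarrow> based_map H A C (g \<circ> f)"
  using based_map_in[of H A B f] unfolding based_map_def
  by (auto intro: continuous_map_compose)

lemma based_map_Whole_Group: "based_map Whole_Group A B f \<Longrightarrow> based_map H A B f"
  by (simp add: based_map_def)

lemma act_in: "is_c2_space A \<Longrightarrow> x \<in> topspace (pts A) \<Longrightarrow> act A x \<in> topspace (pts A)"
  by (metis based_map_in is_c2_space_def)

lemma act_eq_bpt_iff:
  assumes "is_c2_space A" "x \<in> topspace (pts A)"
  shows "act A x = bpt A \<longleftrightarrow> x = bpt A"
  using assms unfolding is_c2_space_def based_map_def by metis

lemma based_homotopic_refl: "based_map H A B f \<Longrightarrow> based_homotopic H A B f f"
  by (simp add: based_homotopic_def based_map_def)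

lemma based_homotopic_sym: "based_homotopic H A B f g \<Longrightarrow> based_homotopic H A B g f"
  unfolding based_homotopic_def by (rule homotopic_with_symD)

lemma based_homotopic_trans:
  "based_homotopic H A B f g \<Longrightarrow> based_homotopic H A B g h \<Longrightarrow> based_homotopic H A B f h"
  unfolding based_homotopic_def by (rule homotopic_with_trans)

lemma based_homotopic_imp_based_map:
  "based_homotopic H A B f g \<Longrightarrow> based_map H A B f \<and> based_map H A B g"
  unfolding based_homotopic_def by (rule homotopic_with_imp_property)

lemma based_homotopic_equal:
  assumes "is_c2_space A" "based_map H A B f" "\<And>x. x \<in> topspace (pts A) \<Longrightarrow> f x = g x"
  shows "based_homotopic H A B f g"
  unfolding based_homotopic_def
  by (rule homotopic_with_equal)
    (use assms based_map_cong[of A f g H B] in \<open>auto simp: based_map_def\<close>)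

lemma based_homotopic_compose_left:
  assumes "based_homotopic H A B f g" "based_map H B C h"
  shows "based_homotopic H A C (h \<circ> f) (h \<circ> g)"
  using assms(1) unfolding based_homotopic_def
proof (rule homotopic_with_compose_continuous_map_left)
  show "continuous_map (pts B) (pts C) h" using assms(2) by (simp add: based_map_def)
qed (rule based_map_compose[OF _ assms(2)])

lemma based_homotopic_compose_right:
  assumes "based_homotopic H B C f g" "based_map H A B h"
  shows "based_homotopic H A C (f \<circ> h) (g \<circ> h)"
  using assms(1) unfolding based_homotopic_def
proof (rule homotopic_with_compose_continuous_map_right)
  show "continuous_map (pts A) (pts B) h" using assms(2) by (simp add: based_map_def)
qed (rule based_map_compose[OF assms(2)])

lemma smash_map_smash_proj:
  assumes "f (bpt A) = bpt C" "g (bpt B) = bpt D"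
  shows "smash_map C D f g (smash_proj A B z) = smash_proj C D (map_prod f g z)"
  using assms by (cases z) (auto simp: smash_map_def smash_proj_def)

lemma quotient_map_smash_proj:
  "quotient_map (prod_topology (pts A) (pts B)) (pts (smash A B)) (smash_proj A B)"
  by (simp add: smash_def quotient_map_quotient_top)

lemma is_c2_space_smash:
  assumes A: "is_c2_space A" and B: "is_c2_space B"
  shows "is_c2_space (smash A B)"
proof -
  have a: "bpt A \<in> topspace (pts A)" "continuous_map (pts A) (pts A) (act A)" "act A (bpt A) = bpt A"
    "\<And>x. x \<in> topspace (pts A) \<Longrightarrow> act A (act A x) = x"
    and b: "bpt B \<in> topspace (pts B)" "continuous_map (pts B) (pts B) (act B)" "act B (bpt B) = bpt B"
    "\<And>x. x \<in> topspace (pts B) \<Longrightarrow> act B (act B x) = x"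
    using A B by (auto simp: is_c2_space_def based_map_def)
  have eq: "act (smash A B) (smash_proj A B z) = smash_proj A B (map_prod (act A) (act B) z)"
    if "z \<in> topspace (prod_topology (pts A) (pts B))" for z
    using that act_eq_bpt_iff[OF A] act_eq_bpt_iff[OF B]
    by (cases z) (auto simp: act_smash smash_proj_def)
  have "continuous_map (prod_topology (pts A) (pts B)) (prod_topology (pts A) (pts B)) (map_prod (act A) (act B))"
    using a b by (simp add: continuous_map_prod_top map_prod_def)
  then have "continuous_map (prod_topology (pts A) (pts B)) (pts (smash A B)) (act (smash A B) \<circ> smash_proj A B)"
    using continuous_map_compose[OF _ continuous_map_smash_proj] eq
    by (force intro: continuous_map_eq)
  then have "continuous_map (pts (smash A B)) (pts (smash A B)) (act (smash A B))"
    using continuous_compose_quotient_map_eq quotient_map_smash_proj by blast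
  moreover have "act (smash A B) (act (smash A B) z) = z" if "z \<in> topspace (pts (smash A B))" for z
    using that a b by (auto simp: topspace_smash act_smash)
  ultimately show ?thesis
    using a b by (simp add: is_c2_space_def based_map_def topspace_smash) (simp add: act_smash)
qed

text \<open>Smashing with a fixed space is compatible with homotopies, since crossing with the unit
  interval preserves quotient maps.\<close>

lemma based_homotopic_smash_map:
  assumes A: "is_c2_space A" and C: "is_c2_space C" and hom: "based_homotopic H A B f g"
  shows "based_homotopic H (smash C A) (smash C B) (smash_map C B id f) (smash_map C B id g)"
proof -
  let ?I = "top_of_set {0..1::real}"
  obtain h where h: "continuous_map (prod_topology ?I (pts A)) (pts B) h"
    "\<And>x. h (0, x) = f x" "\<And>x. h (1, x) = g x" "\<And>t. t \<in> {0..1} \<Longrightarrow> based_map H A B (\<lambda>x. h (t, x))"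
    using hom unfolding based_homotopic_def homotopic_with_def by metis
  let ?k = "\<lambda>(t, z). smash_map C B id (\<lambda>x. h (t, x)) z"
  let ?q = "\<lambda>(t, z). (t, smash_proj C A z)"
  have bA: "bpt A \<in> topspace (pts A)" and bC: "bpt C \<in> topspace (pts C)"
    using A C by (auto simp: is_c2_space_def)
  have hb: "h (t, bpt A) = bpt B" if "t \<in> {0..1}" for t
    using h(4)[OF that] by (simp add: based_map_def)
  have q: "quotient_map (prod_topology ?I (prod_topology (pts C) (pts A))) (prod_topology ?I (pts (smash C A))) ?q"
    by (rule quotient_map_prod_right) (auto simp: quotient_map_smash_proj Hausdorff_space_subtopology
        intro!: locally_compact_space_closed_subset locally_compact_space_euclidean)
  have "continuous_map (prod_topology ?I (prod_topology (pts C) (pts A))) (pts (smash C B)) (?k \<circ> ?q)"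
  proof (rule continuous_map_eq)
    show "continuous_map (prod_topology ?I (prod_topology (pts C) (pts A))) (pts (smash C B))
        (smash_proj C B \<circ> (\<lambda>(t, x, y). (x, h (t, y))))"
    proof (rule continuous_map_compose[OF _ continuous_map_smash_proj])
      have "continuous_map (prod_topology ?I (prod_topology (pts C) (pts A))) (prod_topology ?I (pts A)) (\<lambda>z. (fst z, snd (snd z)))"
        by (intro continuous_map_pairedI continuous_map_fst
            continuous_map_compose[OF continuous_map_snd continuous_map_snd, unfolded o_def])
      from continuous_map_compose[OF this h(1)]
      have "continuous_map (prod_topology ?I (prod_topology (pts C) (pts A))) (pts B) (\<lambda>z. h (fst z, snd (snd z)))"
        by (simp add: o_def)
      moreover have "continuous_map (prod_topology ?I (prod_topology (pts C) (pts A))) (pts C) (\<lambda>z. fst (snd z))"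
        by (rule continuous_map_compose[OF continuous_map_snd continuous_map_fst, unfolded o_def])
      ultimately show "continuous_map (prod_topology ?I (prod_topology (pts C) (pts A)))
          (prod_topology (pts C) (pts B)) (\<lambda>(t, x, y). (x, h (t, y)))"
        by (simp add: case_prod_unfold continuous_map_pairedI)
    qed
  qed (auto simp: smash_map_smash_proj[of id C C _ A B] hb)
  then have k: "continuous_map (prod_topology ?I (pts (smash C A))) (pts (smash C B)) ?k"
    using continuous_compose_quotient_map_eq[OF q] by blast
  have "based_map H (smash C A) (smash C B) (smash_map C B id (\<lambda>x. h (t, x)))" if t: "t \<in> {0..1}" for t
    unfolding based_map_def
  proof (intro conjI impI ballI)
    have "continuous_map (pts (smash C A)) (prod_topology ?I (pts (smash C A))) (\<lambda>z. (t, z))"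
      using t by (intro continuous_map_pairedI) auto
    from continuous_map_compose[OF this k]
    show "continuous_map (pts (smash C A)) (pts (smash C B)) (smash_map C B id (\<lambda>x. h (t, x)))"
      by (simp add: o_def)
    show "smash_map C B id (\<lambda>x. h (t, x)) (bpt (smash C A)) = bpt (smash C B)"
      by (simp add: smash_map_def)
    fix z assume H: "H = Whole_Group" and z: "z \<in> topspace (pts (smash C A))"
    have "h (t, act A x) = act B (h (t, x))" if "x \<in> topspace (pts A)" for x
      using h(4)[OF t] H that by (auto simp: based_map_def)
    moreover have "act B (bpt B) = bpt B"
      using h(4)[OF t] H bA A by (metis based_map_def is_c2_space_def)
    \<comment> \<open>\<open>act B\<close> is an involution at least on the image of \<open>h\<close>, as \<open>act A\<close> is one\<close>
    moreover have "act B (h (t, x)) = bpt B \<Longrightarrow> h (t, x) = bpt B" if "x \<in> topspace (pts A)" for x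
    proof -
      assume eq: "act B (h (t, x)) = bpt B"
      have "h (t, x) = h (t, act A (act A x))" using A that by (simp add: is_c2_space_def)
      also have "\<dots> = act B (act B (h (t, x)))"
        using calculation act_in[OF A] that \<open>\<And>x. x \<in> topspace (pts A) \<Longrightarrow> h (t, act A x) = act B (h (t, x))\<close> by metis
      finally show "h (t, x) = bpt B" using eq \<open>act B (bpt B) = bpt B\<close> by simp
    qed
    ultimately show "smash_map C B id (\<lambda>x. h (t, x)) (act (smash C A) z) =
        act (smash C B) (smash_map C B id (\<lambda>x. h (t, x)) z)"
      using z act_eq_bpt_iff[OF C] unfolding topspace_smash[OF bC bA] act_smash
      by (auto simp: smash_map_def smash_proj_def split: if_splits)
  qed
  then show ?thesis
    unfolding based_homotopic_def homotopic_with_def using k h(2,3) by (intro exI[of _ ?k]) auto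
qed

lemma based_map_smash_map:
  assumes "is_c2_space A" "is_c2_space C" "based_map H A B f"
  shows "based_map H (smash C A) (smash C B) (smash_map C B id f)"
  using based_homotopic_smash_map[OF assms(1,2) based_homotopic_refl[OF assms(3)]]
    based_homotopic_imp_based_map by blast


section \<open>Representation spheres\<close>

lemma topspace_rep:
  "topspace (rep p q) = {x. (\<forall>i\<ge>p. fst x i = 0) \<and> (\<forall>i\<ge>q. snd x i = 0)}"
  by (auto simp: rep_def topspace_Euclidean_space)

lemma continuous_map_rep:
  "continuous_map X (rep p q) f \<longleftrightarrow>
     (\<forall>x\<in>topspace X. f x \<in> topspace (rep p q)) \<and>
     (\<forall>i<p. continuous_map X euclideanreal (\<lambda>x. fst (f x) i)) \<and>
     (\<forall>i<q. continuous_map X euclideanreal (\<lambda>x. snd (f x) i))"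
proof -
  have euc: "continuous_map X (Euclidean_space m) g \<longleftrightarrow>
      (\<forall>x\<in>topspace X. \<forall>i\<ge>m. g x i = 0) \<and> (\<forall>i<m. continuous_map X euclideanreal (\<lambda>x. g x i))"
    for m and g :: "'a \<Rightarrow> nat \<Rightarrow> real"
  proof
    assume g: "continuous_map X (Euclidean_space m) g"
    then have "continuous_map X euclideanreal (\<lambda>x. g x i)" for i
      unfolding Euclidean_space_def continuous_map_in_subtopology by (simp add: continuous_map_componentwise_UNIV)
    moreover have "g x \<in> topspace (Euclidean_space m)" if "x \<in> topspace X" for x
      using g that by (meson continuous_map_image_subset_topspace image_subset_iff)
    ultimately show "(\<forall>x\<in>topspace X. \<forall>i\<ge>m. g x i = 0) \<and> (\<forall>i<m. continuous_map X euclideanreal (\<lambda>x. g x i))"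
      by (simp add: topspace_Euclidean_space)
  next
    assume g: "(\<forall>x\<in>topspace X. \<forall>i\<ge>m. g x i = 0) \<and> (\<forall>i<m. continuous_map X euclideanreal (\<lambda>x. g x i))"
    then have "continuous_map X (Euclidean_space m) (\<lambda>x i. if i < m then g x i else 0)"
      by (simp add: continuous_map_componentwise_Euclidean_space)
    then show "continuous_map X (Euclidean_space m) g"
      by (rule continuous_map_eq) (use g in \<open>auto simp: fun_eq_iff\<close>)
  qed
  have "continuous_map X (rep p q) f \<longleftrightarrow>
      continuous_map X (Euclidean_space p) (\<lambda>x. fst (f x)) \<and> continuous_map X (Euclidean_space q) (\<lambda>x. snd (f x))"
    by (simp add: rep_def continuous_map_pairwise o_def)
  then show ?thesis
    by (auto simp: euc topspace_rep)
qed

lemma continuous_map_rep_coordinates: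
  assumes "continuous_map X (rep p q) f"
  shows "continuous_map X euclideanreal (\<lambda>x. fst (f x) i)"
    and "continuous_map X euclideanreal (\<lambda>x. snd (f x) i)"
proof -
  have z: "fst (f x) i = 0 \<or> i < p" "snd (f x) i = 0 \<or> i < q" if "x \<in> topspace X" for x
    using assms that by (fastforce simp: continuous_map_rep topspace_rep not_less)+
  show "continuous_map X euclideanreal (\<lambda>x. fst (f x) i)"
  proof (cases "i < p")
    case True then show ?thesis using assms by (simp add: continuous_map_rep)
  next
    case False
    have "continuous_map X euclideanreal (\<lambda>x. 0)" by simp
    then show ?thesis by (rule continuous_map_eq) (use z False in auto)
  qed
  show "continuous_map X euclideanreal (\<lambda>x. snd (f x) i)"
  proof (cases "i < q")
    case True then show ?thesis using assms by (simp add: continuous_map_rep)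
  next
    case False
    have "continuous_map X euclideanreal (\<lambda>x. 0)" by simp
    then show ?thesis by (rule continuous_map_eq) (use z False in auto)
  qed
qed

lemma Hausdorff_space_rep: "Hausdorff_space (rep p q)"
  by (simp add: rep_def Hausdorff_space_prod_topology Hausdorff_Euclidean_space)

lemma locally_compact_space_rep: "locally_compact_space (rep p q)"
  by (simp add: rep_def locally_compact_space_prod_topology locally_compact_Euclidean_space)

lemma rep_sphere_simps [simp]:
  "pts (rep_sphere p q) = Alexandroff_compactification (rep p q)"
  "bpt (rep_sphere p q) = None" "act (rep_sphere p q) = map_option flip"
  by (simp_all add: rep_sphere_def)

lemma one_point_compactification_rep_sphere:
  "one_point_compactification (rep p q) (rep_sphere p q) Some"
  by (rule one_point_compactification_Alexandroff)
    (simp_all add: Hausdorff_space_rep locally_compact_space_rep)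

lemma flip_in_rep [simp]: "flip x \<in> topspace (rep p q) \<longleftrightarrow> x \<in> topspace (rep p q)"
  by (auto simp: topspace_rep flip_def case_prod_unfold)

lemma flip_flip [simp]: "flip (flip x) = x"
  by (simp add: flip_def case_prod_unfold)

lemma fst_flip [simp]: "fst (flip x) = fst x" and snd_flip: "snd (flip x) = (\<lambda>i. - snd x i)"
  by (simp_all add: flip_def case_prod_unfold)

lemma continuous_map_in: "continuous_map X Y f \<Longrightarrow> x \<in> topspace X \<Longrightarrow> f x \<in> topspace Y"
  by (meson continuous_map_image_subset_topspace image_subset_iff)

lemma continuous_map_flip:
  assumes f: "continuous_map X (rep p q) f"
  shows "continuous_map X (rep p q) (\<lambda>x. flip (f x))"
  using continuous_map_in[OF f] continuous_map_rep_coordinates[OF f]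
  by (simp add: continuous_map_rep snd_flip continuous_map_minus)

lemma homeomorphic_map_flip: "homeomorphic_map (rep p q) (rep p q) flip"
  using continuous_map_flip[of "rep p q" p q "\<lambda>x. x"]
  by (auto simp: homeomorphic_map_maps homeomorphic_maps_def intro!: exI[of _ flip])

text \<open>The actions on spheres and Thom spaces are given by homeomorphisms of the complement of the base
  point, and so are continuous at the base point as well.\<close>

lemma is_c2_space_one_point_compactification:
  assumes A: "one_point_compactification X A j" and f: "homeomorphic_map X X f"
    and "act A (bpt A) = bpt A" and ext: "\<And>x. x \<in> topspace X \<Longrightarrow> act A (j x) = j (f x)"
    and inv: "\<And>x. x \<in> topspace X \<Longrightarrow> f (f x) = x"
  shows "is_c2_space A"
proof -
  have "homeomorphic_map (pts A) (pts A) (act A)"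
    by (rule one_point_compactification_extend[OF A A f]) (use assms in auto)
  then have "continuous_map (pts A) (pts A) (act A)" by (rule homeomorphic_imp_continuous_map)
  moreover have "act A (act A x) = x" if "x \<in> topspace (pts A)" for x
  proof (cases "x = bpt A")
    case False
    then have "x \<in> j ` topspace X"
      using A that by (simp add: one_point_compactification_def)
    then obtain y where y: "y \<in> topspace X" "x = j y" by blast
    moreover have "f y \<in> topspace X"
      using f y by (metis homeomorphic_imp_surjective_map imageI)
    ultimately show ?thesis using ext inv by simp
  qed (use assms in simp)
  ultimately show ?thesis
    using A assms(3) by (simp add: is_c2_space_def based_map_def one_point_compactification_def)
qed

lemma is_c2_space_rep_sphere: "is_c2_space (rep_sphere p q)"
  by (rule is_c2_space_one_point_compactification[OF one_point_compactification_rep_sphere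
        homeomorphic_map_flip]) auto

text \<open>\<open>unstack\<close> extends a linear isomorphism \<open>\<real>\<^bsup>p+1\<^esup> \<oplus> \<real>\<^bsup>q+1\<^esup>\<sigma> \<cong> \<rho> \<oplus> (\<real>\<^sup>p \<oplus> \<real>\<^sup>q\<sigma>)\<close> to the one-point
  compactifications.\<close>

definition split_last :: "nat \<Rightarrow> nat \<Rightarrow> vec \<Rightarrow> vec \<times> vec" where
  "split_last p q x =
     (((\<lambda>_. 0)(0 := fst x p), (\<lambda>_. 0)(0 := snd x q)), ((fst x)(p := 0), (snd x)(q := 0)))"

definition append_last :: "nat \<Rightarrow> nat \<Rightarrow> vec \<times> vec \<Rightarrow> vec" where
  "append_last p q z = ((fst (snd z))(p := fst (fst z) 0), (snd (snd z))(q := snd (fst z) 0))"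

lemma homeomorphic_maps_split_last:
  "homeomorphic_maps (rep (Suc p) (Suc q)) (prod_topology (rep 1 1) (rep p q))
     (split_last p q) (append_last p q)"
proof -
  let ?X = "rep (Suc p) (Suc q)" and ?Y = "prod_topology (rep 1 1) (rep p q)"
  note co = continuous_map_rep_coordinates[of ?X "Suc p" "Suc q" "\<lambda>x. x", simplified]
  have y: "continuous_map ?Y (rep 1 1) fst" "continuous_map ?Y (rep p q) snd"
    by (simp_all add: continuous_map_fst continuous_map_snd)
  note co' = continuous_map_rep_coordinates[OF y(1)] continuous_map_rep_coordinates[OF y(2)]
  have "continuous_map ?X ?Y (split_last p q)"
    unfolding split_last_def
    by (intro continuous_map_pairedI)
      (auto simp: continuous_map_rep topspace_rep co le_Suc_eq split: if_splits)
  moreover have "continuous_map ?Y ?X (append_last p q)"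
    unfolding append_last_def
    by (auto simp del: One_nat_def simp: continuous_map_rep topspace_rep co' le_Suc_eq less_Suc_eq)
  moreover have "append_last p q (split_last p q x) = x" for x
    by (simp add: append_last_def split_last_def prod_eq_iff)
  moreover have "split_last p q (append_last p q z) = z" if "z \<in> topspace ?Y" for z
    using that by (auto simp: append_last_def split_last_def prod_eq_iff topspace_rep fun_eq_iff)
  ultimately show ?thesis by (simp add: homeomorphic_maps_def)
qed

lemma unstack_Some: "unstack p q (Some x) = Some (Some (fst (split_last p q x)), Some (snd (split_last p q x)))"
  by (cases x) (simp add: unstack_def split_last_def)

lemma stack_Some: "stack p q (Some (Some x, Some y)) = Some (append_last p q (x, y))"
  by (cases x; cases y) (simp add: stack_def append_last_def)

lemma flip_split_last: "map_prod flip flip (split_last p q x) = split_last p q (flip x)"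
  by (auto simp: split_last_def flip_def case_prod_unfold fun_eq_iff)

lemma flip_append_last: "flip (append_last p q z) = append_last p q (map_prod flip flip z)"
  by (cases z) (auto simp: append_last_def flip_def case_prod_unfold fun_eq_iff)

lemma based_map_unstack:
  "based_map H (rep_sphere (Suc p) (Suc q)) (smash (rho_sphere 1) (rep_sphere p q)) (unstack p q)"
proof -
  note sm = one_point_compactification_smash[OF one_point_compactification_rep_sphere[of 1 1]
      one_point_compactification_rep_sphere[of p q]]
  have "homeomorphic_map (rep (Suc p) (Suc q)) (prod_topology (rep 1 1) (rep p q)) (split_last p q)"
    using homeomorphic_maps_split_last homeomorphic_map_maps by blast
  from one_point_compactification_extend[OF one_point_compactification_rep_sphere sm this, of "unstack p q"]
  have "homeomorphic_map (pts (rep_sphere (Suc p) (Suc q))) (pts (smash (rho_sphere 1) (rep_sphere p q))) (unstack p q)"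
    by (simp add: unstack_Some case_prod_unfold) (simp add: unstack_def)
  moreover have "unstack p q (map_option flip z) = act (smash (rho_sphere 1) (rep_sphere p q)) (unstack p q z)" for z
  proof (cases z)
    case (Some x)
    then show ?thesis
      by (simp add: unstack_Some act_smash flip: flip_split_last)
  qed (simp add: unstack_def act_smash)
  ultimately show ?thesis
    unfolding based_map_def by (simp add: homeomorphic_imp_continuous_map) (simp add: unstack_def)
qed


section \<open>Homotopy groups of spectra\<close>

lemma stem_sphere_Suc:
  assumes "0 \<le> k + int m"
  shows "stem_sphere k (m + Suc r) = rep_sphere (Suc (nat (k + int (m + r)))) (Suc (m + r))"
proof -
  have "nat (k + int (m + Suc r)) = Suc (nat (k + int (m + r)))" using assms by linarith
  then show ?thesis by (simp add: stem_sphere_def)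
qed

lemma is_c2_space_stem_sphere: "is_c2_space (stem_sphere k m)"
  by (simp add: stem_sphere_def is_c2_space_rep_sphere)

lemma based_map_unstack_stem_sphere:
  assumes "0 \<le> k + int m"
  shows "based_map H (stem_sphere k (m + Suc r)) (smash (rho_sphere 1) (stem_sphere k (m + r)))
           (unstack (nat (k + int (m + r))) (m + r))"
  unfolding stem_sphere_Suc[OF assms] stem_sphere_def[of k "m + r"] by (rule based_map_unstack)

abbreviation stem_homotopic ::
  "'a c2_spectrum \<Rightarrow> c2_subgroup \<Rightarrow> int \<Rightarrow> nat \<Rightarrow> (vec option \<Rightarrow> 'a) \<Rightarrow> (vec option \<Rightarrow> 'a) \<Rightarrow> bool" where
  "stem_homotopic X H k m \<equiv> based_homotopic H (stem_sphere k m) (level X m)"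

lemma stabilise_homotopic:
  assumes X: "is_spectrum X" and k: "0 \<le> k + int m"
    and hom: "stem_homotopic X H k m \<alpha> \<beta>"
  shows "stem_homotopic X H k (m + r) (stabilise X k m \<alpha> r) (stabilise X k m \<beta> r)"
proof (induction r)
  case 0
  then show ?case using hom by simp
next
  case (Suc r)
  have bond: "based_map H (smash (rho_sphere 1) (level X (m + r))) (level X (m + Suc r)) (bond X (m + r))"
    using X by (auto simp: is_spectrum_def intro: based_map_Whole_Group)
  show ?case
    unfolding stabilise.simps(2)
    by (rule based_homotopic_compose_right[OF _ based_map_unstack_stem_sphere[OF k]],
        rule based_homotopic_compose_left[OF _ bond],
        rule based_homotopic_smash_map[OF is_c2_space_stem_sphere is_c2_space_rep_sphere Suc.IH])
qed

lemma stabilise_based_map: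
  assumes "is_spectrum X" "0 \<le> k + int m" "based_map H (stem_sphere k m) (level X m) \<alpha>"
  shows "based_map H (stem_sphere k (m + r)) (level X (m + r)) (stabilise X k m \<alpha> r)"
  using stabilise_homotopic[OF assms(1,2) based_homotopic_refl[OF assms(3)]]
    based_homotopic_imp_based_map by blast

lemma stabilise_add:
  "stabilise X k m \<alpha> (r + s) = stabilise X k (m + r) (stabilise X k m \<alpha> r) s"
  by (induction s) (simp_all add: add.assoc)

lemma stems_stabilise:
  assumes "is_spectrum X" "(m, \<alpha>) \<in> stems X H k"
  shows "(m + r, stabilise X k m \<alpha> r) \<in> stems X H k"
    and "((m, \<alpha>), (m + r, stabilise X k m \<alpha> r)) \<in> stably_homotopic X H k"
proof -
  have b: "based_map H (stem_sphere k (m + r)) (level X (m + r)) (stabilise X k m \<alpha> r)"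
    using stabilise_based_map assms by (auto simp: stems_def)
  show st: "(m + r, stabilise X k m \<alpha> r) \<in> stems X H k"
    using b assms by (simp add: stems_def)
  have "stem_homotopic X H k (m + r) (stabilise X k m \<alpha> r)
      (stabilise X k (m + r) (stabilise X k m \<alpha> r) 0)"
    using based_homotopic_refl[OF b] by simp
  then show "((m, \<alpha>), (m + r, stabilise X k m \<alpha> r)) \<in> stably_homotopic X H k"
    unfolding stably_homotopic_def using assms(2) st
    by (simp del: stabilise.simps) (metis add_0_right)
qed

lemma stably_homotopicI:
  assumes "(m, \<alpha>) \<in> stems X H k" "(m', \<alpha>') \<in> stems X H k" "m + r = m' + r'"
    "stem_homotopic X H k (m + r) (stabilise X k m \<alpha> r) (stabilise X k m' \<alpha>' r')"
  shows "((m, \<alpha>), (m', \<alpha>')) \<in> stably_homotopic X H k"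
proof -
  have "\<exists>r r'. m + r = m' + r' \<and> stem_homotopic X H k (m + r)
      (stabilise X k m \<alpha> r) (stabilise X k m' \<alpha>' r')"
    using assms(3,4) by blast
  then show ?thesis using assms(1,2) by (simp only: stably_homotopic_def mem_Collect_eq case_prod_conv)
qed

text \<open>A homotopy witnessing the relation persists under all further suspensions.\<close>

lemma stably_homotopicE:
  assumes X: "is_spectrum X" and h: "((m, \<alpha>), (m', \<alpha>')) \<in> stably_homotopic X H k"
  obtains r r' where "(m, \<alpha>) \<in> stems X H k" "(m', \<alpha>') \<in> stems X H k" "m + r = m' + r'"
    "\<And>s. stem_homotopic X H k (m + (r + s))
       (stabilise X k m \<alpha> (r + s)) (stabilise X k m' \<alpha>' (r' + s))"
proof -
  obtain r r' where r: "(m, \<alpha>) \<in> stems X H k" "(m', \<alpha>') \<in> stems X H k" "m + r = m' + r'"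
    "stem_homotopic X H k (m + r) (stabilise X k m \<alpha> r) (stabilise X k m' \<alpha>' r')"
    using h by (auto simp: stably_homotopic_def)
  have "0 \<le> k + int (m + r)" using r(1) by (simp add: stems_def)
  from stabilise_homotopic[OF X this r(4)]
  have "stem_homotopic X H k (m + (r + s))
      (stabilise X k m \<alpha> (r + s)) (stabilise X k m' \<alpha>' (r' + s))" for s
    unfolding stabilise_add by (simp add: r(3) add.assoc[symmetric])
  then show thesis using that r by blast
qed

lemma equiv_stably_homotopic:
  assumes X: "is_spectrum X"
  shows "equiv (stems X H k) (stably_homotopic X H k)"
proof (rule equivI)
  show "stably_homotopic X H k \<subseteq> stems X H k \<times> stems X H k"
    by (auto simp: stably_homotopic_def)
  show "refl_on (stems X H k) (stably_homotopic X H k)"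
  proof (rule refl_onI)
    fix z assume z: "z \<in> stems X H k"
    obtain m \<alpha> where [simp]: "z = (m, \<alpha>)" by (cases z)
    show "(z, z) \<in> stably_homotopic X H k" using stems_stabilise(2)[OF X, of m \<alpha> H k 0] z by simp
  qed
  show "sym (stably_homotopic X H k)"
  proof (rule symI)
    fix a b assume ab: "(a, b) \<in> stably_homotopic X H k"
    obtain m \<alpha> m' \<alpha>' where [simp]: "a = (m, \<alpha>)" "b = (m', \<alpha>')" by (cases a; cases b)
    from stably_homotopicE[OF X ab[simplified]] obtain r r' where r:
      "(m, \<alpha>) \<in> stems X H k" "(m', \<alpha>') \<in> stems X H k" "m + r = m' + r'"
      "\<And>s. stem_homotopic X H k (m + (r + s))
       (stabilise X k m \<alpha> (r + s)) (stabilise X k m' \<alpha>' (r' + s))" by metis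
    from r(4)[of 0] show "(b, a) \<in> stably_homotopic X H k"
      using stably_homotopicI[OF r(2,1) r(3)[symmetric]] r(3)
      by (simp add: based_homotopic_sym)
  qed
  show "trans (stably_homotopic X H k)"
  proof (rule transI)
    fix a b c assume ab: "(a, b) \<in> stably_homotopic X H k" and bc: "(b, c) \<in> stably_homotopic X H k"
    obtain m1 a1 m2 a2 m3 a3 where [simp]: "a = (m1, a1)" "b = (m2, a2)" "c = (m3, a3)"
      by (cases a; cases b; cases c)
    from stably_homotopicE[OF X ab[simplified]] obtain r1 r2 where r:
      "(m1, a1) \<in> stems X H k" "m1 + r1 = m2 + r2"
      "\<And>s. stem_homotopic X H k (m1 + (r1 + s))
       (stabilise X k m1 a1 (r1 + s)) (stabilise X k m2 a2 (r2 + s))" by metis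
    from stably_homotopicE[OF X bc[simplified]] obtain s2 s3 where s:
      "(m3, a3) \<in> stems X H k" "m2 + s2 = m3 + s3"
      "\<And>s. stem_homotopic X H k (m2 + (s2 + s))
       (stabilise X k m2 a2 (s2 + s)) (stabilise X k m3 a3 (s3 + s))" by metis
    \<comment> \<open>compare both homotopies at the common level \<open>m2 + r2 + s2\<close>\<close>
    have e: "m2 + (s2 + r2) = m1 + (r1 + s2)" "s2 + r2 = r2 + s2" using r(2) by auto
    have "stem_homotopic X H k (m1 + (r1 + s2))
       (stabilise X k m1 a1 (r1 + s2)) (stabilise X k m3 a3 (s3 + r2))"
      using based_homotopic_trans[OF r(3)[of s2] s(3)[of r2, unfolded e(1), unfolded e(2)]] .
    then show "(a, c) \<in> stably_homotopic X H k"
      using stably_homotopicI[OF r(1) s(1), of "r1 + s2" "s3 + r2"] r(2) s(2) by simp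
  qed
qed

lemma smash_map_smash_map:
  "g (bpt B) = bpt B' \<Longrightarrow> smash_map C B' id g (smash_map C B id f z) = smash_map C B' id (g \<circ> f) z"
  by (auto simp: smash_map_def smash_proj_def split: option.split)

lemma smash_map_cong:
  assumes "is_c2_space A" "is_c2_space C" "z \<in> topspace (pts (smash C A))"
    "\<And>x. x \<in> topspace (pts A) \<Longrightarrow> f x = g x"
  shows "smash_map C B id f z = smash_map C B id g z"
  using assms by (auto simp: smash_map_def topspace_smash is_c2_space_def)

lemma stabilise_natural:
  assumes X: "is_spectrum X" and f: "spectrum_map X Y f"
    and \<alpha>: "(m, \<alpha>) \<in> stems X H k" and x: "x \<in> topspace (pts (stem_sphere k (m + r)))"
  shows "f (m + r) (stabilise X k m \<alpha> r x) = stabilise Y k m (f m \<circ> \<alpha>) r x"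
  using x
proof (induction r arbitrary: x)
  case 0
  then show ?case by simp
next
  case (Suc r)
  have k: "0 \<le> k + int m" and b: "based_map H (stem_sphere k m) (level X m) \<alpha>"
    using \<alpha> by (auto simp: stems_def)
  let ?u = "unstack (nat (k + int (m + r))) (m + r) x"
  have u: "?u \<in> topspace (pts (smash (rho_sphere 1) (stem_sphere k (m + r))))"
    using based_map_in[OF based_map_unstack_stem_sphere[OF k] Suc.prems] .
  let ?z = "smash_map (rho_sphere 1) (level X (m + r)) id (stabilise X k m \<alpha> r) ?u"
  have z: "?z \<in> topspace (pts (smash (rho_sphere 1) (level X (m + r))))"
    using based_map_in[OF based_map_smash_map[OF is_c2_space_stem_sphere is_c2_space_rep_sphere
          stabilise_based_map[OF X k b]] u] .
  have "f (m + Suc r) (bond X (m + r) ?z) =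
      bond Y (m + r) (smash_map (rho_sphere 1) (level Y (m + r)) id (f (m + r)) ?z)"
    using f z by (simp add: spectrum_map_def)
  also have "smash_map (rho_sphere 1) (level Y (m + r)) id (f (m + r)) ?z =
      smash_map (rho_sphere 1) (level Y (m + r)) id (f (m + r) \<circ> stabilise X k m \<alpha> r) ?u"
    using f by (intro smash_map_smash_map) (simp add: spectrum_map_def based_map_def)
  also have "\<dots> = smash_map (rho_sphere 1) (level Y (m + r)) id (stabilise Y k m (f m \<circ> \<alpha>) r) ?u"
    by (rule smash_map_cong[OF is_c2_space_stem_sphere is_c2_space_rep_sphere u]) (subst o_apply, rule Suc.IH)
  finally show ?case unfolding stabilise.simps comp_def .
qed

text \<open>Only the levels \<open>m \<ge> M\<close> matter for the homotopy groups: every class is represented at such a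
  level, and there a levelwise equivariant homeomorphism can be inverted.\<close>

lemma pi_isomorphism_eventually_homeomorphic:
  assumes X: "is_spectrum X" and Y: "is_spectrum Y" and f: "spectrum_map X Y f"
    and homeo: "\<And>m. M \<le> m \<Longrightarrow> homeomorphic_map (pts (level X m)) (pts (level Y m)) (f m)"
  shows "pi_isomorphism X Y f"
proof -
  have inverse: "\<exists>g. (\<forall>H. based_map H (level Y m) (level X m) g) \<and>
      (\<forall>x\<in>topspace (pts (level X m)). g (f m x) = x) \<and> (\<forall>y\<in>topspace (pts (level Y m)). f m (g y) = y)"
    if m: "M \<le> m" for m
  proof -
    obtain g where g: "homeomorphic_maps (pts (level X m)) (pts (level Y m)) (f m) g"
      using homeo[OF m] by (auto simp: homeomorphic_map_maps)
    then have cg: "continuous_map (pts (level Y m)) (pts (level X m)) g"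
      and gf: "\<And>x. x \<in> topspace (pts (level X m)) \<Longrightarrow> g (f m x) = x"
      and fg: "\<And>y. y \<in> topspace (pts (level Y m)) \<Longrightarrow> f m (g y) = y"
      by (auto simp: homeomorphic_maps_def)
    have cX: "is_c2_space (level X m)" and cY: "is_c2_space (level Y m)"
      using X Y by (auto simp: is_spectrum_def)
    have bf: "based_map Whole_Group (level X m) (level Y m) (f m)"
      using f by (simp add: spectrum_map_def)
    have "g (bpt (level Y m)) = bpt (level X m)"
      using gf[of "bpt (level X m)"] bf cX by (simp add: based_map_def is_c2_space_def)
    moreover have "g (act (level Y m) y) = act (level X m) (g y)"
      if y: "y \<in> topspace (pts (level Y m))" for y
    proof -
      have "g y \<in> topspace (pts (level X m))" using continuous_map_in[OF cg y] .
      then have "f m (act (level X m) (g y)) = act (level Y m) y"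
        using bf fg[OF y] by (simp add: based_map_def)
      then show ?thesis
        using gf[OF act_in[OF cX \<open>g y \<in> topspace (pts (level X m))\<close>]] by simp
    qed
    ultimately have "based_map H (level Y m) (level X m) g" for H
      using cg by (simp add: based_map_def)
    then show ?thesis using gf fg by blast
  qed
  have bf: "based_map H (level X m) (level Y m) (f m)" for H m
    using f by (auto simp: spectrum_map_def intro: based_map_Whole_Group)
  have stems: "(m, f m \<circ> \<alpha>) \<in> stems Y H k" if "(m, \<alpha>) \<in> stems X H k" for m \<alpha> H k
    using that based_map_compose[OF _ bf] by (auto simp: stems_def)
  have natural: "stem_homotopic Y H k (m + r)
      (f (m + r) \<circ> stabilise X k m \<alpha> r) (stabilise Y k m (f m \<circ> \<alpha>) r)"
    if "(m, \<alpha>) \<in> stems X H k" for m \<alpha> r H k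
  proof (rule based_homotopic_equal[OF is_c2_space_stem_sphere])
    have "based_map H (stem_sphere k (m + r)) (level X (m + r)) (stabilise X k m \<alpha> r)"
      using stabilise_based_map[OF X] that by (auto simp: stems_def)
    then show "based_map H (stem_sphere k (m + r)) (level Y (m + r)) (f (m + r) \<circ> stabilise X k m \<alpha> r)"
      by (rule based_map_compose[OF _ bf])
  qed (simp add: stabilise_natural[OF X f that])
  have respects: "((m, f m \<circ> \<alpha>), (m', f m' \<circ> \<alpha>')) \<in> stably_homotopic Y H k"
    if h: "((m, \<alpha>), (m', \<alpha>')) \<in> stably_homotopic X H k" for m \<alpha> m' \<alpha>' H k
  proof -
    from stably_homotopicE[OF X h] obtain r r' where r:
      "(m, \<alpha>) \<in> stems X H k" "(m', \<alpha>') \<in> stems X H k" "m + r = m' + r'"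
      "\<And>s. stem_homotopic X H k (m + (r + s))
       (stabilise X k m \<alpha> (r + s)) (stabilise X k m' \<alpha>' (r' + s))" by metis
    have "stem_homotopic Y H k (m + r)
        (f (m + r) \<circ> stabilise X k m \<alpha> r) (f (m + r) \<circ> stabilise X k m' \<alpha>' r')"
      using based_homotopic_compose_left[OF r(4)[of 0] bf] by simp
    then have "stem_homotopic Y H k (m + r)
        (stabilise Y k m (f m \<circ> \<alpha>) r) (stabilise Y k m' (f m' \<circ> \<alpha>') r')"
      using based_homotopic_trans[OF based_homotopic_trans[OF
            based_homotopic_sym[OF natural[OF r(1), of r]]] natural[OF r(2), of r', folded r(3)]]
      by blast
    then show ?thesis by (rule stably_homotopicI[OF stems[OF r(1)] stems[OF r(2)] r(3)])
  qed
  have class_eq: "induced_map Y f H k (stably_homotopic X H k `` {(m, \<alpha>)}) =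
      stably_homotopic Y H k `` {(m, f m \<circ> \<alpha>)}" if "(m, \<alpha>) \<in> stems X H k" for m \<alpha> H k
  proof -
    have "congruent (stably_homotopic X H k) (\<lambda>(m, \<alpha>). stably_homotopic Y H k `` {(m, f m \<circ> \<alpha>)})"
    proof (rule congruentI, clarify)
      fix m \<alpha> m' \<alpha>' assume "((m, \<alpha>), (m', \<alpha>')) \<in> stably_homotopic X H k"
      from equiv_class_eq[OF equiv_stably_homotopic[OF Y] respects[OF this]]
      show "stably_homotopic Y H k `` {(m, f m \<circ> \<alpha>)} = stably_homotopic Y H k `` {(m', f m' \<circ> \<alpha>')}" .
    qed
    from UN_equiv_class[OF equiv_stably_homotopic[OF X] this that]
    show ?thesis by (simp add: induced_map_def)
  qed
  \<comment> \<open>injectivity: a homotopy in \<open>Y\<close> is raised above level \<open>M\<close> and pulled back there\<close>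
  have reflect: "((m, \<alpha>), (m', \<alpha>')) \<in> stably_homotopic X H k"
    if st: "(m, \<alpha>) \<in> stems X H k" "(m', \<alpha>') \<in> stems X H k"
      and h: "((m, f m \<circ> \<alpha>), (m', f m' \<circ> \<alpha>')) \<in> stably_homotopic Y H k" for m \<alpha> m' \<alpha>' H k
  proof -
    from stably_homotopicE[OF Y h] obtain r r' where r: "m + r = m' + r'"
      "\<And>s. stem_homotopic Y H k (m + (r + s))
       (stabilise Y k m (f m \<circ> \<alpha>) (r + s)) (stabilise Y k m' (f m' \<circ> \<alpha>') (r' + s))" by metis
    let ?n = "m + (r + M)"
    have n: "m' + (r' + M) = ?n" using r(1) by simp
    obtain g where g: "based_map H (level Y ?n) (level X ?n) g"
      "\<And>x. x \<in> topspace (pts (level X ?n)) \<Longrightarrow> g (f ?n x) = x"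
      using inverse[of ?n] by auto
    have "stem_homotopic Y H k ?n
        (f ?n \<circ> stabilise X k m \<alpha> (r + M)) (f ?n \<circ> stabilise X k m' \<alpha>' (r' + M))"
      by (rule based_homotopic_trans[OF based_homotopic_trans[OF natural[OF st(1)] r(2)]
            based_homotopic_sym[OF natural[OF st(2), of "r' + M", unfolded n]]])
    from based_homotopic_compose_left[OF this g(1)]
    have gf: "stem_homotopic X H k ?n
        (g \<circ> (f ?n \<circ> stabilise X k m \<alpha> (r + M))) (g \<circ> (f ?n \<circ> stabilise X k m' \<alpha>' (r' + M)))" .
    have k: "0 \<le> k + int m" "0 \<le> k + int m'"
      "based_map H (stem_sphere k m) (level X m) \<alpha>" "based_map H (stem_sphere k m') (level X m') \<alpha>'"
      using st by (auto simp: stems_def)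
    note b = stabilise_based_map[OF X k(1,3), of "r + M"]
    note b' = stabilise_based_map[OF X k(2,4), of "r' + M", unfolded n]
    have "stem_homotopic X H k ?n
        (stabilise X k m \<alpha> (r + M)) (g \<circ> (f ?n \<circ> stabilise X k m \<alpha> (r + M)))"
      by (rule based_homotopic_equal[OF is_c2_space_stem_sphere b]) (simp add: g(2) based_map_in[OF b])
    moreover have "stem_homotopic X H k ?n
        (stabilise X k m' \<alpha>' (r' + M)) (g \<circ> (f ?n \<circ> stabilise X k m' \<alpha>' (r' + M)))"
      by (rule based_homotopic_equal[OF is_c2_space_stem_sphere b']) (simp add: g(2) based_map_in[OF b'])
    ultimately have "stem_homotopic X H k ?n
        (stabilise X k m \<alpha> (r + M)) (stabilise X k m' \<alpha>' (r' + M))"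
      using based_homotopic_trans[OF based_homotopic_trans[OF _ gf] based_homotopic_sym] by blast
    then show ?thesis by (rule stably_homotopicI[OF st n[symmetric]])
  qed
  \<comment> \<open>surjectivity: from level \<open>M\<close> on, a map into \<open>Y\<close> lifts along the inverse of \<open>f\<close>\<close>
  have lift: "\<exists>n \<alpha>. (n, \<alpha>) \<in> stems X H k \<and> ((m, \<beta>), (n, f n \<circ> \<alpha>)) \<in> stably_homotopic Y H k"
    if st: "(m, \<beta>) \<in> stems Y H k" for m \<beta> H k
  proof -
    let ?n = "m + M" and ?\<beta> = "stabilise Y k m \<beta> M"
    obtain g where g: "based_map H (level Y ?n) (level X ?n) g"
      "\<And>y. y \<in> topspace (pts (level Y ?n)) \<Longrightarrow> f ?n (g y) = y"
      using inverse[of ?n] by auto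
    note s = stems_stabilise[OF Y st, of M]
    have b: "based_map H (stem_sphere k ?n) (level Y ?n) ?\<beta>" and k: "0 \<le> k + int ?n"
      using s(1) by (auto simp: stems_def)
    have st': "(?n, g \<circ> ?\<beta>) \<in> stems X H k"
      using based_map_compose[OF b g(1)] k by (simp add: stems_def)
    have "stem_homotopic Y H k ?n ?\<beta> (f ?n \<circ> (g \<circ> ?\<beta>))"
      by (rule based_homotopic_equal[OF is_c2_space_stem_sphere b]) (simp add: g(2) based_map_in[OF b])
    then have "((?n, ?\<beta>), (?n, f ?n \<circ> (g \<circ> ?\<beta>))) \<in> stably_homotopic Y H k"
      using stably_homotopicI[OF s(1) stems[OF st'], of 0 0] by simp
    then have "((m, \<beta>), (?n, f ?n \<circ> (g \<circ> ?\<beta>))) \<in> stably_homotopic Y H k"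
      using s(2) equiv_stably_homotopic[OF Y] by (meson equivE transD)
    then show ?thesis using st' by blast
  qed
  have "bij_betw (induced_map Y f H k) (homotopy_group X H k) (homotopy_group Y H k)" for H k
    unfolding bij_betw_def
  proof
    show "inj_on (induced_map Y f H k) (homotopy_group X H k)"
    proof (rule inj_onI)
      fix c d assume c: "c \<in> homotopy_group X H k" and d: "d \<in> homotopy_group X H k"
        and eq: "induced_map Y f H k c = induced_map Y f H k d"
      obtain m \<alpha> where c': "(m, \<alpha>) \<in> stems X H k" "c = stably_homotopic X H k `` {(m, \<alpha>)}"
        using c unfolding homotopy_group_def by (metis quotientE surj_pair)
      obtain m' \<alpha>' where d': "(m', \<alpha>') \<in> stems X H k" "d = stably_homotopic X H k `` {(m', \<alpha>')}"
        using d unfolding homotopy_group_def by (metis quotientE surj_pair)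
      have "((m, f m \<circ> \<alpha>), (m', f m' \<circ> \<alpha>')) \<in> stably_homotopic Y H k"
        using eq c' d' class_eq eq_equiv_class[OF _ equiv_stably_homotopic[OF Y] stems[OF d'(1)]] by simp
      from reflect[OF c'(1) d'(1) this] show "c = d"
        using c' d' equiv_class_eq[OF equiv_stably_homotopic[OF X]] by simp
    qed
    show "induced_map Y f H k ` homotopy_group X H k = homotopy_group Y H k"
    proof
      show "induced_map Y f H k ` homotopy_group X H k \<subseteq> homotopy_group Y H k"
      proof (rule image_subsetI)
        fix c assume "c \<in> homotopy_group X H k"
        then obtain m \<alpha> where "(m, \<alpha>) \<in> stems X H k" "c = stably_homotopic X H k `` {(m, \<alpha>)}"
          unfolding homotopy_group_def by (metis quotientE surj_pair)
        then show "induced_map Y f H k c \<in> homotopy_group Y H k"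
          using class_eq stems by (simp add: homotopy_group_def quotientI)
      qed
      show "homotopy_group Y H k \<subseteq> induced_map Y f H k ` homotopy_group X H k"
      proof
        fix c assume "c \<in> homotopy_group Y H k"
        then obtain m \<beta> where c: "(m, \<beta>) \<in> stems Y H k" "c = stably_homotopic Y H k `` {(m, \<beta>)}"
          unfolding homotopy_group_def by (metis quotientE surj_pair)
        obtain n \<alpha> where n: "(n, \<alpha>) \<in> stems X H k" "((m, \<beta>), (n, f n \<circ> \<alpha>)) \<in> stably_homotopic Y H k"
          using lift[OF c(1)] by blast
        have "c = induced_map Y f H k (stably_homotopic X H k `` {(n, \<alpha>)})"
          using c(2) class_eq[OF n(1)] equiv_class_eq[OF equiv_stably_homotopic[OF Y] n(2)] by simp
        moreover have "stably_homotopic X H k `` {(n, \<alpha>)} \<in> homotopy_group X H k"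
          using n(1) by (simp add: homotopy_group_def quotientI)
        ultimately show "c \<in> induced_map Y f H k ` homotopy_group X H k" by blast
      qed
    qed
  qed
  then show ?thesis using X Y f by (simp add: pi_isomorphism_def)
qed

lemma spectrum_map_compose:
  assumes Z: "is_spectrum Z" and g: "spectrum_map Z X g" and f: "spectrum_map X Y f"
  shows "spectrum_map Z Y (\<lambda>m. f m \<circ> g m)"
  unfolding spectrum_map_def
proof (intro allI conjI ballI)
  fix m
  show "based_map Whole_Group (level Z m) (level Y m) (f m \<circ> g m)"
    by (rule based_map_compose) (use f g in \<open>auto simp: spectrum_map_def\<close>)
  fix z assume z: "z \<in> topspace (pts (smash (rho_sphere 1) (level Z m)))"
  let ?w = "smash_map (rho_sphere 1) (level X m) id (g m) z"
  have "is_c2_space (level Z m)" "based_map Whole_Group (level Z m) (level X m) (g m)"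
    using Z g by (auto simp: is_spectrum_def spectrum_map_def)
  then have "?w \<in> topspace (pts (smash (rho_sphere 1) (level X m)))"
    using based_map_in[OF based_map_smash_map z] is_c2_space_rep_sphere by blast
  then have "f (Suc m) (g (Suc m) (bond Z m z)) = bond Y m (smash_map (rho_sphere 1) (level Y m) id (f m) ?w)"
    using f g z by (simp add: spectrum_map_def)
  also have "smash_map (rho_sphere 1) (level Y m) id (f m) ?w =
      smash_map (rho_sphere 1) (level Y m) id (f m \<circ> g m) z"
    using f by (intro smash_map_smash_map) (simp add: spectrum_map_def based_map_def)
  finally show "(f (Suc m) \<circ> g (Suc m)) (bond Z m z) =
      bond Y m (smash_map (rho_sphere 1) (level Y m) id (f m \<circ> g m) z)" by simp
qed


section \<open>Stable equivalences from eventual homeomorphisms\<close>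

text \<open>A zigzag of spectra requires its inner terms to have points in a prescribed type. An injection into
  that type carries the whole structure over.\<close>

definition transport_space :: "('a \<Rightarrow> 'b) \<Rightarrow> 'a c2_space \<Rightarrow> 'b c2_space" where
  "transport_space j A = \<lparr>pts = quotient_top (pts A) j, bpt = j (bpt A), act = j \<circ> act A \<circ> inv j\<rparr>"

definition transport_spectrum :: "('a \<Rightarrow> 'b) \<Rightarrow> 'a c2_spectrum \<Rightarrow> 'b c2_spectrum" where
  "transport_spectrum j X =
     \<lparr>level = (\<lambda>m. transport_space j (level X m)),
      bond = (\<lambda>m z. j (bond X m (smash_map (rho_sphere 1) (level X m) id (inv j) z)))\<rparr>"

lemma transport_space:
  assumes j: "inj j" and A: "is_c2_space A"
  shows "homeomorphic_maps (pts A) (pts (transport_space j A)) j (inv j)"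
    and "is_c2_space (transport_space j A)"
    and "based_map H A (transport_space j A) j"
    and "based_map H (transport_space j A) A (inv j)"
proof -
  let ?B = "transport_space j A"
  have inv: "inv j (j x) = x" for x using j by simp
  have top: "topspace (pts ?B) = j ` topspace (pts A)"
    by (simp add: transport_space_def topspace_quotient_top)
  have "quotient_map (pts A) (pts ?B) j"
    by (simp add: transport_space_def quotient_map_quotient_top)
  then have hm: "homeomorphic_map (pts A) (pts ?B) j"
    using j by (simp add: homeomorphic_map_def inj_on_subset[OF j])
  then show h: "homeomorphic_maps (pts A) (pts ?B) j (inv j)"
  proof -
    obtain g where g: "homeomorphic_maps (pts A) (pts ?B) j g"
      using hm by (auto simp: homeomorphic_map_maps)
    then have cg: "continuous_map (pts ?B) (pts A) g"
      and gj: "\<And>x. x \<in> topspace (pts A) \<Longrightarrow> g (j x) = x"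
      by (auto simp: homeomorphic_maps_def)
    have "continuous_map (pts ?B) (pts A) (inv j)"
      by (rule continuous_map_eq[OF cg]) (auto simp: top inv gj)
    then show ?thesis using g by (auto simp: homeomorphic_maps_def top inv)
  qed
  then have c: "continuous_map (pts A) (pts ?B) j" "continuous_map (pts ?B) (pts A) (inv j)"
    by (auto simp: homeomorphic_maps_def)
  have a: "bpt A \<in> topspace (pts A)" "continuous_map (pts A) (pts A) (act A)" "act A (bpt A) = bpt A"
    "\<And>x. x \<in> topspace (pts A) \<Longrightarrow> act A (act A x) = x"
    using A by (auto simp: is_c2_space_def based_map_def)
  have "continuous_map (pts ?B) (pts ?B) (j \<circ> act A \<circ> inv j)"
    using c a by (intro continuous_map_compose)
  then show "is_c2_space ?B"
    using a top act_in[OF A] by (auto simp: is_c2_space_def based_map_def transport_space_def inv)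
  show "based_map H A ?B j"
    using c by (auto simp: based_map_def transport_space_def inv)
  show "based_map H ?B A (inv j)"
    using c top by (auto simp: based_map_def transport_space_def inv)
qed

lemma transport_spectrum:
  assumes j: "inj j" and X: "is_spectrum X"
  shows "is_spectrum (transport_spectrum j X)"
    and "spectrum_map (transport_spectrum j X) X (\<lambda>m. inv j)"
proof -
  have A: "is_c2_space (level X m)" for m using X by (simp add: is_spectrum_def)
  note t = transport_space[OF j A]
  have "based_map Whole_Group (smash (rho_sphere 1) (transport_space j (level X m)))
      (transport_space j (level X (Suc m)))
      (j \<circ> (bond X m \<circ> smash_map (rho_sphere 1) (level X m) id (inv j)))" for m
  proof (rule based_map_compose[OF based_map_compose t(3)])
    show "based_map Whole_Group (smash (rho_sphere 1) (transport_space j (level X m)))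
        (smash (rho_sphere 1) (level X m)) (smash_map (rho_sphere 1) (level X m) id (inv j))"
      by (rule based_map_smash_map[OF t(2) is_c2_space_rep_sphere t(4)])
    show "based_map Whole_Group (smash (rho_sphere 1) (level X m)) (level X (Suc m)) (bond X m)"
      using X by (simp add: is_spectrum_def)
  qed
  then show "is_spectrum (transport_spectrum j X)"
    using t(2) by (simp add: is_spectrum_def transport_spectrum_def o_def)
  show "spectrum_map (transport_spectrum j X) X (\<lambda>m. inv j)"
    using t(4) j by (simp add: spectrum_map_def transport_spectrum_def)
qed

text \<open>A copy of \<open>X\<close> with points in the prescribed type serves for both ends of the zigzag.\<close>

lemma stably_equivalent_eventually_homeomorphic:
  fixes X :: "'a c2_spectrum" and Y :: "'b c2_spectrum"
  assumes X: "is_spectrum X" and Y: "is_spectrum Y" and f: "spectrum_map X Y f"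
    and homeo: "\<And>m. M \<le> m \<Longrightarrow> homeomorphic_map (pts (level X m)) (pts (level Y m)) (f m)"
  shows "X \<simeq>\<^sub>s Y"
proof -
  define j :: "'a \<Rightarrow> real \<Rightarrow> 'a + 'b" where "j = (\<lambda>a _. Inl a)"
  have j: "inj j" by (auto simp: j_def inj_def fun_eq_iff)
  let ?Z = "transport_spectrum j X"
  have hom: "homeomorphic_map (pts (level ?Z m)) (pts (level X m)) (inv j)" for m
    using transport_space(1)[OF j, of "level X m"] X
    by (simp add: is_spectrum_def transport_spectrum_def)
      (meson homeomorphic_map_maps homeomorphic_maps_sym)
  have "pi_isomorphism ?Z X (\<lambda>m. inv j)"
    by (rule pi_isomorphism_eventually_homeomorphic[OF transport_spectrum(1)[OF j X] X
          transport_spectrum(2)[OF j X] hom])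
  moreover have "pi_isomorphism ?Z Y (\<lambda>m. f m \<circ> inv j)"
  proof (rule pi_isomorphism_eventually_homeomorphic[OF transport_spectrum(1)[OF j X] Y])
    show "spectrum_map ?Z Y (\<lambda>m. f m \<circ> inv j)"
      by (rule spectrum_map_compose[OF transport_spectrum(1)[OF j X] transport_spectrum(2)[OF j X] f])
    show "homeomorphic_map (pts (level ?Z m)) (pts (level Y m)) (f m \<circ> inv j)" if "M \<le> m" for m
      by (rule homeomorphic_map_compose[OF hom homeo[OF that]])
  qed
  ultimately show ?thesis
    unfolding stably_equivalent_def pi_isomorphic_to_def
    by (intro exI[of _ ?Z] conjI equivclp_refl) blast+
qed


section \<open>Comparing desuspended suspension spectra\<close>

lemma based_map_one_point_compactification:
  assumes A: "one_point_compactification X A j" and B: "one_point_compactification Y B k"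
    and f: "homeomorphic_map X Y f"
    and base: "F (bpt A) = bpt B"
    and ext: "\<And>x. x \<in> topspace X \<Longrightarrow> F (j x) = k (f x)"
    and act: "act A (bpt A) = bpt A" "act B (bpt B) = bpt B"
      "\<And>x. x \<in> topspace X \<Longrightarrow> F (act A (j x)) = act B (F (j x))"
  shows "based_map Whole_Group A B F \<and> homeomorphic_map (pts A) (pts B) F"
proof -
  have h: "homeomorphic_map (pts A) (pts B) F"
    by (rule one_point_compactification_extend[OF A B f base ext])
  have "F (act A x) = act B (F x)" if "x \<in> topspace (pts A)" for x
  proof (cases "x = bpt A")
    case False
    then have "x \<in> j ` topspace X" using A that by (simp add: one_point_compactification_def)
    then show ?thesis using act(3) by auto
  qed (simp add: act base)
  then show ?thesis
    using base h by (simp add: based_map_def homeomorphic_imp_continuous_map)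
qed

lemma homeomorphic_map_shuffles:
  "homeomorphic_map (prod_topology X (prod_topology Y Z)) (prod_topology (prod_topology X Y) Z)
     (\<lambda>(x, y, z). ((x, y), z))"
  "homeomorphic_map (prod_topology X (prod_topology Y Z)) (prod_topology (prod_topology X Z) Y)
     (\<lambda>(x, y, z). ((x, z), y))"
  "homeomorphic_map (prod_topology X (prod_topology Y Z)) (prod_topology Y (prod_topology X Z))
     (\<lambda>(x, y, z). (y, x, z))"
  "homeomorphic_map (prod_topology (prod_topology X Y) Z) (prod_topology (prod_topology X Z) Y)
     (\<lambda>((x, y), z). ((x, z), y))"
proof -
  note [simp] = case_prod_unfold
  note p = continuous_map_fst continuous_map_snd
    continuous_map_compose[OF continuous_map_snd continuous_map_fst, unfolded o_def]
    continuous_map_compose[OF continuous_map_snd continuous_map_snd, unfolded o_def]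
    continuous_map_compose[OF continuous_map_fst continuous_map_fst, unfolded o_def]
    continuous_map_compose[OF continuous_map_fst continuous_map_snd, unfolded o_def]
  show "homeomorphic_map (prod_topology X (prod_topology Y Z)) (prod_topology (prod_topology X Y) Z)
     (\<lambda>(x, y, z). ((x, y), z))"
    unfolding homeomorphic_map_maps homeomorphic_maps_def
    by (rule exI[of _ "\<lambda>((x, y), z). (x, y, z)"]) (simp add: continuous_map_pairedI p)
  show "homeomorphic_map (prod_topology X (prod_topology Y Z)) (prod_topology (prod_topology X Z) Y)
     (\<lambda>(x, y, z). ((x, z), y))"
    unfolding homeomorphic_map_maps homeomorphic_maps_def
    by (rule exI[of _ "\<lambda>((x, z), y). (x, y, z)"]) (simp add: continuous_map_pairedI p)
  show "homeomorphic_map (prod_topology X (prod_topology Y Z)) (prod_topology Y (prod_topology X Z))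
     (\<lambda>(x, y, z). (y, x, z))"
    unfolding homeomorphic_map_maps homeomorphic_maps_def
    by (rule exI[of _ "\<lambda>(y, x, z). (x, y, z)"]) (simp add: continuous_map_pairedI p)
  show "homeomorphic_map (prod_topology (prod_topology X Y) Z) (prod_topology (prod_topology X Z) Y)
     (\<lambda>((x, y), z). ((x, z), y))"
    unfolding homeomorphic_map_maps homeomorphic_maps_def
    by (rule exI[of _ "\<lambda>((x, z), y). ((x, y), z)"]) (simp add: continuous_map_pairedI p)
qed

lemma homeomorphic_map_append_last:
  "homeomorphic_map (prod_topology (rep 1 1) (rep p q)) (rep (Suc p) (Suc q)) (append_last p q)"
  using homeomorphic_maps_split_last homeomorphic_maps_sym homeomorphic_map_maps by blast

text \<open>The isomorphism \<open>M\<rho> \<oplus> d\<rho> \<cong> (M+d)\<rho>\<close> that puts the coordinates of \<open>M\<rho>\<close> first.\<close>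

definition append_vec :: "nat \<Rightarrow> vec \<times> vec \<Rightarrow> vec" where
  "append_vec M z =
     (\<lambda>i. if i < M then fst (fst z) i else fst (snd z) (i - M),
      \<lambda>i. if i < M then snd (fst z) i else snd (snd z) (i - M))"

lemma homeomorphic_map_append_vec:
  "homeomorphic_map (prod_topology (rep M M) (rep d d)) (rep (M + d) (M + d)) (append_vec M)"
proof -
  let ?X = "prod_topology (rep M M) (rep d d)" and ?Y = "rep (M + d) (M + d)"
  let ?g = "\<lambda>x. ((\<lambda>i. if i < M then fst x i else 0, \<lambda>i. if i < M then snd x i else 0),
      (\<lambda>i. fst x (i + M), \<lambda>i. snd x (i + M))) :: vec \<times> vec"
  note co = continuous_map_rep_coordinates[OF continuous_map_fst[of "rep M M" "rep d d"]]
    continuous_map_rep_coordinates[OF continuous_map_snd[of "rep M M" "rep d d"]]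
  note co' = continuous_map_rep_coordinates[of ?Y "M + d" "M + d" "\<lambda>x. x", simplified]
  have "continuous_map ?X ?Y (append_vec M)"
    unfolding append_vec_def continuous_map_rep
    by (auto simp: topspace_rep co)
  moreover have "continuous_map ?Y ?X ?g"
    by (intro continuous_map_pairedI) (auto simp: continuous_map_rep topspace_rep co')
  moreover have "?g (append_vec M z) = z" if "z \<in> topspace ?X" for z
    using that by (auto simp: append_vec_def topspace_rep prod_eq_iff fun_eq_iff not_less)
  moreover have "append_vec M (?g x) = x" for x
    by (auto simp: append_vec_def prod_eq_iff fun_eq_iff)
  ultimately show ?thesis
    unfolding homeomorphic_map_maps homeomorphic_maps_def by blast
qed

lemma flip_append_vec: "flip (append_vec M z) = append_vec M (map_prod flip flip z)"
  by (cases z) (auto simp: append_vec_def flip_def case_prod_unfold fun_eq_iff)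

lemma append_last_append_vec:
  "append_last (M + d) (M + d) (s, append_vec M (w, u)) = append_vec M (w, append_last d d (s, u))"
  by (auto simp: append_last_def append_vec_def fun_eq_iff)

text \<open>The based \<open>C\<^sub>2\<close>-spaces \<open>A\<close> that occur below are one-point compactifications of locally compact
  \<open>C\<^sub>2\<close>-spaces, with the action extended by fixing the point at infinity.\<close>

definition compactifies :: "'x topology \<Rightarrow> ('x \<Rightarrow> 'x) \<Rightarrow> 'x option c2_space \<Rightarrow> bool" where
  "compactifies X g A \<longleftrightarrow>
     one_point_compactification X A Some \<and> bpt A = None \<and> act A = map_option g \<and>
     homeomorphic_map X X g \<and> (\<forall>x\<in>topspace X. g (g x) = x)"

lemma compactifies_is_c2_space: "compactifies X g A \<Longrightarrow> is_c2_space A"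
  unfolding compactifies_def
  by (rule is_c2_space_one_point_compactification[of X A Some g]) auto

lemma is_c2_space_level_shifted_suspension_spectrum:
  assumes "is_c2_space A"
  shows "is_c2_space (level (shifted_suspension_spectrum K A) m)"
  using is_c2_space_smash[OF is_c2_space_rep_sphere assms]
  by (simp add: shifted_suspension_spectrum_def is_c2_space_def based_map_def)

lemma bpt_level_shifted_suspension_spectrum [simp]:
  "bpt (level (shifted_suspension_spectrum K A) m) = None"
  by (simp add: shifted_suspension_spectrum_def)

lemma based_map_constant:
  assumes "is_c2_space B" "f = (\<lambda>_. bpt B)"
  shows "based_map H A B f"
  using assms by (simp add: based_map_def is_c2_space_def)

lemma is_spectrum_shifted_suspension_spectrum:
  assumes A: "compactifies X g A"
  shows "is_spectrum (shifted_suspension_spectrum K A)"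
  unfolding is_spectrum_def
proof (intro allI conjI)
  let ?S = "shifted_suspension_spectrum K A"
  note cA = compactifies_is_c2_space[OF A]
  note cl = is_c2_space_level_shifted_suspension_spectrum[OF cA]
  fix m
  show "is_c2_space (level ?S m)" by (rule cl)
  show "based_map Whole_Group (smash (rho_sphere 1) (level ?S m)) (level ?S (Suc m)) (bond ?S m)"
  proof (cases "m < K")
    case True
    then show ?thesis
      by (intro based_map_constant cl) (simp add: shifted_suspension_spectrum_def fun_eq_iff)
  next
    case False
    define d where "d = m - K"
    have d: "Suc m - K = Suc d" "\<not> Suc m < K" using False by (auto simp: d_def)
    have lev: "level ?S m = smash (rho_sphere d) A" "level ?S (Suc m) = smash (rho_sphere (Suc d)) A"
      using False d by (simp_all add: shifted_suspension_spectrum_def d_def)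
    have a: "one_point_compactification X A Some" "bpt A = None" "act A = map_option g"
      using A by (auto simp: compactifies_def)
    note opc = one_point_compactification_rep_sphere
    have h: "homeomorphic_map (prod_topology (rep 1 1) (prod_topology (rep d d) X)) (prod_topology (rep (Suc d) (Suc d)) X)
        (map_prod (append_last d d) id \<circ> (\<lambda>(x, y, z). ((x, y), z)))"
      by (rule homeomorphic_map_compose[OF homeomorphic_map_shuffles(1)])
        (rule homeomorphic_map_prod[OF homeomorphic_map_append_last homeomorphic_map_id[THEN iffD2, OF refl]])
    show ?thesis
      unfolding lev
    proof (rule based_map_one_point_compactification[THEN conjunct1, OF
          one_point_compactification_smash[OF opc one_point_compactification_smash[OF opc a(1)]]
          one_point_compactification_smash[OF opc a(1)] h])
      show "bond ?S m (bpt (smash (rho_sphere 1) (smash (rho_sphere d) A))) = bpt (smash (rho_sphere (Suc d)) A)"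
        using False by (simp add: shifted_suspension_spectrum_def)
      fix x assume "x \<in> topspace (prod_topology (rep 1 1) (prod_topology (rep d d) X))"
      obtain s t e where [simp]: "x = (s, t, e)" by (cases x)
      show "bond ?S m (case x of (x, y) \<Rightarrow> Some (Some x, case y of (x, y) \<Rightarrow> Some (Some x, Some y))) =
        (case (map_prod (append_last d d) id \<circ> (\<lambda>(x, y, z). ((x, y), z))) x of (x, y) \<Rightarrow> Some (Some x, Some y))"
        using False d by (simp add: shifted_suspension_spectrum_def smash_proj_def stack_Some a flip: d_def)
      show "bond ?S m (act (smash (rho_sphere 1) (smash (rho_sphere d) A))
          (case x of (x, y) \<Rightarrow> Some (Some x, case y of (x, y) \<Rightarrow> Some (Some x, Some y)))) =
        act (smash (rho_sphere (Suc d)) A)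
          (bond ?S m (case x of (x, y) \<Rightarrow> Some (Some x, case y of (x, y) \<Rightarrow> Some (Some x, Some y))))"
        using False d
        by (simp add: shifted_suspension_spectrum_def smash_proj_def stack_Some a act_smash flip_append_last flip: d_def)
    qed (simp_all add: act_smash)
  qed
qed

lemma is_spectrum_suspension_shifted_suspension_spectrum:
  assumes A: "compactifies X g A"
  shows "is_spectrum (suspension N (shifted_suspension_spectrum K A))"
  unfolding is_spectrum_def
proof (intro allI conjI)
  let ?S = "shifted_suspension_spectrum K A"
  let ?T = "suspension N ?S"
  have lT: "level ?T m = smash (rho_sphere N) (level ?S m)" for m by (simp add: suspension_def)
  note cA = compactifies_is_c2_space[OF A]
  have cl: "is_c2_space (level ?T m)" for m
    unfolding lT
    by (rule is_c2_space_smash[OF is_c2_space_rep_sphere is_c2_space_level_shifted_suspension_spectrum[OF cA]])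
  fix m
  show "is_c2_space (level ?T m)" by (rule cl)
  show "based_map Whole_Group (smash (rho_sphere 1) (level ?T m)) (level ?T (Suc m)) (bond ?T m)"
  proof (cases "m < K")
    case True
    have "bond ?S m z = None" for z using True by (simp add: shifted_suspension_spectrum_def)
    then have "bond ?T m = (\<lambda>_. bpt (level ?T (Suc m)))"
      unfolding lT by (simp add: suspension_def smash_proj_def fun_eq_iff split: option.split)
    then show ?thesis by (intro based_map_constant cl)
  next
    case False
    define d where "d = m - K"
    have d: "Suc m - K = Suc d" "\<not> Suc m < K" using False by (auto simp: d_def)
    have lev: "level ?T m = smash (rho_sphere N) (smash (rho_sphere d) A)"
      "level ?T (Suc m) = smash (rho_sphere N) (smash (rho_sphere (Suc d)) A)"
      using False d by (simp_all add: suspension_def shifted_suspension_spectrum_def d_def)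
    have a: "one_point_compactification X A Some" "bpt A = None" "act A = map_option g"
      using A by (auto simp: compactifies_def)
    have bond: "bond ?T m (Some (Some s, Some (Some t, Some (Some u, Some e)))) =
        Some (Some t, Some (Some (append_last d d (s, u)), Some e))" for s t u e
      using False d by (simp add: suspension_def shifted_suspension_spectrum_def smash_proj_def stack_Some a flip: d_def)
    note opc = one_point_compactification_rep_sphere
    have h: "homeomorphic_map (prod_topology (rep 1 1) (prod_topology (rep N N) (prod_topology (rep d d) X)))
        (prod_topology (rep N N) (prod_topology (rep (Suc d) (Suc d)) X))
        (map_prod id (map_prod (append_last d d) id \<circ> (\<lambda>(x, y, z). ((x, y), z))) \<circ> (\<lambda>(x, y, z). (y, x, z)))"
      by (rule homeomorphic_map_compose[OF homeomorphic_map_shuffles(3)]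
          homeomorphic_map_prod homeomorphic_map_id[THEN iffD2, OF refl]
          homeomorphic_map_compose[OF homeomorphic_map_shuffles(1)] homeomorphic_map_append_last)+
    show ?thesis
      unfolding lev
    proof (rule based_map_one_point_compactification[THEN conjunct1, OF
          one_point_compactification_smash[OF opc one_point_compactification_smash[OF opc one_point_compactification_smash[OF opc a(1)]]]
          one_point_compactification_smash[OF opc one_point_compactification_smash[OF opc a(1)]] h], goal_cases)
      case 1
      then show ?case by (simp add: suspension_def)
    next
      case (2 x)
      obtain s t u e where [simp]: "x = (s, t, u, e)" by (cases x)
      show ?case by (simp add: bond)
    next
      case (5 x)
      obtain s t u e where [simp]: "x = (s, t, u, e)" by (cases x)
      show ?case by (simp add: bond act_smash a flip_append_last)
    qed (simp_all add: act_smash)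
  qed
qed

text \<open>An equivariant homeomorphism between the spaces \<open>N\<rho> \<times> X\<close> and \<open>M\<rho> \<times> Y\<close> suffices to compare
  \<open>\<Sigma>\<^bsup>N\<rho>\<^esup> \<Sigma>\<^bsup>-(M+q)\<rho>\<^esup> X\<^sup>+\<close> and \<open>\<Sigma>\<^bsup>-q\<rho>\<^esup> Y\<^sup>+\<close>, where \<open>+\<close> is the one-point compactification. In the levels
  \<open>m \<ge> M + q\<close> it is crossed with \<open>(m - M - q)\<rho>\<close>; placing \<open>M\<rho>\<close> in front of this summand makes the
  result compatible with bonding maps, which append coordinates at the end.\<close>

lemma suspension_shifted_suspension_spectrum_equivalent:
  assumes A: "compactifies X g A" and B: "compactifies Y g' B"
    and h: "homeomorphic_map (prod_topology (rep N N) X) (prod_topology (rep M M) Y) h"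
    and h_act: "\<And>t e. t \<in> topspace (rep N N) \<Longrightarrow> e \<in> topspace X \<Longrightarrow>
      h (flip t, g e) = map_prod flip g' (h (t, e))"
  shows "suspension N (shifted_suspension_spectrum (M + q) A) \<simeq>\<^sub>s shifted_suspension_spectrum q B"
proof -
  let ?S = "shifted_suspension_spectrum (M + q) A"
  let ?X = "suspension N ?S" and ?Y = "shifted_suspension_spectrum q B"
  have a: "one_point_compactification X A Some" "bpt A = None" "act A = map_option g"
    and b: "one_point_compactification Y B Some" "bpt B = None" "act B = map_option g'"
    using A B by (auto simp: compactifies_def)
  define f where "f = (\<lambda>m z. case z of
      Some (Some t, Some (Some s, Some e)) \<Rightarrow>
        if m < M + q then None else Some (Some (append_vec M (fst (h (t, e)), s)), Some (snd (h (t, e))))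
    | _ \<Rightarrow> None)"
  have f_simps: "f m None = None"
    "\<not> m < M + q \<Longrightarrow> f m (Some (Some t, Some (Some s, Some e))) =
      Some (Some (append_vec M (fst (h (t, e)), s)), Some (snd (h (t, e))))"
    "m < M + q \<Longrightarrow> f m z = None" for m t s e z
    by (auto simp: f_def split: option.split)
  have lX: "level ?X m = (if m < M + q then smash (rho_sphere N) \<lparr>pts = discrete_topology {None}, bpt = None, act = id\<rparr>
      else smash (rho_sphere N) (smash (rho_sphere (m - (M + q))) A))" for m
    unfolding suspension_def shifted_suspension_spectrum_def by simp
  have bA: "None \<in> topspace (pts A)" using a by (simp add: one_point_compactification_def)
  have Xbase: "topspace (pts (level ?X m)) = {None}" if "m < M + q" for m
    using that unfolding lX by (simp add: topspace_smash)
  have cY: "is_c2_space (level ?Y m)" for m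
    by (rule is_c2_space_level_shifted_suspension_spectrum[OF compactifies_is_c2_space[OF B]])
  have f_high: "based_map Whole_Group (level ?X m) (level ?Y m) (f m) \<and>
    homeomorphic_map (pts (level ?X m)) (pts (level ?Y m)) (f m)" if m: "M + q \<le> m" for m
  proof -
    define d where "d = m - (M + q)"
    have d: "m - q = M + d" "\<not> m < M + q" "\<not> m < q" using m by (auto simp: d_def)
    have lev: "level ?X m = smash (rho_sphere N) (smash (rho_sphere d) A)"
      unfolding lX using d(2) by (simp add: d_def)
    have lev': "level ?Y m = smash (rho_sphere (M + d)) B"
      using d by (simp add: shifted_suspension_spectrum_def)
    note opc = one_point_compactification_rep_sphere
    have H: "homeomorphic_map (prod_topology (rep N N) (prod_topology (rep d d) X)) (prod_topology (rep (M + d) (M + d)) Y)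
        (map_prod (append_vec M) id \<circ> ((\<lambda>((x, y), z). ((x, z), y)) \<circ> (map_prod h id \<circ> (\<lambda>(x, y, z). ((x, z), y)))))"
      by (rule homeomorphic_map_compose homeomorphic_map_shuffles(2,4)
          homeomorphic_map_prod[OF h homeomorphic_map_id[THEN iffD2, OF refl]]
          homeomorphic_map_prod[OF homeomorphic_map_append_vec homeomorphic_map_id[THEN iffD2, OF refl]])+
    have ext: "f m (Some (Some t, Some (Some s, Some e))) =
        Some (Some (append_vec M (fst (h (t, e)), s)), Some (snd (h (t, e))))" for t s e
      using f_simps(2)[OF d(2)] .
    show ?thesis
      unfolding lev lev'
    proof (rule based_map_one_point_compactification[OF
          one_point_compactification_smash[OF opc one_point_compactification_smash[OF opc a(1)]]
          one_point_compactification_smash[OF opc b(1)] H], goal_cases)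
      case (2 x)
      obtain t s e where [simp]: "x = (t, s, e)" by (cases x)
      show ?case by (simp add: ext case_prod_unfold)
    next
      case (5 x)
      obtain t s e where [simp]: "x = (t, s, e)" by (cases x)
      have "t \<in> topspace (rep N N)" "e \<in> topspace X" using 5 by auto
      then show ?case
        by (simp add: ext act_smash a b h_act flip_append_vec)
    qed (simp_all add: act_smash f_simps)
  qed
  have "spectrum_map ?X ?Y f"
    unfolding spectrum_map_def
  proof (intro allI conjI ballI)
    fix m
    show "based_map Whole_Group (level ?X m) (level ?Y m) (f m)"
    proof (cases "m < M + q")
      case True
      then show ?thesis by (intro based_map_constant cY) (simp add: f_simps fun_eq_iff)
    qed (use f_high in simp)
    fix z assume z: "z \<in> topspace (pts (smash (rho_sphere 1) (level ?X m)))"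
    show "f (Suc m) (bond ?X m z) = bond ?Y m (smash_map (rho_sphere 1) (level ?Y m) id (f m) z)"
    proof (cases "m < M + q")
      case True
      then have "z = None"
        using z Xbase[OF True] by (simp add: topspace_smash lX)
      then show ?thesis
        by (simp add: suspension_def f_simps smash_map_def shifted_suspension_spectrum_def)
    next
      case False
      define d where "d = m - (M + q)"
      have d: "m - q = M + d" "\<not> m < q" "Suc m - q = Suc (M + d)" "Suc m - (M + q) = Suc d"
        "\<not> Suc m < M + q" "\<not> Suc m < q" using False by (auto simp: d_def)
      have lev: "level ?X m = smash (rho_sphere N) (smash (rho_sphere d) A)"
        using False by (simp add: lX d_def)
      have tA: "topspace (pts A) - {None} = Some ` topspace X"
        using a by (simp add: one_point_compactification_def)
      show ?thesis
      proof (cases "z = None")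
        case True
        then show ?thesis
          by (simp add: suspension_def f_simps smash_map_def shifted_suspension_spectrum_def)
      next
        case z': False
        obtain s t u e where [simp]: "z = Some (Some s, Some (Some t, Some (Some u, Some e)))"
          using z z' unfolding lev by (auto simp: topspace_smash bA tA a)
        have "bond ?X m z = Some (Some t, Some (Some (append_last d d (s, u)), Some e))"
          using False d
          by (simp add: suspension_def shifted_suspension_spectrum_def smash_proj_def stack_Some a flip: d_def)
        moreover have "smash_map (rho_sphere 1) (level ?Y m) id (f m) z =
            Some (Some s, Some (Some (append_vec M (fst (h (t, e)), u)), Some (snd (h (t, e)))))"
          by (simp add: smash_map_def f_simps(2)[OF False] smash_proj_def)
        moreover have "bond ?Y m \<dots> =
            Some (Some (append_last (M + d) (M + d) (s, append_vec M (fst (h (t, e)), u))), Some (snd (h (t, e))))"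
          using d by (simp add: shifted_suspension_spectrum_def smash_proj_def stack_Some b)
        ultimately show ?thesis
          using f_simps(2)[OF d(5)] by (simp add: append_last_append_vec)
      qed
    qed
  qed
  then show ?thesis
    using stably_equivalent_eventually_homeomorphic[OF is_spectrum_suspension_shifted_suspension_spectrum[OF A]
        is_spectrum_shifted_suspension_spectrum[OF B] _ f_high[THEN conjunct2]] by blast
qed

lemma compactifies_thom_space:
  assumes "Hausdorff_space (total_pts E)" "locally_compact_space (total_pts E)"
    "homeomorphic_map (total_pts E) (total_pts E) (total_act E)"
    "\<And>e. e \<in> topspace (total_pts E) \<Longrightarrow> total_act E (total_act E e) = e"
  shows "compactifies (total_pts E) (total_act E) (thom_space E)"
  unfolding compactifies_def
proof (intro conjI)
  show "one_point_compactification (total_pts E) (thom_space E) Some"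
    by (rule one_point_compactification_Alexandroff) (use assms in \<open>auto simp: thom_space_def\<close>)
qed (use assms in \<open>auto simp: thom_space_def\<close>)


section \<open>Linear algebra of the trivialisation\<close>

text \<open>The adjoint of the isometric embedding \<open>y \<mapsto> x \<otimes> y\<close>, for a unit vector \<open>x\<close>.\<close>

definition cotensor :: "nat \<Rightarrow> vec \<Rightarrow> vec \<Rightarrow> vec" where
  "cotensor n x w =
     ((\<lambda>_. 0)(0 := (\<Sum>i<n. fst x i * fst w i + snd x i * snd w i)),
      (\<lambda>_. 0)(0 := (\<Sum>i<n. snd x i * fst w (n + i) + fst x i * snd w (n + i))))"

definition zero_vec :: vec where "zero_vec = (\<lambda>_. 0, \<lambda>_. 0)"

definition add_vec :: "vec \<Rightarrow> vec \<Rightarrow> vec" where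
  "add_vec x y = (\<lambda>i. fst x i + fst y i, \<lambda>i. snd x i + snd y i)"

definition diff_vec :: "vec \<Rightarrow> vec \<Rightarrow> vec" where
  "diff_vec x y = (\<lambda>i. fst x i - fst y i, \<lambda>i. snd x i - snd y i)"

lemma tensor_altdef:
  "tensor n x y =
     (\<lambda>i. if i < n then fst x i * fst y 0 else if i < 2 * n then snd x (i - n) * snd y 0 else 0,
      \<lambda>i. if i < n then snd x i * fst y 0 else if i < 2 * n then fst x (i - n) * snd y 0 else 0)"
  by (simp add: tensor_def case_prod_unfold)

lemma vec_eqI: "(\<And>i. fst x i = fst y i) \<Longrightarrow> (\<And>i. snd x i = snd y i) \<Longrightarrow> x = (y :: vec)"
  by (auto simp: prod_eq_iff fun_eq_iff)

lemma zero_add_vec [simp]: "add_vec zero_vec x = x" "add_vec x zero_vec = x"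
  and add_diff_vec [simp]: "add_vec x (diff_vec y x) = y"
  and diff_zero_vec [simp]: "diff_vec x zero_vec = x"
  and diff_self_vec [simp]: "diff_vec x x = zero_vec"
  by (simp_all add: add_vec_def diff_vec_def zero_vec_def)

lemma add_diff_add_vec: "diff_vec (add_vec x y) x = y"
  by (simp add: add_vec_def diff_vec_def)

lemma vec_in_rep [simp]:
  "zero_vec \<in> topspace (rep p q)"
  "x \<in> topspace (rep p q) \<Longrightarrow> y \<in> topspace (rep p q) \<Longrightarrow> add_vec x y \<in> topspace (rep p q)"
  "x \<in> topspace (rep p q) \<Longrightarrow> y \<in> topspace (rep p q) \<Longrightarrow> diff_vec x y \<in> topspace (rep p q)"
  "neg x \<in> topspace (rep p q) \<longleftrightarrow> x \<in> topspace (rep p q)"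
  "tensor n x y \<in> topspace (rep (2 * n) (2 * n))"
  "cotensor n x w \<in> topspace (rep 1 1)"
  by (auto simp: topspace_rep zero_vec_def add_vec_def diff_vec_def neg_def tensor_altdef cotensor_def case_prod_unfold)

lemma cotensor_in_rep_Suc_0 [simp]: "cotensor n x w \<in> topspace (rep (Suc 0) (Suc 0))"
  using vec_in_rep(6) by simp

lemma fst_neg: "fst (neg x) = (\<lambda>i. - fst x i)" and snd_neg: "snd (neg x) = (\<lambda>i. - snd x i)"
  by (simp_all add: neg_def case_prod_unfold)

lemma neg_neg [simp]: "neg (neg x) = x"
  by (simp add: vec_eqI fst_neg snd_neg)

lemma flip_neg: "flip (neg x) = neg (flip x)"
  by (simp add: vec_eqI fst_neg snd_neg snd_flip)

lemma flip_zero_vec [simp]: "flip zero_vec = zero_vec"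
  and flip_add_vec: "flip (add_vec x y) = add_vec (flip x) (flip y)"
  by (simp_all add: vec_eqI snd_flip zero_vec_def add_vec_def diff_vec_def)

lemma cotensor_zero [simp]: "cotensor n x zero_vec = zero_vec"
  and tensor_zero [simp]: "tensor n x zero_vec = zero_vec"
  by (auto simp: vec_eqI cotensor_def zero_vec_def tensor_altdef)

lemma cotensor_add: "cotensor n x (add_vec v w) = add_vec (cotensor n x v) (cotensor n x w)"
  and cotensor_diff: "cotensor n x (diff_vec v w) = diff_vec (cotensor n x v) (cotensor n x w)"
  by (auto intro!: vec_eqI simp: cotensor_def add_vec_def diff_vec_def algebra_simps sum.distrib sum_subtractf)

lemma cotensor_neg: "cotensor n (neg x) w = neg (cotensor n x w)"
  by (auto intro!: vec_eqI simp: cotensor_def fst_neg snd_neg sum_negf algebra_simps sum_subtractf sum.distrib)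

lemma flip_cotensor: "flip (cotensor n x w) = cotensor n (flip x) (flip w)"
  by (auto intro!: vec_eqI simp: cotensor_def snd_flip sum_negf algebra_simps sum_subtractf sum.distrib)

lemma cotensor_tensor:
  assumes "dot n x x = 1" "y \<in> topspace (rep 1 1)"
  shows "cotensor n x (tensor n x y) = y"
proof -
  have "(\<Sum>i<n. fst x i * fst x i + snd x i * snd x i) = 1"
    using assms(1) by (simp add: dot_def sum.distrib)
  moreover have "(\<Sum>i<n. snd x i * (snd x i * c) + fst x i * (fst x i * c)) =
      (\<Sum>i<n. fst x i * fst x i + snd x i * snd x i) * c" for c
    unfolding sum_distrib_right by (rule sum.cong) (auto simp: algebra_simps)
  moreover have "(\<Sum>i<n. fst x i * (fst x i * c) + snd x i * (snd x i * c)) =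
      (\<Sum>i<n. fst x i * fst x i + snd x i * snd x i) * c" for c
    unfolding sum_distrib_right by (rule sum.cong) (auto simp: algebra_simps)
  ultimately show ?thesis
    using assms(2) by (intro vec_eqI) (auto simp: cotensor_def tensor_altdef topspace_rep)
qed

lemma dot_tensor_right: "dot (2 * n) w (tensor n x y) = dot 1 (cotensor n x w) y"
proof -
  have split: "(\<Sum>i<2 * n. f i) = (\<Sum>i<n. f i) + (\<Sum>i<n. f (n + i))" for f :: "nat \<Rightarrow> real"
    using sum.atLeastLessThan_concat[of 0 n "2 * n" f] sum.shift_bounds_nat_ivl[of f 0 n n]
    by (simp add: atLeast0LessThan mult_2 add.commute)
  show ?thesis
    unfolding dot_def split
    by (simp add: tensor_altdef cotensor_def sum_distrib_left sum_distrib_right sum.distrib algebra_simps)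
qed

text \<open>The fibres of \<open>\<xi>\<^sup>\<bottom>\<close> are the kernels of the adjoints.\<close>

lemma orthogonal_iff_cotensor:
  "(\<forall>y\<in>topspace (rep 1 1). dot (2 * n) w (tensor n x y) = 0) \<longleftrightarrow> cotensor n x w = zero_vec"
proof
  assume "\<forall>y\<in>topspace (rep 1 1). dot (2 * n) w (tensor n x y) = 0"
  then have "dot 1 (cotensor n x w) (cotensor n x w) = 0"
    using vec_in_rep(6) unfolding dot_tensor_right by blast
  then have "fst (cotensor n x w) 0 = 0" "snd (cotensor n x w) 0 = 0"
    by (auto simp: dot_def add_nonneg_eq_0_iff)
  then show "cotensor n x w = zero_vec"
    by (auto intro!: vec_eqI simp: cotensor_def zero_vec_def)
next
  assume "cotensor n x w = zero_vec"
  then show "\<forall>y\<in>topspace (rep 1 1). dot (2 * n) w (tensor n x y) = 0"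
    unfolding dot_tensor_right by (simp add: dot_def zero_vec_def)
qed

text \<open>The trivialisation of \<open>N\<xi>\<close>. If \<open>C\<^sub>0, \<dots>, C\<^bsub>2n-1\<^esub>\<close> is a family of orthogonal \<open>N \<times> N\<close> matrices as
  above and \<open>x = (a, b)\<close>, put \<open>K = \<Sum> a\<^sub>j C\<^sub>j\<close> and \<open>L = \<Sum> b\<^sub>j C\<^bsub>n+j\<^esub>\<close>. The matrix with rows \<open>(K, L)\<close> and
  \<open>(L, K)\<close> is linear in \<open>x\<close>, hence changes its sign with \<open>x\<close>, and it is orthogonal for unit vectors
  \<open>x\<close> because the coefficient vectors \<open>(a, 0)\<close> and \<open>(0, b)\<close> are orthogonal. Since \<open>K\<close> preserves and
  \<open>L\<close> exchanges the two eigenspaces of the generator of \<open>C\<^sub>2\<close> on \<open>N\<rho>\<close>, it is moreover equivariant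
  in \<open>x\<close>.\<close>

definition even_part :: "nat \<Rightarrow> (nat \<Rightarrow> nat \<Rightarrow> nat \<Rightarrow> real) \<Rightarrow> vec \<Rightarrow> nat \<Rightarrow> nat \<Rightarrow> real" where
  "even_part n C x i l = (\<Sum>j<n. fst x j * C j i l)"

definition odd_part :: "nat \<Rightarrow> (nat \<Rightarrow> nat \<Rightarrow> nat \<Rightarrow> real) \<Rightarrow> vec \<Rightarrow> nat \<Rightarrow> nat \<Rightarrow> real" where
  "odd_part n C x i l = (\<Sum>j<n. snd x j * C (n + j) i l)"

definition trivialise ::
  "nat \<Rightarrow> nat \<Rightarrow> (nat \<Rightarrow> nat \<Rightarrow> nat \<Rightarrow> real) \<Rightarrow> vec \<Rightarrow> (nat \<Rightarrow> vec) \<Rightarrow> vec" where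
  "trivialise n N C x y =
     (\<lambda>i. if i < N then \<Sum>l<N. even_part n C x i l * fst (y l) 0 + odd_part n C x i l * snd (y l) 0 else 0,
      \<lambda>i. if i < N then \<Sum>l<N. odd_part n C x i l * fst (y l) 0 + even_part n C x i l * snd (y l) 0 else 0)"

definition untrivialise ::
  "nat \<Rightarrow> nat \<Rightarrow> (nat \<Rightarrow> nat \<Rightarrow> nat \<Rightarrow> real) \<Rightarrow> vec \<Rightarrow> vec \<Rightarrow> nat \<Rightarrow> vec" where
  "untrivialise n N C x t l =
     ((\<lambda>_. 0)(0 := \<Sum>i<N. even_part n C x i l * fst t i + odd_part n C x i l * snd t i),
      (\<lambda>_. 0)(0 := \<Sum>i<N. odd_part n C x i l * fst t i + even_part n C x i l * snd t i))"

lemma part_neg: "even_part n C (neg x) i l = - even_part n C x i l"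
  "odd_part n C (neg x) i l = - odd_part n C x i l"
  by (simp_all add: even_part_def odd_part_def fst_neg snd_neg sum_negf)

lemma part_flip: "even_part n C (flip x) i l = even_part n C x i l"
  "odd_part n C (flip x) i l = - odd_part n C x i l"
  by (simp_all add: even_part_def odd_part_def snd_flip sum_negf)

lemma trivialise_neg: "trivialise n N C (neg x) (\<lambda>l. neg (y l)) = trivialise n N C x y"
  by (auto intro!: vec_eqI simp: trivialise_def part_neg fst_neg snd_neg)

lemma untrivialise_neg: "untrivialise n N C (neg x) t l = neg (untrivialise n N C x t l)"
  by (auto intro!: vec_eqI simp: untrivialise_def part_neg fst_neg snd_neg sum.distrib sum_subtractf sum_negf)

lemma untrivialise_flip: "untrivialise n N C (flip x) (flip t) l = flip (untrivialise n N C x t l)"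
  by (auto intro!: vec_eqI simp: untrivialise_def part_flip snd_flip sum.distrib sum_subtractf sum_negf)

lemma trivialise_in_rep [simp]: "trivialise n N C x y \<in> topspace (rep N N)"
  and untrivialise_in_rep [simp]: "untrivialise n N C x t l \<in> topspace (rep (Suc 0) (Suc 0))"
  by (auto simp: topspace_rep trivialise_def untrivialise_def)

text \<open>The defining relations are bilinear in the pair \<open>(C\<^sub>i, C\<^sub>j)\<close>.\<close>

lemma orthogonal_family_bilinear:
  assumes C: "orthogonal_family r N C" and kl: "k < N" "l < N"
  defines "G \<equiv> \<lambda>z i l. \<Sum>j<r. z j * C j i l"
  shows "(\<Sum>a<N. G z a k * G z' a l + G z' a k * G z a l) = (if k = l then 2 * (\<Sum>j<r. z j * z' j) else 0)"
proof -
  have prod: "G z a k * G z' a l + G z' a k * G z a l =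
      (\<Sum>i<r. \<Sum>j<r. z i * z' j * (C i a k * C j a l + C j a k * C i a l))" for a
  proof -
    have "G z' a k * G z a l = (\<Sum>i<r. \<Sum>j<r. z' i * C i a k * (z j * C j a l))"
      unfolding G_def sum_product ..
    also have "\<dots> = (\<Sum>j<r. \<Sum>i<r. z' i * C i a k * (z j * C j a l))" by (rule sum.swap)
    finally show ?thesis
      unfolding G_def sum_product by (simp add: algebra_simps sum.distrib)
  qed
  have "(\<Sum>a<N. G z a k * G z' a l + G z' a k * G z a l) =
      (\<Sum>i<r. \<Sum>j<r. z i * z' j * (\<Sum>a<N. C i a k * C j a l + C j a k * C i a l))"
    unfolding prod sum_distrib_left
    by (subst sum.swap, rule sum.cong[OF refl], subst sum.swap, rule refl)
  also have "\<dots> = (\<Sum>i<r. \<Sum>j<r. if i = j then (if k = l then 2 * (z i * z' j) else 0) else 0)"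
    using C kl by (intro sum.cong refl) (simp add: orthogonal_family_def)
  also have "\<dots> = (if k = l then 2 * (\<Sum>j<r. z j * z' j) else 0)"
    by (simp add: sum_distrib_left)
  finally show ?thesis .
qed

lemma orthogonal_family_transpose:
  "orthogonal_family r N C \<Longrightarrow> orthogonal_family r N (\<lambda>j k l. C j l k)"
  by (simp add: orthogonal_family_def)

lemma part_orthogonal:
  assumes C: "orthogonal_family (2 * n) N C" and x: "dot n x x = 1" and kl: "k < N" "l < N"
  defines "K \<equiv> even_part n C x" and "L \<equiv> odd_part n C x"
  shows "(\<Sum>a<N. K a k * K a l + L a k * L a l) = (if k = l then 1 else 0)"
    and "(\<Sum>a<N. K a k * L a l + L a k * K a l) = 0"
    and "(\<Sum>a<N. K k a * K l a + L k a * L l a) = (if k = l then 1 else 0)"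
    and "(\<Sum>a<N. K k a * L l a + L k a * K l a) = 0"
proof -
  have split: "(\<Sum>i<2 * n. f i) = (\<Sum>i<n. f i) + (\<Sum>i<n. f (n + i))" for f :: "nat \<Rightarrow> real"
    using sum.atLeastLessThan_concat[of 0 n "2 * n" f] sum.shift_bounds_nat_ivl[of f 0 n n]
    by (simp add: atLeast0LessThan mult_2 add.commute)
  \<comment> \<open>the coefficient vectors \<open>(a, 0)\<close> of \<open>K\<close> and \<open>(0, b)\<close> of \<open>L\<close>, which are orthogonal\<close>
  define z where "z = (\<lambda>j. if j < n then fst x j else 0)"
  define z' where "z' = (\<lambda>j. if j < n then 0 else snd x (j - n))"
  have K: "(\<Sum>j<2 * n. z j * C j i l) = K i l" and L: "(\<Sum>j<2 * n. z' j * C j i l) = L i l" for i l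
    unfolding split by (simp_all add: z_def z'_def K_def L_def even_part_def odd_part_def)
  have zz: "(\<Sum>j<2 * n. z j * z j) = (\<Sum>j<n. fst x j * fst x j)"
    "(\<Sum>j<2 * n. z' j * z' j) = (\<Sum>j<n. snd x j * snd x j)"
    "(\<Sum>j<2 * n. z j * z' j) = 0"
    unfolding split by (simp_all add: z_def z'_def)
  have norm: "(\<Sum>j<n. fst x j * fst x j) + (\<Sum>j<n. snd x j * snd x j) = 1"
    using x by (simp add: dot_def)
  note B = orthogonal_family_bilinear[OF C kl] orthogonal_family_bilinear[OF orthogonal_family_transpose[OF C] kl]
  note 1 = B[of z z, unfolded K zz] B[of z' z', unfolded L zz] B[of z z', unfolded K L zz]
  show "(\<Sum>a<N. K a k * L a l + L a k * K a l) = 0" "(\<Sum>a<N. K k a * L l a + L k a * K l a) = 0"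
    using 1(5,6) by simp_all
  show "(\<Sum>a<N. K a k * K a l + L a k * L a l) = (if k = l then 1 else 0)"
    "(\<Sum>a<N. K k a * K l a + L k a * L l a) = (if k = l then 1 else 0)"
    using 1(1-4) norm by (auto simp: sum.distrib simp flip: sum_distrib_left split: if_splits)
qed

lemma block_matrix_inverse:
  fixes K L :: "nat \<Rightarrow> nat \<Rightarrow> real"
  assumes "\<And>k l. k < N \<Longrightarrow> l < N \<Longrightarrow> (\<Sum>a<N. K a k * K a l + L a k * L a l) = (if k = l then 1 else 0)"
    and "\<And>k l. k < N \<Longrightarrow> l < N \<Longrightarrow> (\<Sum>a<N. K a k * L a l + L a k * K a l) = 0" and "k < N"
  shows "(\<Sum>a<N. K a k * (\<Sum>l<N. K a l * u l + L a l * v l) + L a k * (\<Sum>l<N. L a l * u l + K a l * v l)) = u k"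
proof -
  have "(\<Sum>a<N. K a k * (\<Sum>l<N. K a l * u l + L a l * v l) + L a k * (\<Sum>l<N. L a l * u l + K a l * v l)) =
      (\<Sum>a<N. \<Sum>l<N. (K a k * K a l + L a k * L a l) * u l + (K a k * L a l + L a k * K a l) * v l)"
    by (simp add: sum_distrib_left sum.distrib algebra_simps)
  also have "\<dots> = (\<Sum>l<N. (\<Sum>a<N. K a k * K a l + L a k * L a l) * u l + (\<Sum>a<N. K a k * L a l + L a k * K a l) * v l)"
  proof -
    have "(\<Sum>a<N. p a * c + q a * d) = (\<Sum>a<N. p a) * c + (\<Sum>a<N. q a) * d" for p q and c d :: real
      by (simp add: sum.distrib sum_distrib_right)
    then show ?thesis by (subst sum.swap) simp
  qed
  also have "\<dots> = (\<Sum>l<N. if k = l then u l else 0)"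
    using assms by (intro sum.cong) auto
  finally show ?thesis using assms(3) by simp
qed

lemma trivialise_untrivialise:
  assumes C: "orthogonal_family (2 * n) N C" and x: "dot n x x = 1" and t: "t \<in> topspace (rep N N)"
  shows "trivialise n N C x (untrivialise n N C x t) = t"
proof -
  let ?K = "even_part n C x" and ?L = "odd_part n C x"
  note p = part_orthogonal[OF C x]
  have "(\<Sum>a<N. ?K k a * (\<Sum>l<N. ?K l a * u l + ?L l a * v l) + ?L k a * (\<Sum>l<N. ?L l a * u l + ?K l a * v l)) = u k"
    if "k < N" for k u v
    by (rule block_matrix_inverse[of N "\<lambda>i j. ?K j i" "\<lambda>i j. ?L j i"]) (use p(3,4) that in auto)
  note this[of _ "fst t" "snd t"] this[of _ "snd t" "fst t"]
  then show ?thesis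
    using t by (intro vec_eqI) (auto simp: trivialise_def untrivialise_def topspace_rep add.commute)
qed

lemma untrivialise_trivialise:
  assumes C: "orthogonal_family (2 * n) N C" and x: "dot n x x = 1" and k: "k < N" and y: "y k \<in> topspace (rep 1 1)"
  shows "untrivialise n N C x (trivialise n N C x y) k = y k"
proof -
  let ?K = "even_part n C x" and ?L = "odd_part n C x"
  note p = part_orthogonal[OF C x]
  have "(\<Sum>a<N. ?K a k * (\<Sum>l<N. ?K a l * u l + ?L a l * v l) + ?L a k * (\<Sum>l<N. ?L a l * u l + ?K a l * v l)) = u k"
    for u v
    by (rule block_matrix_inverse) (use p(1,2) k in auto)
  note this[of "\<lambda>l. fst (y l) 0" "\<lambda>l. snd (y l) 0"] this[of "\<lambda>l. snd (y l) 0" "\<lambda>l. fst (y l) 0"]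
  then show ?thesis
    using y by (intro vec_eqI) (auto simp: trivialise_def untrivialise_def topspace_rep add.commute)
qed

text \<open>A sequence of \<open>M\<close> vectors of \<open>2n\<rho>\<close>, written as a vector of \<open>2nM\<rho>\<close>.\<close>

definition pack :: "nat \<Rightarrow> nat \<Rightarrow> (nat \<Rightarrow> vec) \<Rightarrow> vec" where
  "pack n M v =
     (\<lambda>i. if i < 2 * n * M then fst (v (i div (2 * n))) (i mod (2 * n)) else 0,
      \<lambda>i. if i < 2 * n * M then snd (v (i div (2 * n))) (i mod (2 * n)) else 0)"

definition unpack :: "nat \<Rightarrow> vec \<Rightarrow> nat \<Rightarrow> vec" where
  "unpack n t i =
     (\<lambda>j. if j < 2 * n then fst t (2 * n * i + j) else 0,
      \<lambda>j. if j < 2 * n then snd t (2 * n * i + j) else 0)"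

lemma pack_in_rep [simp]: "pack n M v \<in> topspace (rep (2 * n * M) (2 * n * M))"
  and unpack_in_rep [simp]: "unpack n t i \<in> topspace (rep (2 * n) (2 * n))"
  by (auto simp: topspace_rep pack_def unpack_def)

lemma pack_cong: "(\<And>i. i < M \<Longrightarrow> v i = w i) \<Longrightarrow> pack n M v = pack n M w"
  by (auto simp: pack_def fun_eq_iff less_mult_imp_div_less mult.commute)

lemma unpack_pack:
  assumes i: "i < M" and v: "v i \<in> topspace (rep (2 * n) (2 * n))"
  shows "unpack n (pack n M v) i = v i"
proof -
  have "2 * n * i + j < 2 * n * M" if "j < 2 * n" for j
  proof -
    have "2 * n * i + j < 2 * n * Suc i" using that by simp
    also have "\<dots> \<le> 2 * n * M" using i by (intro mult_le_mono2) auto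
    finally show ?thesis .
  qed
  then show ?thesis
    using v by (intro vec_eqI) (auto simp: pack_def unpack_def topspace_rep)
qed

lemma pack_unpack:
  assumes "t \<in> topspace (rep (2 * n * M) (2 * n * M))"
  shows "pack n M (unpack n t) = t"
proof -
  have "i mod (2 * n) < 2 * n" if "i < 2 * n * M" for i using that by (cases n) auto
  then show ?thesis
    using assms by (intro vec_eqI) (auto simp: pack_def unpack_def topspace_rep)
qed

lemma flip_pack: "flip (pack n M v) = pack n M (\<lambda>i. flip (v i))"
  by (auto intro!: vec_eqI simp: pack_def snd_flip)


section \<open>Continuity of the linear algebra\<close>

lemma continuous_map_rep_eq:
  "continuous_map X (rep p q) f \<longleftrightarrow>
     (\<forall>x\<in>topspace X. f x \<in> topspace (rep p q)) \<and>
     (\<forall>i. continuous_map X euclideanreal (\<lambda>x. fst (f x) i) \<and> continuous_map X euclideanreal (\<lambda>x. snd (f x) i))"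
  using continuous_map_rep_coordinates continuous_map_rep[of X p q f] by (auto dest: continuous_map_in)

lemma continuous_map_tensor:
  assumes "continuous_map X (rep p q) f" "continuous_map X (rep p' q') g"
  shows "continuous_map X (rep (2 * n) (2 * n)) (\<lambda>x. tensor n (f x) (g x))"
  using continuous_map_rep_coordinates[OF assms(1)] continuous_map_rep_coordinates[OF assms(2)]
  unfolding continuous_map_rep_eq
  by (auto simp: tensor_altdef simp del: continuous_map_if_iff intro!: continuous_map_if continuous_map_real_mult)
    (auto simp flip: tensor_altdef)

lemma continuous_map_cotensor:
  assumes "continuous_map X (rep p q) f" "continuous_map X (rep p' q') g"
  shows "continuous_map X (rep 1 1) (\<lambda>x. cotensor n (f x) (g x))"
  using continuous_map_rep_coordinates[OF assms(1)] continuous_map_rep_coordinates[OF assms(2)]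
  unfolding continuous_map_rep
  by (auto simp: cotensor_def topspace_rep intro!: continuous_map_sum continuous_map_add continuous_map_real_mult)

lemma continuous_map_add_vec:
  assumes "continuous_map X (rep p q) f" "continuous_map X (rep p q) g"
  shows "continuous_map X (rep p q) (\<lambda>x. add_vec (f x) (g x))"
  using continuous_map_rep_coordinates[OF assms(1)] continuous_map_rep_coordinates[OF assms(2)]
    continuous_map_in[OF assms(1)] continuous_map_in[OF assms(2)]
  unfolding continuous_map_rep_eq
  by (simp add: add_vec_def[of "f _"]) (auto simp flip: add_vec_def intro!: continuous_map_add)

lemma continuous_map_diff_vec:
  assumes "continuous_map X (rep p q) f" "continuous_map X (rep p q) g"
  shows "continuous_map X (rep p q) (\<lambda>x. diff_vec (f x) (g x))"
  using continuous_map_rep_coordinates[OF assms(1)] continuous_map_rep_coordinates[OF assms(2)]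
    continuous_map_in[OF assms(1)] continuous_map_in[OF assms(2)]
  unfolding continuous_map_rep_eq
  by (simp add: diff_vec_def[of "f _"]) (auto simp flip: diff_vec_def intro!: continuous_map_diff)

lemma continuous_map_part:
  assumes "continuous_map X (rep p q) f"
  shows "continuous_map X euclideanreal (\<lambda>x. even_part n C (f x) i l)"
    and "continuous_map X euclideanreal (\<lambda>x. odd_part n C (f x) i l)"
  using continuous_map_rep_coordinates[OF assms] unfolding even_part_def odd_part_def
  by (auto intro!: continuous_map_sum continuous_map_real_mult_right)

lemma continuous_map_trivialise:
  assumes "continuous_map X (rep p q) f" "\<And>l. l < N \<Longrightarrow> continuous_map X (rep p' q') (\<lambda>x. g x l)"
  shows "continuous_map X (rep N N) (\<lambda>x. trivialise n N C (f x) (g x))"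
  using continuous_map_part[OF assms(1)] continuous_map_rep_coordinates[OF assms(2)]
  unfolding continuous_map_rep
  by (auto simp: trivialise_def simp del: continuous_map_if_iff
      intro!: continuous_map_sum continuous_map_add continuous_map_real_mult) (auto simp: topspace_rep)

lemma continuous_map_untrivialise:
  assumes "continuous_map X (rep p q) f" "continuous_map X (rep p' q') g"
  shows "continuous_map X (rep 1 1) (\<lambda>x. untrivialise n N C (f x) (g x) l)"
  using continuous_map_part[OF assms(1)] continuous_map_rep_coordinates[OF assms(2)]
  unfolding continuous_map_rep
  by (auto simp: untrivialise_def topspace_rep
      intro!: continuous_map_sum continuous_map_add continuous_map_real_mult)

lemma continuous_map_pack:
  assumes "\<And>i. i < M \<Longrightarrow> continuous_map X (rep p q) (\<lambda>x. v x i)"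
  shows "continuous_map X (rep (2 * n * M) (2 * n * M)) (\<lambda>x. pack n M (v x))"
proof -
  have "i div (2 * n) < M" if "i < 2 * n * M" for i
    using that by (simp add: less_mult_imp_div_less mult.commute)
  then show ?thesis
    unfolding continuous_map_rep
    using continuous_map_rep_coordinates[OF assms] by (auto simp: pack_def topspace_rep)
qed

lemma continuous_map_unpack:
  assumes "continuous_map X (rep p q) f"
  shows "continuous_map X (rep (2 * n) (2 * n)) (\<lambda>x. unpack n (f x) i)"
  using continuous_map_rep_coordinates[OF assms] unfolding continuous_map_rep
  by (auto simp: unpack_def topspace_rep)


section \<open>Projective spaces\<close>

lemma topspace_unit_sphere: "topspace (unit_sphere n) = {x \<in> topspace (rep n n). dot n x x = 1}"
  by (auto simp: unit_sphere_def)

text \<open>The unit sphere is a closed subset of a product of intervals.\<close>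

lemma compact_space_unit_sphere: "compact_space (unit_sphere n)"
proof -
  let ?S = "topspace (unit_sphere n)"
  have coord: "continuous_on UNIV (\<lambda>x::vec. fst x i)" "continuous_on UNIV (\<lambda>x::vec. snd x i)" for i
    by (rule continuous_on_compose2[OF continuous_on_product_coordinates continuous_on_fst[OF continuous_on_id] subset_UNIV]
        continuous_on_compose2[OF continuous_on_product_coordinates continuous_on_snd[OF continuous_on_id] subset_UNIV])+
  have S: "?S = (\<Inter>i\<in>{n..}. {x. fst x i = 0}) \<inter> (\<Inter>i\<in>{n..}. {x. snd x i = 0}) \<inter> {x. dot n x x = 1}"
    by (auto simp: topspace_unit_sphere topspace_rep)
  have "closed {x::vec. dot n x x = 1}"
    unfolding dot_def by (intro closed_Collect_eq continuous_intros coord)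
  moreover have "closed {x::vec. fst x i = 0}" "closed {x::vec. snd x i = 0}" for i
    by (intro closed_Collect_eq continuous_intros coord)+
  ultimately have closed: "closed ?S"
    unfolding S by (intro closed_Int closed_INT ballI)
  let ?K = "PiE UNIV (\<lambda>_::nat. {-1..1::real})"
  have "compactin (powertop_real UNIV) ?K"
    by (simp add: compactin_PiE)
  then have "compact ?K"
    by (simp add: euclidean_product_topology)
  then have "compact (?K \<times> ?K)" by (intro compact_Times)
  moreover have "?S \<subseteq> ?K \<times> ?K"
  proof
    fix x assume x: "x \<in> ?S"
    have bound: "\<bar>fst x i\<bar> \<le> 1 \<and> \<bar>snd x i\<bar> \<le> 1" for i
    proof (cases "i < n")
      case True
      have "fst x i * fst x i \<le> (\<Sum>i<n. fst x i * fst x i)" "snd x i * snd x i \<le> (\<Sum>i<n. snd x i * snd x i)"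
        "0 \<le> (\<Sum>i<n. fst x i * fst x i)" "0 \<le> (\<Sum>i<n. snd x i * snd x i)"
        using True by (auto intro!: member_le_sum sum_nonneg)
      then have "fst x i * fst x i \<le> 1" "snd x i * snd x i \<le> 1"
        using x by (auto simp: topspace_unit_sphere dot_def)
      then show ?thesis by (simp add: power2_eq_square flip: abs_square_le_1)
    qed (use x in \<open>auto simp: topspace_unit_sphere topspace_rep\<close>)
    have "fst x i \<in> {-1..1} \<and> snd x i \<in> {-1..1}" for i
      using bound[of i] by (auto simp: abs_if split: if_splits)
    then show "x \<in> ?K \<times> ?K" by (auto simp: mem_Times_iff)
  qed
  ultimately have "compact ?S"
    using closed by (metis compact_Int_closed inf.absorb_iff2)
  moreover have "unit_sphere n = top_of_set ?S"
  proof -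
    have "rep n n = top_of_set (topspace (rep n n))"
      by (simp add: rep_def Euclidean_space_def euclidean_product_topology)
    then show ?thesis
      unfolding unit_sphere_def
      by (metis (no_types, lifting) subtopology_subtopology topspace_subtopology)
  qed
  ultimately show ?thesis
    by (metis compact_space_subtopology compactin_euclidean_iff)
qed

lemma dot_neg_neg: "dot n (neg x) (neg y) = dot n x y"
  by (simp add: dot_def fst_neg snd_neg)

lemma neg_in_unit_sphere [simp]: "neg x \<in> topspace (unit_sphere n) \<longleftrightarrow> x \<in> topspace (unit_sphere n)"
  by (simp add: topspace_unit_sphere dot_neg_neg)

lemma flip_in_unit_sphere [simp]: "flip x \<in> topspace (unit_sphere n) \<longleftrightarrow> x \<in> topspace (unit_sphere n)"
  by (simp add: topspace_unit_sphere dot_def snd_flip)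

lemma continuous_map_unit_sphere:
  "continuous_map X (unit_sphere n) f \<longleftrightarrow> continuous_map X (rep n n) f \<and> (\<forall>x\<in>topspace X. f x \<in> topspace (unit_sphere n))"
  unfolding unit_sphere_def by (auto simp: continuous_map_in_subtopology dest: continuous_map_in)

lemma quotient_map_antipodal_class: "quotient_map (unit_sphere n) (projective_space n) antipodal_class"
  by (simp add: projective_space_def quotient_map_quotient_top)

lemma topspace_projective_space: "topspace (projective_space n) = antipodal_class ` topspace (unit_sphere n)"
  by (simp add: projective_space_def topspace_quotient_top)

lemma compact_space_projective_space: "compact_space (projective_space n)"
  using image_compactin[OF _ quotient_imp_continuous_map[OF quotient_map_antipodal_class]]
    compact_space_unit_sphere[of n] unfolding compact_space_def topspace_projective_space by blast

text \<open>Functions on a projective space are written as even functions of a representative.\<close>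

definition representative :: "'a set \<Rightarrow> 'a" where
  "representative b = (SOME x. x \<in> b)"

lemma representative_in: "b \<noteq> {} \<Longrightarrow> representative b \<in> b"
  by (simp add: representative_def some_in_eq)

lemma representative_antipodal_class:
  "representative (antipodal_class x) = x \<or> representative (antipodal_class x) = neg x"
  using representative_in[of "antipodal_class x"] by (auto simp: antipodal_class_def)

lemma even_representative:
  assumes "f (neg x) = f x"
  shows "f (representative (antipodal_class x)) = f x"
  using representative_antipodal_class[of x] assms by auto

lemma antipodal_class_neg [simp]: "antipodal_class (neg x) = antipodal_class x"
  by (auto simp: antipodal_class_def)

lemma representative_projective_space:
  assumes "b \<in> topspace (projective_space n)"
  shows "representative b \<in> topspace (unit_sphere n)" "antipodal_class (representative b) = b"
    "dot n (representative b) (representative b) = 1"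
proof -
  obtain x where x: "x \<in> topspace (unit_sphere n)" "b = antipodal_class x"
    using assms by (auto simp: topspace_projective_space)
  show *: "representative b \<in> topspace (unit_sphere n)"
    using representative_antipodal_class[of x] x by auto
  show "antipodal_class (representative b) = b"
    using representative_antipodal_class[of x] x by auto
  show "dot n (representative b) (representative b) = 1"
    using * by (simp add: topspace_unit_sphere)
qed

text \<open>Crossing with a locally compact Hausdorff space preserves quotient maps, so that even functions
  descend also in the presence of a parameter \<open>z\<close>.\<close>

lemma continuous_map_descend:
  assumes Z: "locally_compact_space Z" "Hausdorff_space Z"
    and f: "continuous_map (prod_topology (unit_sphere n) Z) W (\<lambda>(x, z). f x z)"
    and even: "\<And>x z. x \<in> topspace (unit_sphere n) \<Longrightarrow> z \<in> topspace Z \<Longrightarrow> f (neg x) z = f x z"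
  shows "continuous_map (prod_topology (projective_space n) Z) W (\<lambda>(b, z). f (representative b) z)"
proof -
  have q: "quotient_map (prod_topology (unit_sphere n) Z) (prod_topology (projective_space n) Z)
      (\<lambda>(x, z). (antipodal_class x, z))"
    using Z by (intro quotient_map_prod_left quotient_map_antipodal_class) auto
  have "continuous_map (prod_topology (unit_sphere n) Z) W
      ((\<lambda>(b, z). f (representative b) z) \<circ> (\<lambda>(x, z). (antipodal_class x, z)))"
  proof (rule continuous_map_eq[OF f])
    fix p assume "p \<in> topspace (prod_topology (unit_sphere n) Z)"
    then show "(\<lambda>(x, z). f x z) p = ((\<lambda>(b, z). f (representative b) z) \<circ> (\<lambda>(x, z). (antipodal_class x, z))) p"
      using even even_representative[of "\<lambda>x. f x (snd p)" "fst p"] by (cases p) auto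
  qed
  then show ?thesis using continuous_compose_quotient_map_eq[OF q] by blast
qed

lemma continuous_map_descend':
  assumes f: "continuous_map (unit_sphere n) W f"
    and even: "\<And>x. x \<in> topspace (unit_sphere n) \<Longrightarrow> f (neg x) = f x"
  shows "continuous_map (projective_space n) W (\<lambda>b. f (representative b))"
proof -
  have "continuous_map (unit_sphere n) W ((\<lambda>b. f (representative b)) \<circ> antipodal_class)"
    by (rule continuous_map_eq[OF f]) (simp add: even even_representative)
  then show ?thesis using continuous_compose_quotient_map_eq[OF quotient_map_antipodal_class] by blast
qed

lemma unit_vectors_eq:
  assumes "x \<in> topspace (unit_sphere n)" "y \<in> topspace (unit_sphere n)" "dot n x y = 1"
  shows "x = y"
proof -
  have "(\<Sum>i<n. (fst x i - fst y i) * (fst x i - fst y i)) + (\<Sum>i<n. (snd x i - snd y i) * (snd x i - snd y i)) =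
      dot n x x - 2 * dot n x y + dot n y y"
    by (simp add: dot_def algebra_simps sum.distrib sum_subtractf sum_distrib_left)
  also have "\<dots> = 0" using assms by (simp add: topspace_unit_sphere)
  finally have "(\<Sum>i<n. (fst x i - fst y i) * (fst x i - fst y i)) = 0 \<and>
      (\<Sum>i<n. (snd x i - snd y i) * (snd x i - snd y i)) = 0"
    by (subst (asm) add_nonneg_eq_0_iff) (auto intro!: sum_nonneg)
  then have eq: "fst x i = fst y i" "snd x i = snd y i" if "i < n" for i
    using that by (auto simp: sum_nonneg_eq_0_iff)
  have zero: "fst z i = 0" "snd z i = 0" if "\<not> i < n" "z \<in> topspace (unit_sphere n)" for z i
    using that by (auto simp: topspace_unit_sphere topspace_rep)
  show ?thesis
  proof (rule vec_eqI)
    fix i show "fst x i = fst y i" "snd x i = snd y i"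
      using eq[of i] zero[OF _ assms(1)] zero[OF _ assms(2)] by (cases "i < n"; simp)+
  qed
qed

text \<open>The points \<open>[x] \<noteq> [y]\<close> are separated by the function \<open>[z] \<mapsto> \<langle>z, y\<rangle>\<^sup>2\<close>, which equals \<open>1\<close> only at \<open>[y]\<close>.\<close>

lemma Hausdorff_space_projective_space: "Hausdorff_space (projective_space n)"
  unfolding Hausdorff_space_def
proof (intro allI impI, elim conjE)
  fix b b' assume b: "b \<in> topspace (projective_space n)" "b' \<in> topspace (projective_space n)" "b \<noteq> b'"
  let ?y = "representative b'"
  let ?f = "\<lambda>b. (dot n (representative b) ?y) ^ 2"
  note co = continuous_map_rep_coordinates[of "unit_sphere n" n n "\<lambda>x. x"]
  have id: "continuous_map (unit_sphere n) (rep n n) (\<lambda>x. x)"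
    unfolding unit_sphere_def by (simp add: continuous_map_from_subtopology)
  have f: "continuous_map (projective_space n) euclideanreal ?f"
  proof (rule continuous_map_descend')
    show "continuous_map (unit_sphere n) euclideanreal (\<lambda>x. (dot n x ?y) ^ 2)"
      unfolding dot_def by (intro continuous_intros continuous_map_sum co[OF id]) auto
  qed (simp add: dot_def fst_neg snd_neg sum_negf power2_eq_square algebra_simps)
  have y: "?y \<in> topspace (unit_sphere n)" "representative b \<in> topspace (unit_sphere n)"
    using representative_projective_space b by auto
  have "?f b' = 1" using representative_projective_space(3)[OF b(2)] by simp
  moreover have "?f b \<noteq> 1"
  proof
    assume "?f b = 1"
    then have "dot n (representative b) ?y = 1 \<or> dot n (representative b) (neg ?y) = 1"
      by (auto simp: power2_eq_1_iff dot_def fst_neg snd_neg sum_negf)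
    then have "representative b = ?y \<or> representative b = neg ?y"
      using unit_vectors_eq[OF y(2)] y(1) by (metis neg_in_unit_sphere)
    then show False using b representative_projective_space(2)
      by (metis antipodal_class_neg)
  qed
  ultimately obtain U V where U: "open U" "open V" "?f b \<in> U" "?f b' \<in> V" "U \<inter> V = {}"
    using hausdorff[of "?f b" "?f b'"] by auto
  show "\<exists>U V. openin (projective_space n) U \<and> openin (projective_space n) V \<and> b \<in> U \<and> b' \<in> V \<and> disjnt U V"
  proof (intro exI conjI)
    show "openin (projective_space n) {x \<in> topspace (projective_space n). ?f x \<in> U}"
      "openin (projective_space n) {x \<in> topspace (projective_space n). ?f x \<in> V}"
      using U by (auto intro!: openin_continuous_map_preimage[OF f])
  qed (use U b in \<open>auto simp: disjnt_def\<close>)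
qed

lemma flip_antipodal_class: "flip ` antipodal_class x = antipodal_class (flip x)"
  by (simp add: antipodal_class_def flip_neg)

lemma continuous_map_flip_projective_space:
  "continuous_map (projective_space n) (projective_space n) (image flip)"
proof -
  have id: "continuous_map (unit_sphere n) (rep n n) (\<lambda>x. x)"
    unfolding unit_sphere_def by (simp add: continuous_map_from_subtopology)
  have "continuous_map (unit_sphere n) (unit_sphere n) flip"
    using continuous_map_flip[OF id] by (simp add: continuous_map_unit_sphere)
  then have "continuous_map (unit_sphere n) (projective_space n) (antipodal_class \<circ> flip)"
    using quotient_imp_continuous_map[OF quotient_map_antipodal_class] by (rule continuous_map_compose)
  moreover have "antipodal_class \<circ> flip = image flip \<circ> antipodal_class"
    by (auto simp: flip_antipodal_class)
  ultimately show ?thesis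
    using continuous_compose_quotient_map_eq[OF quotient_map_antipodal_class] by metis
qed

lemma flip_in_projective_space [simp]:
  "b \<in> topspace (projective_space n) \<Longrightarrow> flip ` b \<in> topspace (projective_space n)"
  using continuous_map_in[OF continuous_map_flip_projective_space] .

lemma flip_flip_image [simp]: "flip ` flip ` b = b"
  by (simp add: image_image)

lemma even_representative_flip:
  assumes "b \<in> topspace (projective_space n)" and "\<And>x. f (neg x) = f x"
  shows "f (representative (flip ` b)) = f (flip (representative b))"
proof -
  have "flip ` b = antipodal_class (flip (representative b))"
    using representative_projective_space(2)[OF assms(1)] flip_antipodal_class by metis
  then show ?thesis using even_representative[of f] assms(2) by metis
qed


section \<open>Subbundles of a trivial bundle\<close>

text \<open>The orthogonal projection of \<open>V\<close> onto the fibre \<open>x \<otimes> \<rho>\<close> of the tautological bundle.\<close>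

definition line_proj :: "nat \<Rightarrow> vec \<Rightarrow> vec \<Rightarrow> vec" where
  "line_proj n x w = tensor n x (cotensor n x w)"

lemma line_proj_neg [simp]: "line_proj n (neg x) w = line_proj n x w"
  by (simp add: line_proj_def cotensor_neg tensor_neg_neg)

lemma line_proj_in_rep [simp]: "line_proj n x w \<in> topspace (rep (2 * n) (2 * n))"
  by (simp add: line_proj_def)

lemma cotensor_line_proj: "dot n x x = 1 \<Longrightarrow> cotensor n x (line_proj n x w) = cotensor n x w"
  unfolding line_proj_def by (rule cotensor_tensor[OF _ vec_in_rep(6)])

definition fibre_proj :: "nat \<Rightarrow> bool \<Rightarrow> vec set \<Rightarrow> vec \<Rightarrow> vec" where
  "fibre_proj n c b w =
     (if c then line_proj n (representative b) w else diff_vec w (line_proj n (representative b) w))"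

text \<open>The tautological bundle (\<open>c = True\<close>) and its complement (\<open>c = False\<close>) are both treated as
  retracts of the trivial bundle with fibre \<open>V = 2n\<rho>\<close>: \<open>enc\<close> embeds the total space fibrewise into
  \<open>V\<close>, and \<open>dec\<close> is the fibrewise orthogonal projection. This makes all total spaces, and all maps
  between them, accessible through formulas in the coordinates of \<open>V\<close>.\<close>

locale retract_bundle =
  fixes n :: nat and c :: bool and E :: "(vec set, 'e) c2_bundle"
    and enc :: "'e \<Rightarrow> vec" and dec :: "vec set \<times> vec \<Rightarrow> 'e"
  assumes base_pts: "base_pts E = projective_space n"
    and base_act: "base_act E = image flip"
    and continuous_enc: "continuous_map (total_pts E) (rep (2 * n) (2 * n)) enc"
    and continuous_proj: "continuous_map (total_pts E) (projective_space n) (proj E)"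
    and continuous_dec: "continuous_map (prod_topology (projective_space n) (rep (2 * n) (2 * n))) (total_pts E) dec"
    and dec_enc: "e \<in> topspace (total_pts E) \<Longrightarrow> dec (proj E e, enc e) = e"
    and proj_dec: "b \<in> topspace (projective_space n) \<Longrightarrow> w \<in> topspace (rep (2 * n) (2 * n)) \<Longrightarrow>
      proj E (dec (b, w)) = b"
    and enc_dec: "b \<in> topspace (projective_space n) \<Longrightarrow> w \<in> topspace (rep (2 * n) (2 * n)) \<Longrightarrow>
      enc (dec (b, w)) = fibre_proj n c b w"
    and act_in_total: "e \<in> topspace (total_pts E) \<Longrightarrow> total_act E e \<in> topspace (total_pts E)"
    and proj_act: "e \<in> topspace (total_pts E) \<Longrightarrow> proj E (total_act E e) = flip ` proj E e"
    and enc_act: "e \<in> topspace (total_pts E) \<Longrightarrow> enc (total_act E e) = flip (enc e)"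
begin

lemma enc_in: "e \<in> topspace (total_pts E) \<Longrightarrow> enc e \<in> topspace (rep (2 * n) (2 * n))"
  using continuous_map_in[OF continuous_enc] .

lemma proj_in: "e \<in> topspace (total_pts E) \<Longrightarrow> proj E e \<in> topspace (projective_space n)"
  using continuous_map_in[OF continuous_proj] .

lemma dec_in: "b \<in> topspace (projective_space n) \<Longrightarrow> w \<in> topspace (rep (2 * n) (2 * n)) \<Longrightarrow>
    dec (b, w) \<in> topspace (total_pts E)"
  using continuous_map_in[OF continuous_dec] by simp

lemma fibre_proj_enc: "e \<in> topspace (total_pts E) \<Longrightarrow> fibre_proj n c (proj E e) (enc e) = enc e"
  by (metis dec_enc enc_dec enc_in proj_in)

lemma dec_eqI:
  assumes "e \<in> topspace (total_pts E)" "w \<in> topspace (rep (2 * n) (2 * n))"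
    "fibre_proj n c (proj E e) w = enc e"
  shows "dec (proj E e, w) = e"
proof -
  have "dec (proj E e, w) = dec (proj E (dec (proj E e, w)), enc (dec (proj E e, w)))"
    using dec_enc dec_in proj_in assms by simp
  also have "\<dots> = e" using assms proj_in proj_dec enc_dec dec_enc by simp
  finally show ?thesis .
qed

lemma act_dec:
  assumes "b \<in> topspace (projective_space n)" "w \<in> topspace (rep (2 * n) (2 * n))" "fibre_proj n c b w = w"
  shows "total_act E (dec (b, w)) = dec (flip ` b, flip w)"
proof -
  note d = dec_in[OF assms(1,2)]
  have "total_act E (dec (b, w)) = dec (proj E (total_act E (dec (b, w))), enc (total_act E (dec (b, w))))"
    using dec_enc[OF act_in_total[OF d]] by simp
  then show ?thesis
    using proj_act[OF d] enc_act[OF d] proj_dec enc_dec assms by simp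
qed

lemma act_act: "e \<in> topspace (total_pts E) \<Longrightarrow> total_act E (total_act E e) = e"
  using dec_enc[OF act_in_total[OF act_in_total]] by (simp add: proj_act enc_act act_in_total dec_enc)

lemma continuous_act: "continuous_map (total_pts E) (total_pts E) (total_act E)"
proof (rule continuous_map_eq)
  have "continuous_map (total_pts E) (prod_topology (projective_space n) (rep (2 * n) (2 * n)))
      (\<lambda>e. (flip ` proj E e, flip (enc e)))"
    using continuous_map_compose[OF continuous_proj continuous_map_flip_projective_space]
      continuous_map_flip[OF continuous_enc]
    by (intro continuous_map_pairedI) (auto simp: o_def)
  from continuous_map_compose[OF this continuous_dec]
  show "continuous_map (total_pts E) (total_pts E) (\<lambda>e. dec (flip ` proj E e, flip (enc e)))"
    by (simp add: o_def)
  show "dec (flip ` proj E e, flip (enc e)) = total_act E e" if "e \<in> topspace (total_pts E)" for e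
    using dec_enc[OF act_in_total[OF that]] by (simp add: proj_act enc_act that)
qed

lemma topspace_whitney_power:
  "topspace (total_pts (whitney_power k E)) =
     {(b, e). b \<in> topspace (projective_space n) \<and> e \<in> (\<Pi>\<^sub>E i\<in>{..<k}. topspace (total_pts E)) \<and> (\<forall>i<k. proj E (e i) = b)}"
  by (auto simp: whitney_power_def base_pts)

lemma continuous_map_whitney_powerI:
  assumes "continuous_map X (projective_space n) \<beta>" "\<And>i. i < k \<Longrightarrow> continuous_map X (total_pts E) (\<lambda>x. \<epsilon> x i)"
    "\<And>x i. x \<in> topspace X \<Longrightarrow> i < k \<Longrightarrow> proj E (\<epsilon> x i) = \<beta> x"
  shows "continuous_map X (total_pts (whitney_power k E)) (\<lambda>x. (\<beta> x, \<lambda>i\<in>{..<k}. \<epsilon> x i))"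
  unfolding whitney_power_def c2_bundle.simps continuous_map_in_subtopology
proof
  show "continuous_map X (prod_topology (base_pts E) (product_topology (\<lambda>_. total_pts E) {..<k})) (\<lambda>x. (\<beta> x, \<lambda>i\<in>{..<k}. \<epsilon> x i))"
    using assms by (intro continuous_map_pairedI) (auto simp: base_pts continuous_map_componentwise)
qed (use assms in auto)

lemma continuous_map_from_whitney_power:
  "continuous_map (total_pts (whitney_power k E)) (projective_space n) fst"
  "i < k \<Longrightarrow> continuous_map (total_pts (whitney_power k E)) (total_pts E) (\<lambda>z. snd z i)"
proof -
  let ?T = "prod_topology (projective_space n) (product_topology (\<lambda>_. total_pts E) {..<k})"
  have "continuous_map ?T (projective_space n) fst" by (rule continuous_map_fst)
  then show "continuous_map (total_pts (whitney_power k E)) (projective_space n) fst"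
    by (simp add: whitney_power_def base_pts continuous_map_from_subtopology)
  assume "i < k"
  then have "continuous_map ?T (total_pts E) (\<lambda>z. snd z i)"
    using continuous_map_compose[OF continuous_map_snd continuous_map_product_projection[of i "{..<k}" "\<lambda>_. total_pts E"]]
    by (simp add: o_def)
  then show "continuous_map (total_pts (whitney_power k E)) (total_pts E) (\<lambda>z. snd z i)"
    by (simp add: whitney_power_def base_pts continuous_map_from_subtopology)
qed

text \<open>The Whitney powers are retracts of \<open>\<P>(n\<rho>) \<times> V\<^sup>k\<close>, and so inherit its separation and compactness
  properties.\<close>

lemma retraction_whitney_power:
  "retraction_map (prod_topology (projective_space n) (product_topology (\<lambda>_. rep (2 * n) (2 * n)) {..<k}))
     (total_pts (whitney_power k E)) (\<lambda>(b, w). (b, \<lambda>i\<in>{..<k}. dec (b, w i)))"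
proof -
  let ?V = "product_topology (\<lambda>_. rep (2 * n) (2 * n)) {..<k}"
  let ?X = "prod_topology (projective_space n) ?V"
  let ?r = "\<lambda>(b, w). (b, \<lambda>i\<in>{..<k}. dec (b, w i))"
  let ?s = "\<lambda>(b, e). (b, \<lambda>i\<in>{..<k}. enc (e i))"
  have fst: "continuous_map ?X (projective_space n) fst" by (rule continuous_map_fst)
  have snd: "continuous_map ?X (rep (2 * n) (2 * n)) (\<lambda>z. snd z i)" if "i < k" for i
    using continuous_map_compose[OF continuous_map_snd continuous_map_product_projection[of i "{..<k}" "\<lambda>_. rep (2 * n) (2 * n)"]] that
    by (simp add: o_def)
  have "continuous_map ?X (total_pts E) (\<lambda>z. dec (fst z, snd z i))" if "i < k" for i
    using continuous_map_compose[OF continuous_map_pairedI[OF fst snd[OF that]] continuous_dec] by (simp add: o_def)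
  then have r: "continuous_map ?X (total_pts (whitney_power k E)) ?r"
    unfolding case_prod_unfold using fst
    by (intro continuous_map_whitney_powerI) (auto intro!: proj_dec)
  have s: "continuous_map (total_pts (whitney_power k E)) ?X ?s"
    using continuous_map_from_whitney_power[of k] continuous_map_compose[OF continuous_map_from_whitney_power(2) continuous_enc, of _ k]
    unfolding case_prod_unfold
    by (intro continuous_map_pairedI) (auto simp: continuous_map_componentwise o_def)
  have "?r (?s z) = z" if "z \<in> topspace (total_pts (whitney_power k E))" for z
  proof -
    obtain b e where z: "z = (b, e)" by (cases z)
    have "dec (b, enc (e i)) = e i" if "i < k" for i
      using dec_enc[of "e i"] \<open>z \<in> _\<close> that z by (auto simp: topspace_whitney_power)
    moreover have "e \<in> extensional {..<k}"
      using \<open>z \<in> _\<close> z by (auto simp: topspace_whitney_power PiE_def)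
    ultimately show ?thesis using z by (auto simp: fun_eq_iff extensional_def)
  qed
  then have "retraction_maps ?X (total_pts (whitney_power k E)) ?r ?s"
    using r s by (simp add: retraction_maps_def)
  then show ?thesis unfolding retraction_map_def by blast
qed

lemma locally_compact_space_whitney_power: "locally_compact_space (total_pts (whitney_power k E))"
  by (rule locally_compact_space_retraction_map_image[OF retraction_whitney_power])
    (auto simp: locally_compact_space_prod_topology locally_compact_space_product_topology
      locally_compact_space_rep compact_imp_locally_compact_space compact_space_projective_space)

lemma Hausdorff_space_whitney_power: "Hausdorff_space (total_pts (whitney_power k E))"
proof -
  have "Hausdorff_space (prod_topology (projective_space n) (product_topology (\<lambda>_. rep (2 * n) (2 * n)) {..<k}))"
    by (simp add: Hausdorff_space_prod_topology Hausdorff_space_product_topology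
        Hausdorff_space_rep Hausdorff_space_projective_space)
  moreover obtain s where "retraction_maps (prod_topology (projective_space n) (product_topology (\<lambda>_. rep (2 * n) (2 * n)) {..<k}))
     (total_pts (whitney_power k E)) (\<lambda>(b, w). (b, \<lambda>i\<in>{..<k}. dec (b, w i))) s"
    using retraction_whitney_power unfolding retraction_map_def by blast
  ultimately show ?thesis
    using Hausdorff_space_subtopology homeomorphic_Hausdorff_space retraction_maps_section_image2 by blast
qed

lemma compactifies_thom_space_whitney_power:
  "compactifies (total_pts (whitney_power k E)) (total_act (whitney_power k E)) (thom_space (whitney_power k E))"
proof (rule compactifies_thom_space[OF Hausdorff_space_whitney_power locally_compact_space_whitney_power])
  let ?W = "whitney_power k E"
  have act: "total_act ?W = (\<lambda>z. (flip ` fst z, \<lambda>i\<in>{..<k}. total_act E (snd z i)))"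
    by (simp add: whitney_power_def base_act case_prod_unfold)
  have inv: "total_act ?W (total_act ?W z) = z" if "z \<in> topspace (total_pts ?W)" for z
  proof -
    have "total_act E (total_act E (snd z i)) = snd z i" if "i < k" for i
      using act_act[of "snd z i"] \<open>z \<in> _\<close> that by (auto simp: topspace_whitney_power case_prod_unfold)
    moreover have "snd z \<in> extensional {..<k}"
      using \<open>z \<in> _\<close> by (auto simp: topspace_whitney_power PiE_def case_prod_unfold)
    ultimately have "(\<lambda>i\<in>{..<k}. total_act E ((\<lambda>i\<in>{..<k}. total_act E (snd z i)) i)) = snd z"
      by (auto simp: fun_eq_iff extensional_def)
    then show ?thesis unfolding act by simp
  qed
  moreover have "continuous_map (total_pts ?W) (total_pts ?W) (total_act ?W)"
    unfolding act
  proof (rule continuous_map_whitney_powerI)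
    show "continuous_map (total_pts ?W) (projective_space n) (\<lambda>z. flip ` fst z)"
      using continuous_map_compose[OF continuous_map_from_whitney_power(1) continuous_map_flip_projective_space] by (simp add: o_def)
    show "continuous_map (total_pts ?W) (total_pts E) (\<lambda>z. total_act E (snd z i))" if "i < k" for i
      using continuous_map_compose[OF continuous_map_from_whitney_power(2)[OF that] continuous_act] by (simp add: o_def)
    show "proj E (total_act E (snd z i)) = flip ` fst z" if "z \<in> topspace (total_pts ?W)" "i < k" for z i
      using that proj_act[of "snd z i"] by (auto simp: topspace_whitney_power case_prod_unfold)
  qed
  ultimately show "homeomorphic_map (total_pts ?W) (total_pts ?W) (total_act ?W)"
    unfolding homeomorphic_map_maps homeomorphic_maps_def by blast
  show "total_act ?W (total_act ?W z) = z" if "z \<in> topspace (total_pts ?W)" for z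
    by (rule inv[OF that])
qed

end


section \<open>The tautological bundle and its complement\<close>

lemma continuous_map_unit_sphere_rep: "continuous_map X (unit_sphere n) f \<Longrightarrow> continuous_map X (rep n n) f"
  by (simp add: continuous_map_unit_sphere)

text \<open>Both total spaces consist of antipodal pairs \<open>{(x, y), (-x, \<iota> y)}\<close> with \<open>x\<close> in the unit sphere, where
  \<open>\<iota>\<close> is an involution: \<open>\<iota> y = -y\<close> for \<open>y \<in> \<rho>\<close> in the tautological bundle, and \<open>\<iota> = id\<close> on
  \<open>(x \<otimes> \<rho>)\<^sup>\<bottom>\<close> in its complement. The lemma descends an embedding \<open>em x\<close> of the fibre over \<open>[x]\<close> into
  \<open>V\<close> and a left inverse \<open>re x\<close> of it from the unit sphere to the projective space.\<close>

lemma retract_bundleI: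
  fixes E :: "(vec set, (vec \<times> vec) set) c2_bundle" and em re :: "vec \<Rightarrow> vec \<Rightarrow> vec"
  defines "cl \<equiv> \<lambda>\<iota> (x, y). {(x, y), (neg x, \<iota> y)}"
  assumes base: "base_pts E = projective_space n" "base_act E = image flip"
    and total: "total_pts E = quotient_top X (cl \<iota>)"
    and pr_act: "proj E = image fst" "total_act E = image (map_prod flip flip)"
    and fst: "continuous_map X (unit_sphere n) fst"
    and em: "continuous_map X (rep (2 * n) (2 * n)) (\<lambda>(x, y). em x y)"
    and em_\<iota>: "\<And>x y. em (neg x) (\<iota> y) = em x y"
    and em_flip: "\<And>x y. em (flip x) (flip y) = flip (em x y)"
    and re: "continuous_map (prod_topology (unit_sphere n) (rep (2 * n) (2 * n))) X (\<lambda>(x, w). (x, re x w))"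
    and re_\<iota>: "\<And>x w. re (neg x) w = \<iota> (re x w)"
    and \<iota>_\<iota>: "\<And>y. \<iota> (\<iota> y) = y" and \<iota>_flip: "\<And>y. flip (\<iota> y) = \<iota> (flip y)"
    and flip: "\<And>x y. (x, y) \<in> topspace X \<Longrightarrow> (flip x, flip y) \<in> topspace X"
    and re_em: "\<And>x y. (x, y) \<in> topspace X \<Longrightarrow> re x (em x y) = y"
    and em_re: "\<And>b w. b \<in> topspace (projective_space n) \<Longrightarrow>
      em (representative b) (re (representative b) w) = fibre_proj n c b w"
  shows "retract_bundle n c E (\<lambda>e. case_prod em (representative e))
    (\<lambda>(b, w). cl \<iota> (representative b, re (representative b) w))"
proof -
  let ?V = "rep (2 * n) (2 * n)"
  have q: "quotient_map X (total_pts E) (cl \<iota>)"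
    unfolding total by (rule quotient_map_quotient_top)
  have cl: "cl \<iota> (x, y) = {(x, y), (neg x, \<iota> y)}" for x y by (simp add: cl_def)
  have even: "cl \<iota> (neg x, re (neg x) w) = cl \<iota> (x, re x w)" for x w
    by (auto simp: cl re_\<iota> \<iota>_\<iota>)
  have enc: "case_prod em (representative (cl \<iota> (x, y))) = em x y" for x y
  proof -
    have "representative (cl \<iota> (x, y)) \<in> cl \<iota> (x, y)" by (rule representative_in) (simp add: cl)
    then show ?thesis by (auto simp: cl em_\<iota>)
  qed
  have proj: "proj E (cl \<iota> (x, y)) = antipodal_class x" for x y
    by (simp add: pr_act cl antipodal_class_def)
  have act: "total_act E (cl \<iota> (x, y)) = cl \<iota> (flip x, flip y)" for x y
    by (simp add: pr_act cl flip_neg \<iota>_flip)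
  show ?thesis
  proof
    show "base_pts E = projective_space n" "base_act E = image flip" by (fact base)+
    have "continuous_map X ?V ((\<lambda>e. case_prod em (representative e)) \<circ> cl \<iota>)"
      by (rule continuous_map_eq[OF em]) (auto simp: enc)
    then show "continuous_map (total_pts E) ?V (\<lambda>e. case_prod em (representative e))"
      using continuous_compose_quotient_map_eq[OF q] by blast
    have "continuous_map X (projective_space n) (proj E \<circ> cl \<iota>)"
      by (rule continuous_map_eq[OF continuous_map_compose[OF fst
              quotient_imp_continuous_map[OF quotient_map_antipodal_class]]]) (auto simp: proj)
    then show "continuous_map (total_pts E) (projective_space n) (proj E)"
      using continuous_compose_quotient_map_eq[OF q] by blast
    show "continuous_map (prod_topology (projective_space n) ?V) (total_pts E)
        (\<lambda>(b, w). cl \<iota> (representative b, re (representative b) w))"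
    proof (rule continuous_map_descend[OF locally_compact_space_rep Hausdorff_space_rep])
      show "continuous_map (prod_topology (unit_sphere n) ?V) (total_pts E) (\<lambda>(x, w). cl \<iota> (x, re x w))"
        using continuous_map_compose[OF re quotient_imp_continuous_map[OF q]]
        by (simp add: o_def case_prod_unfold)
    qed (rule even)
  next
    fix e assume "e \<in> topspace (total_pts E)"
    then obtain x y where e: "(x, y) \<in> topspace X" "e = cl \<iota> (x, y)"
      unfolding total topspace_quotient_top by auto
    have "cl \<iota> (representative (antipodal_class x), re (representative (antipodal_class x)) w) = cl \<iota> (x, re x w)" for w
      by (rule even_representative[of "\<lambda>x. cl \<iota> (x, re x w)", OF even])
    then show "(case (proj E e, case_prod em (representative e)) of
        (b, w) \<Rightarrow> cl \<iota> (representative b, re (representative b) w)) = e"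
      using e by (simp add: proj enc re_em)
    show "total_act E e \<in> topspace (total_pts E)"
      using e flip unfolding total topspace_quotient_top by (auto simp: act)
    show "proj E (total_act E e) = flip ` proj E e"
      using e by (simp add: act proj flip_antipodal_class)
    show "case_prod em (representative (total_act E e)) = flip (case_prod em (representative e))"
      using e by (simp add: act enc em_flip)
  next
    fix b w assume b: "b \<in> topspace (projective_space n)" "w \<in> topspace ?V"
    show "proj E (case (b, w) of (b, w) \<Rightarrow> cl \<iota> (representative b, re (representative b) w)) = b"
      using representative_projective_space(2)[OF b(1)] by (simp add: proj)
    show "case_prod em (representative (case (b, w) of (b, w) \<Rightarrow> cl \<iota> (representative b, re (representative b) w))) =
        fibre_proj n c b w"
      using em_re[OF b(1)] by (simp add: enc)
  qed
qed

lemma retract_bundle_tautological: "\<exists>enc dec. retract_bundle n True (tautological_bundle n) enc dec"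
proof (intro exI, rule retract_bundleI)
  let ?X = "prod_topology (unit_sphere n) (rep 1 1)" and ?Y = "prod_topology (unit_sphere n) (rep (2 * n) (2 * n))"
  show "base_pts (tautological_bundle n) = projective_space n" "base_act (tautological_bundle n) = image flip"
    "total_pts (tautological_bundle n) = quotient_top ?X (\<lambda>(x, y). {(x, y), (neg x, neg y)})"
    "proj (tautological_bundle n) = image fst" "total_act (tautological_bundle n) = image (map_prod flip flip)"
    by (simp_all add: tautological_bundle_def)
  show fst: "continuous_map ?X (unit_sphere n) fst" by (rule continuous_map_fst)
  show "continuous_map ?X (rep (2 * n) (2 * n)) (\<lambda>(x, y). tensor n x y)"
    unfolding case_prod_unfold
    by (rule continuous_map_tensor[OF continuous_map_unit_sphere_rep[OF fst] continuous_map_snd])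
  have fst': "continuous_map ?Y (unit_sphere n) fst" by (rule continuous_map_fst)
  show "continuous_map ?Y ?X (\<lambda>(x, w). (x, cotensor n x w))"
    unfolding case_prod_unfold
    by (intro continuous_map_pairedI fst'
        continuous_map_cotensor[OF continuous_map_unit_sphere_rep[OF fst'] continuous_map_snd])
  show "cotensor n x (tensor n x y) = y" if "(x, y) \<in> topspace ?X" for x y
    using that cotensor_tensor[of n x y] by (simp add: topspace_unit_sphere)
qed (simp_all add: tensor_neg_neg flip_tensor cotensor_neg flip_neg fibre_proj_def line_proj_def)

lemma retract_bundle_complement: "\<exists>enc dec. retract_bundle n False (complement_bundle n) enc dec"
proof (intro exI, rule retract_bundleI)
  let ?V = "rep (2 * n) (2 * n)"
  let ?Y = "prod_topology (unit_sphere n) ?V"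
  let ?X = "subtopology ?Y {(x, w). cotensor n x w = zero_vec}"
  show "base_pts (complement_bundle n) = projective_space n" "base_act (complement_bundle n) = image flip"
    "total_pts (complement_bundle n) = quotient_top ?X (\<lambda>(x, w). {(x, w), (neg x, id w)})"
    "proj (complement_bundle n) = image fst" "total_act (complement_bundle n) = image (map_prod flip flip)"
    unfolding complement_bundle_def orthogonal_iff_cotensor by simp_all
  show "continuous_map ?X (unit_sphere n) fst"
    by (intro continuous_map_from_subtopology continuous_map_fst)
  show "continuous_map ?X ?V (\<lambda>(x, w). w)"
    unfolding case_prod_unfold by (intro continuous_map_from_subtopology continuous_map_snd)
  have fst: "continuous_map ?Y (unit_sphere n) fst" by (rule continuous_map_fst)
  have "continuous_map ?Y ?V (\<lambda>z. diff_vec (snd z) (line_proj n (fst z) (snd z)))"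
    unfolding line_proj_def
    by (intro continuous_map_diff_vec continuous_map_snd
        continuous_map_tensor[OF continuous_map_unit_sphere_rep[OF fst]
          continuous_map_cotensor[OF continuous_map_unit_sphere_rep[OF fst] continuous_map_snd]])
  then show "continuous_map ?Y ?X (\<lambda>(x, w). (x, diff_vec w (line_proj n x w)))"
    unfolding case_prod_unfold continuous_map_in_subtopology
    by (auto intro!: continuous_map_pairedI fst simp: cotensor_diff cotensor_line_proj topspace_unit_sphere)
  show "diff_vec w (line_proj n x w) = w" if "(x, w) \<in> topspace ?X" for x w
    using that by (simp add: line_proj_def)
  show "(flip x, flip w) \<in> topspace ?X" if "(x, w) \<in> topspace ?X" for x w
    using that by (simp flip: flip_cotensor)
qed (simp_all add: fibre_proj_def)


section \<open>The trivialisation of the Whitney power\<close>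

text \<open>The isomorphism from the trivial bundle with fibre \<open>N\<rho>\<close> to \<open>N\<xi>\<close>, with \<open>N\<xi>\<close> embedded in \<open>V\<^sup>N\<close> by
  \<open>[x, y] \<mapsto> x \<otimes> y\<close>, and its inverse, extended to \<open>V\<^sup>N\<close> by the orthogonal projection. Both are even in
  the representative \<open>x\<close>, since the trivialisation is odd in \<open>x\<close>.\<close>

definition theta :: "nat \<Rightarrow> nat \<Rightarrow> (nat \<Rightarrow> nat \<Rightarrow> nat \<Rightarrow> real) \<Rightarrow> vec set \<Rightarrow> vec \<Rightarrow> nat \<Rightarrow> vec" where
  "theta n N C b t i = tensor n (representative b) (untrivialise n N C (representative b) t i)"

definition theta_inv :: "nat \<Rightarrow> nat \<Rightarrow> (nat \<Rightarrow> nat \<Rightarrow> nat \<Rightarrow> real) \<Rightarrow> vec set \<Rightarrow> (nat \<Rightarrow> vec) \<Rightarrow> vec" where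
  "theta_inv n N C b v = trivialise n N C (representative b) (\<lambda>l. cotensor n (representative b) (v l))"

lemma theta_in_rep [simp]: "theta n N C b t i \<in> topspace (rep (2 * n) (2 * n))"
  by (simp add: theta_def)

lemma theta_inv_in_rep [simp]: "theta_inv n N C b v \<in> topspace (rep N N)"
  by (simp add: theta_inv_def)

lemma cotensor_theta:
  "b \<in> topspace (projective_space n) \<Longrightarrow>
    cotensor n (representative b) (theta n N C b t i) = untrivialise n N C (representative b) t i"
  unfolding theta_def by (rule cotensor_tensor) (simp_all add: representative_projective_space)

lemma line_proj_theta:
  "b \<in> topspace (projective_space n) \<Longrightarrow> line_proj n (representative b) (theta n N C b t i) = theta n N C b t i"
  by (simp add: line_proj_def cotensor_theta) (simp add: theta_def)

lemma theta_inv_eqI: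
  assumes "orthogonal_family (2 * n) N C" "b \<in> topspace (projective_space n)" "t \<in> topspace (rep N N)"
    "\<And>i. i < N \<Longrightarrow> cotensor n (representative b) (v i) = untrivialise n N C (representative b) t i"
  shows "theta_inv n N C b v = t"
proof -
  have "theta_inv n N C b v = trivialise n N C (representative b) (untrivialise n N C (representative b) t)"
    unfolding theta_inv_def trivialise_def using assms(4) by (auto intro!: sum.cong)
  then show ?thesis
    using trivialise_untrivialise[OF assms(1) _ assms(3)] representative_projective_space(3)[OF assms(2)] by simp
qed

lemma theta_theta_inv:
  assumes "orthogonal_family (2 * n) N C" "b \<in> topspace (projective_space n)" "i < N"
  shows "theta n N C b (theta_inv n N C b v) i = line_proj n (representative b) (v i)"
  unfolding theta_def theta_inv_def line_proj_def
  by (subst untrivialise_trivialise[OF assms(1) representative_projective_space(3)[OF assms(2)] assms(3)]) simp_all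

lemma theta_flip:
  assumes "b \<in> topspace (projective_space n)"
  shows "theta n N C (flip ` b) (flip t) i = flip (theta n N C b t i)"
  unfolding theta_def
  by (subst even_representative_flip[of b n "\<lambda>x. tensor n x (untrivialise n N C x (flip t) i)", OF assms])
    (simp_all add: untrivialise_neg tensor_neg_neg untrivialise_flip flip_tensor)

lemma continuous_map_theta:
  "continuous_map (prod_topology (projective_space n) (rep N N)) (rep (2 * n) (2 * n)) (\<lambda>(b, t). theta n N C b t i)"
  unfolding theta_def
proof (rule continuous_map_descend[OF locally_compact_space_rep Hausdorff_space_rep])
  have fst: "continuous_map (prod_topology (unit_sphere n) (rep N N)) (rep n n) fst"
    by (rule continuous_map_unit_sphere_rep[OF continuous_map_fst])
  show "continuous_map (prod_topology (unit_sphere n) (rep N N)) (rep (2 * n) (2 * n))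
      (\<lambda>(x, t). tensor n x (untrivialise n N C x t i))"
    unfolding case_prod_unfold
    by (intro continuous_map_tensor[OF fst continuous_map_untrivialise[OF fst continuous_map_snd]])
qed (simp add: untrivialise_neg tensor_neg_neg)

lemma continuous_map_theta_inv:
  "continuous_map (prod_topology (projective_space n) (product_topology (\<lambda>_. rep (2 * n) (2 * n)) {..<N}))
     (rep N N) (\<lambda>(b, v). theta_inv n N C b v)"
  unfolding theta_inv_def
proof (rule continuous_map_descend)
  let ?V = "product_topology (\<lambda>_. rep (2 * n) (2 * n)) {..<N}"
  show "locally_compact_space ?V" "Hausdorff_space ?V"
    by (auto simp: locally_compact_space_product_topology Hausdorff_space_product_topology
        locally_compact_space_rep Hausdorff_space_rep)
  have fst: "continuous_map (prod_topology (unit_sphere n) ?V) (rep n n) fst"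
    by (rule continuous_map_unit_sphere_rep[OF continuous_map_fst])
  have snd: "continuous_map (prod_topology (unit_sphere n) ?V) (rep (2 * n) (2 * n)) (\<lambda>z. snd z l)" if "l < N" for l
    using continuous_map_compose[OF continuous_map_snd continuous_map_product_projection[of l "{..<N}" "\<lambda>_. rep (2 * n) (2 * n)"]] that
    by (simp add: o_def)
  show "continuous_map (prod_topology (unit_sphere n) ?V) (rep N N)
      (\<lambda>(x, v). trivialise n N C x (\<lambda>l. cotensor n x (v l)))"
    unfolding case_prod_unfold
    by (rule continuous_map_trivialise[OF fst continuous_map_cotensor[OF fst snd]])
qed (simp add: cotensor_neg trivialise_neg)

text \<open>All three cases of the theorem are instances of one recombination of summands inside
  \<open>V\<^sup>R\<close>, \<open>R = M + k'\<close>. On the source side, \<open>N\<rho>\<close> is trivialised as \<open>N\<xi>\<close> in the slots \<open>i < N\<close>, and the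
  \<open>k\<close> summands of the given bundle occupy the slots \<open>s \<le> i < s + k\<close>. On the target side, the first
  \<open>M\<close> slots are full copies of \<open>V = \<xi> \<oplus> \<xi>\<^sup>\<bottom>\<close>, and the others contain the target bundle. The
  hypothesis says that the contributions to each slot match.\<close>

lemma whitney_power_homeomorphism:
  fixes E :: "(vec set, 'e) c2_bundle" and E' :: "(vec set, 'f) c2_bundle"
  assumes E: "retract_bundle n c E enc dec" and E': "retract_bundle n c' E' enc' dec'"
    and C: "orthogonal_family (2 * n) N C"
    and R: "N \<le> M + k'" "s + k \<le> M + k'"
    and slots: "\<And>i. i < M + k' \<Longrightarrow>
      (i < N \<and> s \<le> i \<and> i < s + k \<and> i < M \<and> \<not> c) \<or>
      (i < N \<and> \<not> (s \<le> i \<and> i < s + k) \<and> M \<le> i \<and> c') \<or>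
      (N \<le> i \<and> s \<le> i \<and> i < s + k \<and> M \<le> i \<and> c' = c)"
  obtains h where
    "homeomorphic_map (prod_topology (rep N N) (total_pts (whitney_power k E)))
       (prod_topology (rep (2 * n * M) (2 * n * M)) (total_pts (whitney_power k' E'))) h"
    "\<And>t z. t \<in> topspace (rep N N) \<Longrightarrow> z \<in> topspace (total_pts (whitney_power k E)) \<Longrightarrow>
       h (flip t, total_act (whitney_power k E) z) = map_prod flip (total_act (whitney_power k' E')) (h (t, z))"
proof -
  interpret E: retract_bundle n c E enc dec by (rule E)
  interpret E': retract_bundle n c' E' enc' dec' by (rule E')
  let ?P = "projective_space n" and ?V = "rep (2 * n) (2 * n)"
  let ?W = "total_pts (whitney_power k E)" and ?W' = "total_pts (whitney_power k' E')"
  let ?X = "prod_topology (rep N N) ?W" and ?Y = "prod_topology (rep (2 * n * M) (2 * n * M)) ?W'"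
  \<comment> \<open>the content of slot \<open>i\<close>, computed from a point of the source and of the target; the maps \<open>f\<close> and
    \<open>g\<close> are mutually inverse because both preserve it\<close>
  define v where "v = (\<lambda>(t, b, e) i. add_vec (if i < N then theta n N C b t i else zero_vec)
      (if s \<le> i \<and> i < s + k then enc (e (i - s)) else zero_vec))"
  define v' :: "vec \<times> vec set \<times> (nat \<Rightarrow> 'f) \<Rightarrow> nat \<Rightarrow> vec"
    where "v' = (\<lambda>(t, b, e) i. if i < M then unpack n t i else enc' (e (i - M)))"
  define f where "f = (\<lambda>z. (pack n M (v z), (fst (snd z), \<lambda>i\<in>{..<k'}. dec' (fst (snd z), v z (M + i)))))"
  define g where "g = (\<lambda>y. (theta_inv n N C (fst (snd y)) (v' y), (fst (snd y), \<lambda>i\<in>{..<k}. dec (fst (snd y), v' y (s + i)))))"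
  have W: "b \<in> topspace ?P" "\<And>i. i < k \<Longrightarrow> e i \<in> topspace (total_pts E)" "\<And>i. i < k \<Longrightarrow> proj E (e i) = b"
    "e \<in> extensional {..<k}" if "(b, e) \<in> topspace ?W" for b e
    using that by (auto simp: E.topspace_whitney_power PiE_def)
  have W': "b \<in> topspace ?P" "\<And>i. i < k' \<Longrightarrow> e i \<in> topspace (total_pts E')" "\<And>i. i < k' \<Longrightarrow> proj E' (e i) = b"
    "e \<in> extensional {..<k'}" if "(b, e) \<in> topspace ?W'" for b e
    using that by (auto simp: E'.topspace_whitney_power PiE_def)
  have vV: "v (t, b, e) i \<in> topspace ?V" if "(b, e) \<in> topspace ?W" for t b e i
    using W(2)[OF that] E.enc_in by (auto simp: v_def)
  have v'V: "v' (t, b, e) i \<in> topspace ?V" if "(b, e) \<in> topspace ?W'" "i < M + k'" for t b e i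
    using W'(2)[OF that(1)] that(2) E'.enc_in by (auto simp: v'_def)
  have cont_v: "continuous_map ?X ?V (\<lambda>z. v z i)" for i
    unfolding v_def case_prod_unfold
  proof (intro continuous_map_add_vec)
    have "continuous_map ?X (prod_topology ?P (rep N N)) (\<lambda>z. (fst (snd z), fst z))"
      using continuous_map_compose[OF continuous_map_snd E.continuous_map_from_whitney_power(1)]
      by (intro continuous_map_pairedI continuous_map_fst) (simp add: o_def)
    from continuous_map_compose[OF this continuous_map_theta]
    show "continuous_map ?X ?V (\<lambda>z. if i < N then theta n N C (fst (snd z)) (fst z) i else zero_vec)"
      by (cases "i < N") (simp_all add: o_def)
    have cont: "continuous_map ?X ?V (\<lambda>z. enc (snd (snd z) (i - s)))" if "i - s < k"
      using continuous_map_compose[OF continuous_map_compose[OF continuous_map_snd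
            E.continuous_map_from_whitney_power(2)[OF that]] E.continuous_enc]
      by (simp add: o_def)
    show "continuous_map ?X ?V (\<lambda>z. if s \<le> i \<and> i < s + k then enc (snd (snd z) (i - s)) else zero_vec)"
    proof (cases "s \<le> i \<and> i < s + k")
      case True
      then have "i - s < k" by linarith
      then show ?thesis unfolding if_P[OF True] by (rule cont)
    next
      case False
      show ?thesis unfolding if_not_P[OF False] by simp
    qed
  qed
  have cont_v': "continuous_map ?Y ?V (\<lambda>y. v' y i)" if "i < M + k'" for i
  proof (cases "i < M")
    case True
    then show ?thesis
      unfolding v'_def case_prod_unfold using continuous_map_unpack[OF continuous_map_fst] by simp
  next
    case False
    then have "i - M < k'" using that by simp
    from continuous_map_compose[OF continuous_map_compose[OF continuous_map_snd
          E'.continuous_map_from_whitney_power(2)[OF this]] E'.continuous_enc]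
    show ?thesis
      unfolding v'_def case_prod_unfold using False by (simp add: o_def)
  qed
  have base: "continuous_map ?X ?P (\<lambda>z. fst (snd z))"
    using continuous_map_compose[OF continuous_map_snd E.continuous_map_from_whitney_power(1)] by (simp add: o_def)
  have base': "continuous_map ?Y ?P (\<lambda>z. fst (snd z))"
    using continuous_map_compose[OF continuous_map_snd E'.continuous_map_from_whitney_power(1)] by (simp add: o_def)
  have cont_f: "continuous_map ?X ?Y f"
    unfolding f_def
  proof (intro continuous_map_pairedI continuous_map_pack[OF cont_v] E'.continuous_map_whitney_powerI base)
    show "continuous_map ?X (total_pts E') (\<lambda>z. dec' (fst (snd z), v z (M + i)))" for i
      using continuous_map_compose[OF continuous_map_pairedI[OF base cont_v] E'.continuous_dec] by (simp add: o_def)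
    show "proj E' (dec' (fst (snd z), v z (M + i))) = fst (snd z)" if "z \<in> topspace ?X" for z i
      using that W(1) vV by (cases z) (auto intro!: E'.proj_dec)
  qed
  have cont_g: "continuous_map ?Y ?X g"
    unfolding g_def
  proof (intro continuous_map_pairedI E.continuous_map_whitney_powerI base')
    have "continuous_map ?Y (product_topology (\<lambda>_. ?V) {..<N}) (\<lambda>y. \<lambda>i\<in>{..<N}. v' y i)"
      using cont_v' R(1) by (auto simp: continuous_map_componentwise)
    from continuous_map_compose[OF continuous_map_pairedI[OF base' this] continuous_map_theta_inv]
    have "continuous_map ?Y (rep N N) (\<lambda>y. theta_inv n N C (fst (snd y)) (\<lambda>i\<in>{..<N}. v' y i))"
      by (simp add: o_def)
    moreover have "theta_inv n N C b (\<lambda>i\<in>{..<N}. w i) = theta_inv n N C b w" for b w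
      by (auto simp: theta_inv_def trivialise_def intro!: sum.cong)
    ultimately show "continuous_map ?Y (rep N N) (\<lambda>y. theta_inv n N C (fst (snd y)) (v' y))" by simp
    show "continuous_map ?Y (total_pts E) (\<lambda>z. dec (fst (snd z), v' z (s + i)))" if "i < k" for i
      using continuous_map_compose[OF continuous_map_pairedI[OF base' cont_v'] E.continuous_dec] that R(2)
      by (simp add: o_def)
    show "proj E (dec (fst (snd z), v' z (s + i))) = fst (snd z)" if "z \<in> topspace ?Y" "i < k" for z i
      using that W'(1) v'V R(2) by (cases z) (auto intro!: E.proj_dec)
  qed
  have unit: "dot n (representative b) (representative b) = 1" if "b \<in> topspace ?P" for b
    by (rule representative_projective_space(3)[OF that])
  have perp: "line_proj n (representative b) (enc e) = zero_vec" "cotensor n (representative b) (enc e) = zero_vec"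
    if "e \<in> topspace (total_pts E)" "proj E e = b" "\<not> c" for b e
  proof -
    have "enc e = diff_vec (enc e) (line_proj n (representative b) (enc e))"
      using E.fibre_proj_enc[OF that(1)] that by (simp add: fibre_proj_def)
    then have "cotensor n (representative b) (enc e) =
        diff_vec (cotensor n (representative b) (enc e)) (cotensor n (representative b) (enc e))"
      using cotensor_diff cotensor_line_proj unit E.proj_in[OF that(1)] that(2) by metis
    then show "cotensor n (representative b) (enc e) = zero_vec" by simp
    then show "line_proj n (representative b) (enc e) = zero_vec" by (simp add: line_proj_def)
  qed
  have line_proj_add: "line_proj n x (add_vec (tensor n x y) w) = tensor n x y"
    if "dot n x x = 1" "y \<in> topspace (rep 1 1)" "cotensor n x w = zero_vec" for x y w
    using cotensor_tensor[OF that(1,2)] that(3) by (simp add: line_proj_def cotensor_add)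
  have v_proj: "fibre_proj n c' b (v (t, b, e) i) = v (t, b, e) i"
    if be: "(b, e) \<in> topspace ?W" and i: "M \<le> i" "i < M + k'" for t b e i
  proof (cases "i < N")
    case True
    then have "v (t, b, e) i = theta n N C b t i" "c'"
      using slots[OF i(2)] i(1) by (auto simp: v_def)
    then show ?thesis using line_proj_theta[OF W(1)[OF be]] by (simp add: fibre_proj_def)
  next
    case False
    then have "s \<le> i" "i - s < k" "c' = c" "v (t, b, e) i = enc (e (i - s))"
      using slots[OF i(2)] by (auto simp: v_def)
    then show ?thesis
      using E.fibre_proj_enc[OF W(2)[OF be]] W(3)[OF be] by simp
  qed
  have v'_f: "v' (f (t, b, e)) i = v (t, b, e) i"
    if be: "(b, e) \<in> topspace ?W" and i: "i < M + k'" for t b e i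
  proof (cases "i < M")
    case True
    then show ?thesis using vV[OF be] by (simp add: v'_def f_def unpack_pack)
  next
    case False
    then have "i - M < k'" using i by linarith
    then show ?thesis
      using False E'.enc_dec[OF W(1)[OF be] vV[OF be]] v_proj[OF be _ i] by (simp add: v'_def f_def)
  qed
  have gf: "g (f (t, b, e)) = (t, b, e)" if t: "t \<in> topspace (rep N N)" and be: "(b, e) \<in> topspace ?W" for t b e
  proof -
    note b = W(1)[OF be]
    \<comment> \<open>the summand from \<open>\<xi>\<^sup>\<bottom>\<close> in a slot is invisible to the adjoint of \<open>y \<mapsto> x \<otimes> y\<close>\<close>
    have "theta_inv n N C b (v' (f (t, b, e))) = t"
    proof (rule theta_inv_eqI[OF C b t])
      fix i assume i: "i < N"
      then have "cotensor n (representative b) (v (t, b, e) i) = untrivialise n N C (representative b) t i"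
        using slots[of i] R(1) cotensor_theta[OF b] perp(2)[OF W(2)[OF be] W(3)[OF be], of "i - s"]
        by (auto simp: v_def cotensor_add)
      then show "cotensor n (representative b) (v' (f (t, b, e)) i) = untrivialise n N C (representative b) t i"
        using v'_f[OF be] i R(1) by simp
    qed
    moreover have "dec (b, v' (f (t, b, e)) (s + i)) = e i" if i: "i < k" for i
    proof -
      have si: "s + i < M + k'" using i R(2) by simp
      have "fibre_proj n c b (v (t, b, e) (s + i)) = enc (e i)"
      proof (cases "s + i < N")
        case True
        then have "\<not> c" using slots[OF si] i by auto
        moreover have "v (t, b, e) (s + i) = add_vec (theta n N C b t (s + i)) (enc (e i))"
          using True i by (simp add: v_def)
        moreover have "line_proj n (representative b) (add_vec (theta n N C b t (s + i)) (enc (e i))) = theta n N C b t (s + i)"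
          unfolding theta_def
          by (rule line_proj_add[OF unit[OF b]]) (simp_all add: perp(2)[OF W(2)[OF be i] W(3)[OF be i] \<open>\<not> c\<close>])
        ultimately show ?thesis by (simp add: fibre_proj_def add_diff_add_vec)
      next
        case False
        then show ?thesis
          using E.fibre_proj_enc[OF W(2)[OF be i]] W(3)[OF be i] i by (simp add: v_def)
      qed
      then have "dec (proj E (e i), v (t, b, e) (s + i)) = e i"
        using W(2,3)[OF be i] vV[OF be] by (intro E.dec_eqI) auto
      then show ?thesis using v'_f[OF be si] W(3)[OF be i] by simp
    qed
    then have "(\<lambda>i\<in>{..<k}. dec (b, v' (f (t, b, e)) (s + i))) = e"
      using W(4)[OF be] by (auto simp: fun_eq_iff extensional_def)
    moreover have "fst (snd (f (t, b, e))) = b" by (simp add: f_def)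
    ultimately show ?thesis by (simp add: g_def)
  qed
  have v_g: "v (g (t, b, e)) i = v' (t, b, e) i"
    if be: "(b, e) \<in> topspace ?W'" and i: "i < M + k'" for t b e i
  proof -
    note b = W'(1)[OF be]
    let ?w = "v' (t, b, e)"
    have w: "?w i \<in> topspace ?V" by (rule v'V[OF be i])
    have th: "i < N \<Longrightarrow> theta n N C b (theta_inv n N C b ?w) i = line_proj n (representative b) (?w i)"
      by (rule theta_theta_inv[OF C b])
    have en: "s \<le> i \<Longrightarrow> i < s + k \<Longrightarrow> enc ((\<lambda>i\<in>{..<k}. dec (b, ?w (s + i))) (i - s)) = fibre_proj n c b (?w i)"
      using E.enc_dec[OF b w] by (simp add: less_diff_conv2)
    have proj': "M \<le> i \<Longrightarrow> fibre_proj n c' b (?w i) = ?w i"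
      using E'.fibre_proj_enc[OF W'(2)[OF be], of "i - M"] W'(3)[OF be, of "i - M"] i by (simp add: v'_def)
    from slots[OF i] show ?thesis
    proof (elim disjE conjE)
      assume "i < N" "s \<le> i" "i < s + k" "\<not> c"
      then show ?thesis using th en by (simp add: v_def g_def fibre_proj_def)
    next
      assume "i < N" "\<not> (s \<le> i \<and> i < s + k)" "M \<le> i" "c'"
      then show ?thesis using th proj' by (auto simp: v_def g_def fibre_proj_def)
    next
      assume "N \<le> i" "s \<le> i" "i < s + k" "M \<le> i" "c' = c"
      then show ?thesis using en proj' by (simp add: v_def g_def)
    qed
  qed
  have fg: "f (g (t, b, e)) = (t, b, e)"
    if t: "t \<in> topspace (rep (2 * n * M) (2 * n * M))" and be: "(b, e) \<in> topspace ?W'" for t b e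
  proof -
    have "pack n M (v (g (t, b, e))) = pack n M (unpack n t)"
      by (rule pack_cong) (simp add: v_g[OF be] v'_def)
    then have "pack n M (v (g (t, b, e))) = t" using pack_unpack[OF t] by simp
    moreover have "dec' (b, v (g (t, b, e)) (M + i)) = e i" if i: "i < k'" for i
      using E'.dec_enc[OF W'(2)[OF be i]] W'(3)[OF be i] v_g[OF be, of "M + i"] i by (simp add: v'_def)
    then have "(\<lambda>i\<in>{..<k'}. dec' (b, v (g (t, b, e)) (M + i))) = e"
      using W'(4)[OF be] by (auto simp: fun_eq_iff extensional_def)
    moreover have "fst (snd (g (t, b, e))) = b" by (simp add: g_def)
    ultimately show ?thesis by (simp add: f_def)
  qed
  have "homeomorphic_maps ?X ?Y f g"
    unfolding homeomorphic_maps_def using cont_f cont_g gf fg by auto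
  then have h: "homeomorphic_map ?X ?Y f" by (auto simp: homeomorphic_map_maps)
  have "f (flip t, total_act (whitney_power k E) z) = map_prod flip (total_act (whitney_power k' E')) (f (t, z))"
    if t: "t \<in> topspace (rep N N)" and z: "z \<in> topspace ?W" for t z
  proof -
    obtain b e where be: "z = (b, e)" by (cases z)
    note be' = z[unfolded be]
    let ?e = "\<lambda>i\<in>{..<k}. total_act E (e i)"
    have act: "total_act (whitney_power k E) z = (flip ` b, ?e)"
      by (simp add: be whitney_power_def E.base_act)
    have "v (flip t, flip ` b, ?e) i = flip (v (t, b, e) i)" for i
    proof -
      have "s \<le> i \<and> i < s + k \<Longrightarrow> enc (?e (i - s)) = flip (enc (e (i - s)))"
        using E.enc_act[OF W(2)[OF be'], of "i - s"] by (simp add: less_diff_conv2)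
      then show ?thesis
        using theta_flip[OF W(1)[OF be']] by (simp add: v_def flip_add_vec)
    qed
    then have v_act: "v (flip t, flip ` b, ?e) = (\<lambda>i. flip (v (t, b, e) i))" by (rule ext)
    have "dec' (flip ` b, flip (v (t, b, e) (M + i))) = total_act E' (dec' (b, v (t, b, e) (M + i)))" if "i < k'" for i
      using E'.act_dec[OF W(1)[OF be'] vV[OF be'] v_proj[OF be']] that by simp
    then have "(\<lambda>i\<in>{..<k'}. dec' (flip ` b, flip (v (t, b, e) (M + i)))) =
        (\<lambda>i\<in>{..<k'}. total_act E' ((\<lambda>i\<in>{..<k'}. dec' (b, v (t, b, e) (M + i))) i))"
      by (auto simp: fun_eq_iff)
    then show ?thesis
      unfolding act by (simp add: f_def v_act be flip_pack whitney_power_def E'.base_act)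
  qed
  then show thesis using that h by blast
qed

lemma suspension_thom_spectrum_equivalent:
  fixes E :: "(vec set, 'e) c2_bundle" and E' :: "(vec set, 'f) c2_bundle"
  assumes E: "retract_bundle n c E enc dec" and E': "retract_bundle n c' E' enc' dec'"
    and C: "orthogonal_family (2 * n) N C"
    and R: "N \<le> M + k'" "s + k \<le> M + k'"
    and slots: "\<And>i. i < M + k' \<Longrightarrow>
      (i < N \<and> s \<le> i \<and> i < s + k \<and> i < M \<and> \<not> c) \<or>
      (i < N \<and> \<not> (s \<le> i \<and> i < s + k) \<and> M \<le> i \<and> c') \<or>
      (N \<le> i \<and> s \<le> i \<and> i < s + k \<and> M \<le> i \<and> c' = c)"
  shows "suspension N (thom_spectrum (whitney_power k E) (2 * n * M + q)) \<simeq>\<^sub>s thom_spectrum (whitney_power k' E') q"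
proof -
  obtain h where h:
    "homeomorphic_map (prod_topology (rep N N) (total_pts (whitney_power k E)))
       (prod_topology (rep (2 * n * M) (2 * n * M)) (total_pts (whitney_power k' E'))) h"
    "\<And>t z. t \<in> topspace (rep N N) \<Longrightarrow> z \<in> topspace (total_pts (whitney_power k E)) \<Longrightarrow>
       h (flip t, total_act (whitney_power k E) z) = map_prod flip (total_act (whitney_power k' E')) (h (t, z))"
    by (rule whitney_power_homeomorphism[OF assms]) blast+
  show ?thesis
    unfolding thom_spectrum_def
    by (rule suspension_shifted_suspension_spectrum_equivalent[OF
          retract_bundle.compactifies_thom_space_whitney_power[OF E]
          retract_bundle.compactifies_thom_space_whitney_power[OF E'] h])
qed

theorem theorem2:
  fixes n :: nat and k :: int
  assumes "n > 1"
  shows "suspension (2 ^ \<phi> (2 * n - 1)) (stunted_projective_spectrum n k)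
           \<simeq>\<^sub>s stunted_projective_spectrum n (k + 2 ^ \<phi> (2 * n - 1))"
proof -
  define N :: nat where "N = 2 ^ \<phi> (2 * n - 1)"
  have N: "(2::int) ^ \<phi> (2 * n - 1) = int N" "0 < N" by (simp_all add: N_def)
  obtain C where C: "orthogonal_family (2 * n) N C"
    using orthogonal_family_exists[of n] assms by (auto simp: N_def)
  obtain enc dec where taut: "retract_bundle n True (tautological_bundle n) enc dec"
    using retract_bundle_tautological by blast
  obtain enc' dec' where comp: "retract_bundle n False (complement_bundle n) enc' dec'"
    using retract_bundle_complement by blast
  consider "0 \<le> k" | "k < 0" "0 \<le> k + int N" | "k < 0" "k + int N < 0" by linarith
  then have "suspension N (stunted_projective_spectrum n k) \<simeq>\<^sub>s stunted_projective_spectrum n (k + int N)"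
  proof cases
    case 1
    \<comment> \<open>\<open>N\<rho> \<oplus> k\<xi> = (k+N)\<xi>\<close>\<close>
    have "suspension N (thom_spectrum (whitney_power (nat k) (tautological_bundle n)) (2 * n * 0 + 0)) \<simeq>\<^sub>s
        thom_spectrum (whitney_power (N + nat k) (tautological_bundle n)) 0"
      by (rule suspension_thom_spectrum_equivalent[OF taut taut C, where s = N]) auto
    moreover have "nat (k + int N) = N + nat k" using 1 by simp
    ultimately show ?thesis using 1 by (simp add: stunted_projective_spectrum_def)
  next
    case 2
    define l where "l = nat (- k)"
    have l: "l \<le> N" "nat (k + int N) = N - l" using 2 by (auto simp: l_def)
    \<comment> \<open>\<open>N\<rho> \<oplus> l\<xi>\<^sup>\<bottom> = 2nl\<rho> \<oplus> (N-l)\<xi>\<close>\<close>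
    have "suspension N (thom_spectrum (whitney_power l (complement_bundle n)) (2 * n * l + 0)) \<simeq>\<^sub>s
        thom_spectrum (whitney_power (N - l) (tautological_bundle n)) 0"
      by (rule suspension_thom_spectrum_equivalent[OF comp taut C, where s = 0]) (use l in auto)
    then show ?thesis using 2 l by (simp add: stunted_projective_spectrum_def l_def)
  next
    case 3
    define l where "l = nat (- k)"
    have l: "N \<le> l" "nat (- (k + int N)) = l - N" "2 * n * N + 2 * n * (l - N) = 2 * n * l"
      using 3 by (auto simp: l_def simp flip: distrib_left)
    \<comment> \<open>\<open>N\<rho> \<oplus> l\<xi>\<^sup>\<bottom> = 2nN\<rho> \<oplus> (l-N)\<xi>\<^sup>\<bottom>\<close>\<close>
    have "suspension N (thom_spectrum (whitney_power l (complement_bundle n)) (2 * n * N + 2 * n * (l - N))) \<simeq>\<^sub>s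
        thom_spectrum (whitney_power (l - N) (complement_bundle n)) (2 * n * (l - N))"
      by (rule suspension_thom_spectrum_equivalent[OF comp comp C, where s = 0]) (use l in auto)
    then show ?thesis using 3 l(2) unfolding l(3) by (simp add: stunted_projective_spectrum_def l_def)
  qed
  then show ?thesis by (simp only: N N_def[symmetric])
qed

end
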